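(* Let $M$ be a complex left $W^a$-module and $k$ a ($W^a$-invariant) multiplicity function on $R^a$. The assignments $$v\mapsto \partial_v\otimes\mathrm{Id}_M\quad(v\in V),\qquad s_a\mapsto s_a\otimes s_a-k_aI(a)\otimes\mathrm{Id}_M\quad(a\in F^a),\qquad \omega\mapsto\omega\otimes\omega\quad(\omega\in\Omega)$$ uniquely extend to an algebra homomorphism $Q_{k,M}: A(k)\rightarrow \mathrm{End}_{\mathbb{C}}\bigl(C^\omega(V)\otimes_{\mathbb{C}}M\bigr)$.
   Context: Root data. $V$ is a finite-dimensional real Euclidean vector space, $V^*$ its dual with the induced scalar product, $V_{\mathbb{C}},V_{\mathbb{C}}^*$ the complexifications. $R\subset V^*$ is a reduced crystallographic root system, irreducible in its span (it need not span $V^*$). For $0\ne\xi\in V^*$, $\xi^\vee\in V$ is defined by $\eta(\xi^\vee)=2\langle\eta,\xi\rangle/\langle\xi,\xi\rangle$ for all $\eta\in V^*$. $W\subset O(V)$ is the Weyl group generated by $s_\alpha(v)=v-\alpha(v)\alpha^\vee$ ($\alpha\in R$). $X\subset V^*$ is a full lattice containing the root lattice $Q=\mathbb{Z}R$ and such that its dual lattice $Y=\{y\in V\mid \xi(y)\in\mathbb{Z}\ \forall \xi\in X\}$ contains the co-root lattice $Q^\vee=\mathbb{Z}R^\vee$. $t_y(v)=v+y$; $W^a=W\ltimes Y=\{wt_y\}$ is the extended affine Weyl group, acting on $V$ by isometries; $D:W^a\to W$, $D(wt_y)=w$. $R^a=\{\alpha+m1\mid\alpha\in R,m\in\mathbb{Z}\}$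 is the affine root system, $a=\alpha+m1$ being the function $a(v)=\alpha(v)+m$ on $V$; $Da:=\alpha$, $Da^\vee:=\alpha^\vee$. $W^a$ acts on $R^a$ by $(wa)(v)=a(w^{-1}v)$. $s_a(v)=v-a(v)Da^\vee$, an element of $W^a$. Fix a basis $F$ of $R$ with positive/negative roots $R^\pm$ and highest root $\theta$; $a_0=-\theta+1$, $F^a=F\cup\{a_0\}$, $R^{a,+}=(R+\mathbb{Z}_{>0}1)\cup R^+$, $R^{a,-}=-R^{a,+}$; $l(w)=\#(R^{a,+}\cap w^{-1}R^{a,-})$ and $\Omega=\{w\in W^a\mid l(w)=0\}$. A multiplicity function is a $W^a$-invariant function $k:R^a\to\mathbb{C}$, $a\mapsto k_a$. Algebra $A(k)$: the unital associative $\mathbb{C}$-algebra containing $S(V_{\mathbb{C}})$ and $\mathbb{C}[W^a]$ as subalgebras, such that multiplication $S(V_{\mathbb{C}})\otimes_{\mathbb{C}}\mathbb{C}[W^a]\to A(k)$ is a linear isomorphism, with relations $s_a\cdot v-s_{Da}(v)\cdot s_a=-k_a\,Da(v)$ ($a\in F^a$, $v\in V_{\mathbb{C}}$) and $\omega\cdot v=(D\omega)(v)\cdot\omega$ ($\omega\in\Omega$, $v\in V_{\mathbb{C}}$). $C^\omega(V)$ is the space of complex-valued real analytic functions on $V$, with $W^a$-action $(wf)(v)=f(w^{-1}v)$; $\partial_v$ is the directional derivative. In $g\otimes h$ with $g,h\in W^a$, the first factor acts on $C^\omega(V)$ by this action and the second on $M$ by the module action. For $a\in R^a$ the integral operator $I(a)$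 on $C^\omega(V)$ is $$(I(a)f)(v)=\int_0^{a(v)}f(v-tDa^\vee)\,dt.$$ *)

theory Defs
  imports
    "HOL-Analysis.Analysis"
    "HOL-Library.Poly_Mapping"
    "HOL-Library.Multiset"
begin

section \<open>Complex vector spaces and algebras\<close>

class scaleC =
  fixes scaleC :: "complex \<Rightarrow> 'a \<Rightarrow> 'a" (infixr \<open>*\<^sub>C\<close> 75)

class complex_vector = scaleC + ab_group_add +
  assumes scaleC_add_right: "a *\<^sub>C (x + y) = a *\<^sub>C x + a *\<^sub>C y"
    and scaleC_add_left: "(a + b) *\<^sub>C x = a *\<^sub>C x + b *\<^sub>C x"
    and scaleC_scaleC: "a *\<^sub>C b *\<^sub>C x = (a * b) *\<^sub>C x"
    and scaleC_one: "1 *\<^sub>C x = x"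

class complex_algebra_1 = complex_vector + ring_1 +
  assumes mult_scaleC_left: "(a *\<^sub>C x) * y = a *\<^sub>C (x * y)"
    and mult_scaleC_right: "x * (a *\<^sub>C y) = a *\<^sub>C (x * y)"

global_interpretation complex_vector: vector_space "scaleC :: complex \<Rightarrow> 'a \<Rightarrow> 'a::complex_vector"
  by unfold_locales (simp_all add: scaleC_add_right scaleC_add_left scaleC_scaleC scaleC_one)

abbreviation cspan :: "'a::complex_vector set \<Rightarrow> 'a set"
  where "cspan \<equiv> complex_vector.span"

abbreviation clinear :: "('a::complex_vector \<Rightarrow> 'b::complex_vector) \<Rightarrow> bool"
  where "clinear \<equiv> Vector_Spaces.linear scaleC scaleC"

definition algebra_hom_on :: "'a::complex_algebra_1 set \<Rightarrow> ('a \<Rightarrow> 'b::complex_algebra_1) \<Rightarrow> bool"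
  where "algebra_hom_on S h \<longleftrightarrow>
    h 1 = 1 \<and>
    (\<forall>x\<in>S. \<forall>y\<in>S. h (x + y) = h x + h y \<and> h (x * y) = h x * h y) \<and>
    (\<forall>c. \<forall>x\<in>S. h (c *\<^sub>C x) = c *\<^sub>C h x)"

text \<open>A homomorphism of unital algebras from \<open>'a\<close> to the algebra of \<open>\<complex>\<close>-linear endomorphisms
  of \<open>'t\<close>, with pointwise linear structure and composition as product.\<close>

definition algebra_hom_End :: "('a::complex_algebra_1 \<Rightarrow> 't::complex_vector \<Rightarrow> 't) \<Rightarrow> bool"
  where "algebra_hom_End Q \<longleftrightarrow>
    (\<forall>x. clinear (Q x)) \<and>
    Q 1 = id \<and>
    (\<forall>x y. Q (x + y) = (\<lambda>t. Q x t + Q y t)) \<and>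
    (\<forall>c x. Q (c *\<^sub>C x) = (\<lambda>t. c *\<^sub>C Q x t)) \<and>
    (\<forall>x y. Q (x * y) = Q x \<circ> Q y)"

instantiation complex :: complex_algebra_1
begin

definition scaleC_complex :: "complex \<Rightarrow> complex \<Rightarrow> complex"
  where "scaleC_complex a x = a * x"

instance
  by standard (simp_all add: scaleC_complex_def algebra_simps)

end

instantiation poly_mapping :: (type, complex_vector) complex_vector
begin

lift_definition scaleC_poly_mapping :: "complex \<Rightarrow> ('a \<Rightarrow>\<^sub>0 'b) \<Rightarrow> ('a \<Rightarrow>\<^sub>0 'b)"
  is "\<lambda>c f x. c *\<^sub>C f x"
  by (erule rev_finite_subset) auto

instance
  by standard (transfer; simp add: fun_eq_iff scaleC_add_right scaleC_add_left scaleC_scaleC scaleC_one)+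

end

instance poly_mapping :: (monoid_add, complex_algebra_1) complex_algebra_1
proof
  have scale: "c *\<^sub>C z = (c *\<^sub>C 1) * z" "x * ((c *\<^sub>C 1) * z) = (c *\<^sub>C 1) * (x * z)"
    for c and x z :: 'b
    by (simp_all add: mult_scaleC_left mult_scaleC_right)
  fix c and x y :: "'a \<Rightarrow>\<^sub>0 'b"
  show "(c *\<^sub>C x) * y = c *\<^sub>C (x * y)"
  proof transfer
    fix c and f g :: "'a \<Rightarrow> 'b"
    assume f: "finite {x. f x \<noteq> 0}" and g: "finite {x. g x \<noteq> 0}"
    have fin: "finite {l. f l * S l \<noteq> 0}" for S
      by (rule finite_subset[OF _ f]) auto
    show "prod_fun (\<lambda>x. c *\<^sub>C f x) g = (\<lambda>k. c *\<^sub>C prod_fun f g k)"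
      unfolding prod_fun_def mult_scaleC_left
      by (subst (1 2) scale(1)) (simp add: Sum_any_right_distrib[OF fin])
  qed
  show "x * (c *\<^sub>C y) = c *\<^sub>C (x * y)"
  proof transfer
    fix c and f g :: "'a \<Rightarrow> 'b"
    assume f: "finite {x. f x \<noteq> 0}" and g: "finite {x. g x \<noteq> 0}"
    have fin: "finite {l. f l * S l \<noteq> 0}" for S
      by (rule finite_subset[OF _ f]) auto
    have fin': "finite {q. (g q when P q) \<noteq> 0}" for P
      by (rule finite_subset[OF _ g]) (auto simp: when_def)
    have "(\<Sum>q. (c *\<^sub>C g q when P q)) = (c *\<^sub>C 1) * (\<Sum>q. (g q when P q))" for P
      by (subst scale(1)) (simp add: Sum_any_right_distrib[OF fin'] mult_when)
    then show "prod_fun f (\<lambda>x. c *\<^sub>C g x) = (\<lambda>k. c *\<^sub>C prod_fun f g k)"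
      unfolding prod_fun_def
      by (subst scale(1)) (simp add: Sum_any_right_distrib[OF fin] scale(2))
  qed
qed


section \<open>Tensor products over the complex numbers\<close>

inductive_set tensor_relations :: "('a::complex_vector \<times> 'b::complex_vector \<Rightarrow>\<^sub>0 complex) set" where
  "Poly_Mapping.single (x + x', y) 1 - Poly_Mapping.single (x, y) 1 - Poly_Mapping.single (x', y) 1
    \<in> tensor_relations"
| "Poly_Mapping.single (x, y + y') 1 - Poly_Mapping.single (x, y) 1 - Poly_Mapping.single (x, y') 1
    \<in> tensor_relations"
| "Poly_Mapping.single (c *\<^sub>C x, y) 1 - c *\<^sub>C Poly_Mapping.single (x, y) 1 \<in> tensor_relations"
| "Poly_Mapping.single (x, c *\<^sub>C y) 1 - c *\<^sub>C Poly_Mapping.single (x, y) 1 \<in> tensor_relations"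

quotient_type (overloaded) ('a, 'b) ctensor =
  "('a::complex_vector \<times> 'b::complex_vector) \<Rightarrow>\<^sub>0 complex"
  / "\<lambda>s t. s - t \<in> cspan tensor_relations"
proof (rule equivpI)
  show "reflp (\<lambda>s t. s - t \<in> cspan tensor_relations)"
    by (auto intro!: reflpI complex_vector.span_zero)
  show "symp (\<lambda>s t. s - t \<in> cspan tensor_relations)"
    by (auto intro!: sympI dest: complex_vector.span_neg)
  show "transp (\<lambda>s t. s - t \<in> cspan tensor_relations)"
    by (auto intro!: transpI dest: complex_vector.span_add)
qed

instantiation ctensor :: (complex_vector, complex_vector) complex_vector
begin

lift_definition zero_ctensor :: "('a, 'b) ctensor" is 0 .

lift_definition plus_ctensor :: "('a, 'b) ctensor \<Rightarrow> ('a, 'b) ctensor \<Rightarrow> ('a, 'b) ctensor" is "(+)"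
  by (drule (1) complex_vector.span_add) (simp add: algebra_simps)

lift_definition minus_ctensor :: "('a, 'b) ctensor \<Rightarrow> ('a, 'b) ctensor \<Rightarrow> ('a, 'b) ctensor" is "(-)"
  by (drule (1) complex_vector.span_diff) (simp add: algebra_simps)

lift_definition uminus_ctensor :: "('a, 'b) ctensor \<Rightarrow> ('a, 'b) ctensor" is uminus
  by (drule complex_vector.span_neg) simp

lift_definition scaleC_ctensor :: "complex \<Rightarrow> ('a, 'b) ctensor \<Rightarrow> ('a, 'b) ctensor" is scaleC
  by (drule complex_vector.span_scale) (simp add: complex_vector.scale_right_diff_distrib)

instance
  by standard
    (transfer; simp add: algebra_simps complex_vector.span_zero
      scaleC_add_right scaleC_add_left scaleC_scaleC scaleC_one)+

end

lift_definition tensor :: "'a::complex_vector \<Rightarrow> 'b::complex_vector \<Rightarrow> ('a, 'b) ctensor"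
    (infixr \<open>\<otimes>\<^sub>C\<close> 70)
  is "\<lambda>x y. Poly_Mapping.single (x, y) 1" .

text \<open>The tensor product of subspaces, as a subspace of the ambient tensor product.\<close>

definition subspace_tensor ::
    "'a::complex_vector set \<Rightarrow> 'b::complex_vector set \<Rightarrow> ('a, 'b) ctensor set"
  where "subspace_tensor U U' = cspan {x \<otimes>\<^sub>C y | x y. x \<in> U \<and> y \<in> U'}"

lemma tensor_bilinear:
  "(x + x') \<otimes>\<^sub>C y = x \<otimes>\<^sub>C y + x' \<otimes>\<^sub>C y" "x \<otimes>\<^sub>C (y + y') = x \<otimes>\<^sub>C y + x \<otimes>\<^sub>C y'"
  "(c *\<^sub>C x) \<otimes>\<^sub>C y = c *\<^sub>C (x \<otimes>\<^sub>C y)" "x \<otimes>\<^sub>C (c *\<^sub>C y) = c *\<^sub>C (x \<otimes>\<^sub>C y)"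
proof -
  show "(x + x') \<otimes>\<^sub>C y = x \<otimes>\<^sub>C y + x' \<otimes>\<^sub>C y"
    by transfer (unfold diff_diff_add[symmetric], intro complex_vector.span_base tensor_relations.intros)
  show "x \<otimes>\<^sub>C (y + y') = x \<otimes>\<^sub>C y + x \<otimes>\<^sub>C y'"
    by transfer (unfold diff_diff_add[symmetric], intro complex_vector.span_base tensor_relations.intros)
  show "(c *\<^sub>C x) \<otimes>\<^sub>C y = c *\<^sub>C (x \<otimes>\<^sub>C y)"
    by transfer (intro complex_vector.span_base tensor_relations.intros)
  show "x \<otimes>\<^sub>C (c *\<^sub>C y) = c *\<^sub>C (x \<otimes>\<^sub>C y)"
    by transfer (intro complex_vector.span_base tensor_relations.intros)
qed

lemma single_eq_scaleC: "Poly_Mapping.single z c = c *\<^sub>C Poly_Mapping.single z (1::complex)"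
  by (rule poly_mapping_eqI)
    (simp add: scaleC_poly_mapping.rep_eq scaleC_complex_def lookup_single when_def)

lemma poly_mapping_add_induct [case_names single sum]:
  assumes "\<And>z c. P (Poly_Mapping.single z c)" and "\<And>p q. P p \<Longrightarrow> P q \<Longrightarrow> P (p + q)"
  shows "P (p :: 'a \<Rightarrow>\<^sub>0 'b::monoid_add)"
proof (induction p rule: Poly_Mapping.update_induct)
  case const
  show ?case using assms(1)[of _ 0] by simp
next
  case (update p z c)
  then have "Poly_Mapping.update z c p = p + Poly_Mapping.single z c"
    by (intro poly_mapping_eqI) (auto simp: lookup_update lookup_add lookup_single in_keys_iff)
  then show ?case using assms update by simp
qed

lemma ctensor_induct [case_names add scaleC]:
  assumes "\<And>s t. P s \<Longrightarrow> P t \<Longrightarrow> P (s + t)" and "\<And>c x y. P (c *\<^sub>C (x \<otimes>\<^sub>C y))"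
  shows "P t"
proof (induction t rule: ctensor.abs_induct)
  fix p :: "'a \<times> 'b \<Rightarrow>\<^sub>0 complex"
  show "P (abs_ctensor p)"
  proof (induction p rule: poly_mapping_add_induct)
    case (single z c)
    have "abs_ctensor (Poly_Mapping.single z c) = c *\<^sub>C (fst z \<otimes>\<^sub>C snd z)"
      by (subst single_eq_scaleC) (simp add: tensor.abs_eq scaleC_ctensor.abs_eq)
    then show ?case by (simp add: assms(2))
  next
    case (sum p q)
    then have "P (abs_ctensor p + abs_ctensor q)" by (intro assms(1))
    then show ?case by (simp add: plus_ctensor.abs_eq)
  qed
qed

text \<open>The operator \<open>f \<otimes> g\<close>; meaningful for linear \<open>f\<close> and \<open>g\<close> (see \<open>ex1_tensor_map\<close>).\<close>

definition tensor_map ::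
    "('a::complex_vector \<Rightarrow> 'c::complex_vector) \<Rightarrow> ('b::complex_vector \<Rightarrow> 'd::complex_vector) \<Rightarrow>
     ('a, 'b) ctensor \<Rightarrow> ('c, 'd) ctensor"
  where "tensor_map f g = (THE h. clinear h \<and> (\<forall>x y. h (x \<otimes>\<^sub>C y) = f x \<otimes>\<^sub>C g y))"

lemma ex1_tensor_map:
  fixes f :: "'a::complex_vector \<Rightarrow> 'c::complex_vector"
    and g :: "'b::complex_vector \<Rightarrow> 'd::complex_vector"
  assumes f: "clinear f" and g: "clinear g"
  shows "\<exists>!h :: ('a, 'b) ctensor \<Rightarrow> ('c, 'd) ctensor.
    clinear h \<and> (\<forall>x y. h (x \<otimes>\<^sub>C y) = f x \<otimes>\<^sub>C g y)"
proof (rule ex_ex1I)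
  interpret f: Vector_Spaces.linear scaleC scaleC f by (rule f)
  interpret g: Vector_Spaces.linear scaleC scaleC g by (rule g)
  define H where "H p = (\<Sum>z\<in>Poly_Mapping.keys p. Poly_Mapping.lookup p z *\<^sub>C (f (fst z) \<otimes>\<^sub>C g (snd z)))"
    for p :: "'a \<times> 'b \<Rightarrow>\<^sub>0 complex"
  have H_sum: "H p = (\<Sum>z\<in>A. Poly_Mapping.lookup p z *\<^sub>C (f (fst z) \<otimes>\<^sub>C g (snd z)))"
    if "finite A" "Poly_Mapping.keys p \<subseteq> A" for p A
    unfolding H_def using that by (intro sum.mono_neutral_left) (auto simp: in_keys_iff)
  have H_add: "H (p + q) = H p + H q" for p q
  proof -
    let ?A = "Poly_Mapping.keys p \<union> Poly_Mapping.keys q"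
    have "finite ?A" by simp
    moreover have "Poly_Mapping.keys (p + q) \<subseteq> ?A" by (rule Poly_Mapping.keys_add)
    ultimately show ?thesis
      using H_sum[of ?A p] H_sum[of ?A q] H_sum[of ?A "p + q"]
      by (simp add: lookup_add scaleC_add_left sum.distrib)
  qed
  have H_scale: "H (c *\<^sub>C p) = c *\<^sub>C H p" for c p
  proof -
    have "Poly_Mapping.keys (c *\<^sub>C p) \<subseteq> Poly_Mapping.keys p"
      by (auto simp: in_keys_iff scaleC_poly_mapping.rep_eq)
    then show ?thesis
      using H_sum[of "Poly_Mapping.keys p" "c *\<^sub>C p"]
      by (simp add: H_def scaleC_poly_mapping.rep_eq scaleC_complex_def complex_vector.scale_sum_right
          scaleC_scaleC)
  qed
  have lin_H: "clinear H"
    by unfold_locales (simp_all add: H_add H_scale)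
  interpret H: Vector_Spaces.linear scaleC scaleC H by (rule lin_H)
  have H_single: "H (Poly_Mapping.single (x, y) 1) = f x \<otimes>\<^sub>C g y" for x y
    by (simp add: H_def scaleC_one)
  have "H r = 0" if "r \<in> tensor_relations" for r
    using that
    by cases (simp_all add: H.diff H.scale H_single f.add f.scale g.add g.scale tensor_bilinear)
  then have H_0: "H r = 0" if "r \<in> cspan tensor_relations" for r
    using H.eq_0_on_span[OF _ that] by blast
  define h where "h t = H (rep_ctensor t)" for t
  have h_abs: "h (abs_ctensor p) = H p" for p
  proof -
    have "rep_ctensor (abs_ctensor p) - p \<in> cspan tensor_relations"
      by (rule Quotient_rep_abs[OF Quotient_ctensor, simplified]) (simp add: complex_vector.span_zero)
    from H_0[OF this] show ?thesis
      by (simp add: h_def H.diff)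
  qed
  have h_add: "h (s + t) = h s + h t" for s t
    by (induction s rule: ctensor.abs_induct, induction t rule: ctensor.abs_induct)
      (simp add: plus_ctensor.abs_eq h_abs H_add)
  have h_scale: "h (c *\<^sub>C t) = c *\<^sub>C h t" for c t
    by (induction t rule: ctensor.abs_induct) (simp add: scaleC_ctensor.abs_eq h_abs H_scale)
  have "clinear h" by unfold_locales (simp_all add: h_add h_scale)
  moreover have "h (x \<otimes>\<^sub>C y) = f x \<otimes>\<^sub>C g y" for x y
    by (simp add: tensor.abs_eq h_abs H_single)
  ultimately show "\<exists>h. clinear h \<and> (\<forall>x y. h (x \<otimes>\<^sub>C y) = f x \<otimes>\<^sub>C g y)" by blast
next
  fix h h' :: "('a, 'b) ctensor \<Rightarrow> ('c, 'd) ctensor"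
  assume h: "clinear h \<and> (\<forall>x y. h (x \<otimes>\<^sub>C y) = f x \<otimes>\<^sub>C g y)"
    and h': "clinear h' \<and> (\<forall>x y. h' (x \<otimes>\<^sub>C y) = f x \<otimes>\<^sub>C g y)"
  interpret h: Vector_Spaces.linear scaleC scaleC h using h by blast
  interpret h': Vector_Spaces.linear scaleC scaleC h' using h' by blast
  have "h t = h' t" for t
    by (induction t rule: ctensor_induct) (simp_all add: h.add h'.add h.scale h'.scale h h')
  then show "h = h'" by blast
qed


section \<open>Symmetric algebras\<close>

text \<open>The symmetric algebra of a complex vector space is realised as the free commutative algebra on
  the underlying set (the monoid algebra of the multisets), modulo the ideal generated by the
  relations making the generators depend linearly on the vector.\<close>

inductive_set sym_relations :: "('a::complex_vector multiset \<Rightarrow>\<^sub>0 complex) set" where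
  "Poly_Mapping.single {#x + y#} 1 - Poly_Mapping.single {#x#} 1 - Poly_Mapping.single {#y#} 1
    \<in> sym_relations"
| "Poly_Mapping.single {#c *\<^sub>C x#} 1 - c *\<^sub>C Poly_Mapping.single {#x#} 1 \<in> sym_relations"

abbreviation ideal_generated :: "'a::comm_ring_1 set \<Rightarrow> 'a set"
  where "ideal_generated \<equiv> module.span (*)"

lemma module_mult: "module ((*) :: 'a \<Rightarrow> 'a \<Rightarrow> 'a::comm_ring_1)"
  by unfold_locales (simp_all add: algebra_simps)

lemmas ideal_zero = module.span_zero[OF module_mult]
  and ideal_add = module.span_add[OF module_mult]
  and ideal_diff = module.span_diff[OF module_mult]
  and ideal_neg = module.span_neg[OF module_mult]
  and ideal_mult = module.span_scale[OF module_mult]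
  and ideal_minimal = module.span_minimal[OF module_mult]

quotient_type (overloaded) 'a symalg =
  "'a::complex_vector multiset \<Rightarrow>\<^sub>0 complex" / "\<lambda>s t. s - t \<in> ideal_generated sym_relations"
proof (rule equivpI)
  show "reflp (\<lambda>s t. s - t \<in> ideal_generated sym_relations)"
    by (auto intro!: reflpI ideal_zero)
  show "symp (\<lambda>s t. s - t \<in> ideal_generated sym_relations)"
    by (auto intro!: sympI dest: ideal_neg)
  show "transp (\<lambda>s t. s - t \<in> ideal_generated sym_relations)"
    by (auto intro!: transpI dest: ideal_add)
qed

lemma scaleC_eq_mult: "c *\<^sub>C (x :: 'a::complex_algebra_1) = (c *\<^sub>C 1) * x"
  by (simp add: mult_scaleC_left)

lemma lookup_times_empty:
  fixes p q :: "'a multiset \<Rightarrow>\<^sub>0 complex"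
  shows "Poly_Mapping.lookup (p * q) {#} = Poly_Mapping.lookup p {#} * Poly_Mapping.lookup q {#}"
proof transfer
  fix f g :: "'a multiset \<Rightarrow> complex"
  have inner: "Sum_any (\<lambda>m. (g m when {#} = l + m)) = (g {#} when l = {#})" for l
  proof -
    have "(g m when {#} = l + m) = ((g m when l = {#}) when m = {#})" for m
      by (auto simp: when_def)
    then show ?thesis by (auto simp: when_def)
  qed
  show "prod_fun f g {#} = f {#} * g {#}"
    unfolding prod_fun_def inner mult_when by simp
qed

lemma one_notin_sym_ideal: "1 \<notin> ideal_generated (sym_relations :: ('a::complex_vector multiset \<Rightarrow>\<^sub>0 complex) set)"
proof -
  let ?K = "{p :: 'a multiset \<Rightarrow>\<^sub>0 complex. Poly_Mapping.lookup p {#} = 0}"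
  have "sym_relations \<subseteq> ?K"
    by (auto elim!: sym_relations.cases simp: lookup_minus lookup_single scaleC_poly_mapping.rep_eq
        scaleC_complex_def)
  moreover have "module.subspace (*) ?K"
    by (auto simp: module.subspace_def[OF module_mult] lookup_add lookup_times_empty)
  ultimately have "ideal_generated sym_relations \<subseteq> ?K"
    by (rule ideal_minimal)
  moreover have "(1 :: 'a multiset \<Rightarrow>\<^sub>0 complex) \<notin> ?K"
    by (simp add: lookup_one)
  ultimately show ?thesis by blast
qed

instantiation symalg :: (complex_vector) complex_algebra_1
begin

lift_definition zero_symalg :: "'a symalg" is 0 .
lift_definition one_symalg :: "'a symalg" is 1 .

lift_definition plus_symalg :: "'a symalg \<Rightarrow> 'a symalg \<Rightarrow> 'a symalg" is "(+)"
  by (drule (1) ideal_add) (simp add: algebra_simps)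

lift_definition minus_symalg :: "'a symalg \<Rightarrow> 'a symalg \<Rightarrow> 'a symalg" is "(-)"
  by (drule (1) ideal_diff) (simp add: algebra_simps)

lift_definition uminus_symalg :: "'a symalg \<Rightarrow> 'a symalg" is uminus
  by (drule ideal_neg) simp

lift_definition times_symalg :: "'a symalg \<Rightarrow> 'a symalg \<Rightarrow> 'a symalg" is "(*)"
proof -
  fix p p' q q' :: "'a multiset \<Rightarrow>\<^sub>0 complex"
  assume "p - p' \<in> ideal_generated sym_relations" "q - q' \<in> ideal_generated sym_relations"
  then have "q * (p - p') + p' * (q - q') \<in> ideal_generated sym_relations"
    by (intro ideal_add ideal_mult)
  then show "p * q - p' * q' \<in> ideal_generated sym_relations"
    by (simp add: algebra_simps)
qed

lift_definition scaleC_symalg :: "complex \<Rightarrow> 'a symalg \<Rightarrow> 'a symalg" is scaleC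
  unfolding complex_vector.scale_right_diff_distrib[symmetric]
  by (subst scaleC_eq_mult) (rule ideal_mult)

instance
proof
  show "(0 :: 'a symalg) \<noteq> 1"
  proof transfer
    show "(0 :: 'a multiset \<Rightarrow>\<^sub>0 complex) - 1 \<notin> ideal_generated sym_relations"
    proof
      assume "(0 :: 'a multiset \<Rightarrow>\<^sub>0 complex) - 1 \<in> ideal_generated sym_relations"
      from ideal_neg[OF this] show False
        using one_notin_sym_ideal[where 'a = 'a] by simp
    qed
  qed
  fix a b c :: "'a symalg" and r r' :: complex
  show "a + b + c = a + (b + c)" by transfer (simp add: add.assoc ideal_zero)
  show "a + b = b + a" by transfer (simp add: add.commute ideal_zero)
  show "0 + a = a" by transfer (simp add: ideal_zero)
  show "- a + a = 0" by transfer (simp add: ideal_zero)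
  show "a - b = a + - b" by transfer (simp add: ideal_zero)
  show "a * b * c = a * (b * c)" by transfer (simp add: mult.assoc ideal_zero)
  show "1 * a = a" "a * 1 = a" by (transfer; simp add: ideal_zero)+
  show "(a + b) * c = a * c + b * c" by transfer (simp add: distrib_right ideal_zero)
  show "a * (b + c) = a * b + a * c" by transfer (simp add: distrib_left ideal_zero)
  show "r *\<^sub>C (a + b) = r *\<^sub>C a + r *\<^sub>C b"
    by transfer (simp add: scaleC_add_right ideal_zero)
  show "(r + r') *\<^sub>C a = r *\<^sub>C a + r' *\<^sub>C a"
    by transfer (simp add: scaleC_add_left ideal_zero)
  show "r *\<^sub>C r' *\<^sub>C a = (r * r') *\<^sub>C a"
    by transfer (simp add: scaleC_scaleC ideal_zero)
  show "1 *\<^sub>C a = a" by transfer (simp add: scaleC_one ideal_zero)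
  show "(r *\<^sub>C a) * b = r *\<^sub>C (a * b)"
    by transfer (simp add: mult_scaleC_left ideal_zero)
  show "a * (r *\<^sub>C b) = r *\<^sub>C (a * b)"
    by transfer (simp add: mult_scaleC_right ideal_zero)
qed

end

lift_definition sym_of :: "'a::complex_vector \<Rightarrow> 'a symalg"
  is "\<lambda>x. Poly_Mapping.single {#x#} 1" .


section \<open>Complexification of a real vector space\<close>

datatype 'v cplxn = Cplxn (re_part: 'v) (im_part: 'v)

instantiation cplxn :: (real_vector) complex_vector
begin

definition "0 = Cplxn 0 0"
definition "x + y = Cplxn (re_part x + re_part y) (im_part x + im_part y)"
definition "x - y = Cplxn (re_part x - re_part y) (im_part x - im_part y)"
definition "- x = Cplxn (- re_part x) (- im_part x)"
definition "c *\<^sub>C x =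
  Cplxn (Re c *\<^sub>R re_part x - Im c *\<^sub>R im_part x) (Re c *\<^sub>R im_part x + Im c *\<^sub>R re_part x)"

instance
  by standard
    (simp_all add: zero_cplxn_def plus_cplxn_def minus_cplxn_def uminus_cplxn_def scaleC_cplxn_def
      algebra_simps cplxn.expand)

end

abbreviation cplxn_of :: "'v::real_vector \<Rightarrow> 'v cplxn"
  where "cplxn_of v \<equiv> Cplxn v 0"

definition cplxn_map :: "('v::real_vector \<Rightarrow> 'v) \<Rightarrow> 'v cplxn \<Rightarrow> 'v cplxn"
  where "cplxn_map f x = Cplxn (f (re_part x)) (f (im_part x))"

definition cplxn_eval :: "('v::real_vector \<Rightarrow> real) \<Rightarrow> 'v cplxn \<Rightarrow> complex"
  where "cplxn_eval \<xi> x = Complex (\<xi> (re_part x)) (\<xi> (im_part x))"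


section \<open>Real analytic functions\<close>

definition real_analytic :: "('v::euclidean_space \<Rightarrow> complex) \<Rightarrow> bool"
  where "real_analytic f \<longleftrightarrow>
    (\<forall>x. \<exists>r>0. \<exists>c :: ('v \<Rightarrow> nat) \<Rightarrow> complex. \<forall>y\<in>ball x r.
      ((\<lambda>\<nu>. c \<nu> * complex_of_real (\<Prod>b\<in>Basis. ((y - x) \<bullet> b) ^ \<nu> b)) has_sum f y)
        {\<nu>. \<forall>b. b \<notin> Basis \<longrightarrow> \<nu> b = 0})"

lemma real_analytic_0: "real_analytic (\<lambda>_. 0)"
  unfolding real_analytic_def
  by (intro allI exI[of _ 1] conjI exI[of _ "\<lambda>_. 0"] ballI) (auto intro: has_sum_0)

lemma real_analytic_cmult:
  fixes f :: "'a::euclidean_space \<Rightarrow> complex"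
  assumes "real_analytic f"
  shows "real_analytic (\<lambda>x. c * f x)"
  unfolding real_analytic_def
proof
  fix x :: 'a
  let ?N = "{\<nu> :: 'a \<Rightarrow> nat. \<forall>b. b \<notin> Basis \<longrightarrow> \<nu> b = 0}"
  let ?P = "\<lambda>y \<nu>. complex_of_real (\<Prod>b\<in>Basis. ((y - x) \<bullet> b) ^ \<nu> b)"
  obtain r a where r: "r > 0" and a: "\<And>y. y \<in> ball x r \<Longrightarrow> ((\<lambda>\<nu>. a \<nu> * ?P y \<nu>) has_sum f y) ?N"
    using assms unfolding real_analytic_def by blast
  have *: "((\<lambda>\<nu>. c * a \<nu> * ?P y \<nu>) has_sum c * f y) ?N" if "y \<in> ball x r" for y
    unfolding mult.assoc by (rule has_sum_cmult_right[OF a[OF that]])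
  show "\<exists>r>0. \<exists>a. \<forall>y\<in>ball x r. ((\<lambda>\<nu>. a \<nu> * ?P y \<nu>) has_sum c * f y) ?N"
    by (rule exI[of _ r], rule conjI, rule r, rule exI[of _ "\<lambda>\<nu>. c * a \<nu>"], rule ballI, rule *)
qed

lemma real_analytic_add:
  fixes f g :: "'a::euclidean_space \<Rightarrow> complex"
  assumes "real_analytic f" and "real_analytic g"
  shows "real_analytic (\<lambda>x. f x + g x)"
  unfolding real_analytic_def
proof
  fix x :: 'a
  let ?N = "{\<nu> :: 'a \<Rightarrow> nat. \<forall>b. b \<notin> Basis \<longrightarrow> \<nu> b = 0}"
  let ?P = "\<lambda>y \<nu>. complex_of_real (\<Prod>b\<in>Basis. ((y - x) \<bullet> b) ^ \<nu> b)"
  obtain r a where r: "r > 0" and a: "\<And>y. y \<in> ball x r \<Longrightarrow> ((\<lambda>\<nu>. a \<nu> * ?P y \<nu>) has_sum f y) ?N"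
    using assms(1) unfolding real_analytic_def by blast
  obtain s b where s: "s > 0" and b: "\<And>y. y \<in> ball x s \<Longrightarrow> ((\<lambda>\<nu>. b \<nu> * ?P y \<nu>) has_sum g y) ?N"
    using assms(2) unfolding real_analytic_def by blast
  have *: "((\<lambda>\<nu>. (a \<nu> + b \<nu>) * ?P y \<nu>) has_sum f y + g y) ?N" if "y \<in> ball x (min r s)" for y
    unfolding distrib_right by (rule has_sum_add[OF a b]) (use that in auto)
  have rs: "min r s > 0" using r s by simp
  show "\<exists>r>0. \<exists>a. \<forall>y\<in>ball x r. ((\<lambda>\<nu>. a \<nu> * ?P y \<nu>) has_sum f y + g y) ?N"
    by (rule exI[of _ "min r s"], rule conjI, rule rs, rule exI[of _ "\<lambda>\<nu>. a \<nu> + b \<nu>"],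
        rule ballI, rule *)
qed

typedef (overloaded) 'v canalytic = "{f :: 'v::euclidean_space \<Rightarrow> complex. real_analytic f}"
  morphisms capply Abs_canalytic
  using real_analytic_0 by blast

setup_lifting type_definition_canalytic

instantiation canalytic :: (euclidean_space) complex_vector
begin

lift_definition zero_canalytic :: "'a canalytic" is "\<lambda>_. 0"
  by (rule real_analytic_0)

lift_definition plus_canalytic :: "'a canalytic \<Rightarrow> 'a canalytic \<Rightarrow> 'a canalytic"
  is "\<lambda>f g x. f x + g x"
  by (rule real_analytic_add)

lift_definition scaleC_canalytic :: "complex \<Rightarrow> 'a canalytic \<Rightarrow> 'a canalytic"
  is "\<lambda>c f x. c * f x"
  by (rule real_analytic_cmult)

lift_definition uminus_canalytic :: "'a canalytic \<Rightarrow> 'a canalytic" is "\<lambda>f x. - f x"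
  using real_analytic_cmult[of _ "-1"] by simp

lift_definition minus_canalytic :: "'a canalytic \<Rightarrow> 'a canalytic \<Rightarrow> 'a canalytic"
  is "\<lambda>f g x. f x - g x"
  using real_analytic_add[of _ "\<lambda>x. - 1 * g x" for g] real_analytic_cmult[of _ "-1"] by fastforce

instance
  by standard (transfer; simp add: fun_eq_iff algebra_simps)+

end


section \<open>The isometry group\<close>

typedef (overloaded) 'v isom =
  "{g :: 'v::euclidean_space \<Rightarrow> 'v. bij g \<and> (\<forall>x y. dist (g x) (g y) = dist x y)}"
  morphisms iapply Abs_isom
  by (rule exI[of _ id]) auto

setup_lifting type_definition_isom

text \<open>Composition is written additively, because the convolution product on
  \<^typ>\<open>'g \<Rightarrow>\<^sub>0 complex\<close> (which then is the group algebra) is provided for additive monoids.\<close>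

instantiation isom :: (euclidean_space) group_add
begin

lift_definition zero_isom :: "'a isom" is id by auto

lift_definition plus_isom :: "'a isom \<Rightarrow> 'a isom \<Rightarrow> 'a isom" is "(\<circ>)"
  by (auto intro: bij_comp)

lift_definition uminus_isom :: "'a isom \<Rightarrow> 'a isom" is inv
proof -
  fix g :: "'a \<Rightarrow> 'a"
  assume g: "bij g \<and> (\<forall>x y. dist (g x) (g y) = dist x y)"
  then have "dist (inv g x) (inv g y) = dist x y" for x y
    by (metis bij_inv_eq_iff)
  with g show "bij (inv g) \<and> (\<forall>x y. dist (inv g x) (inv g y) = dist x y)"
    by (auto intro: bij_imp_bij_inv)
qed

definition minus_isom :: "'a isom \<Rightarrow> 'a isom \<Rightarrow> 'a isom"
  where "minus_isom g h = g + - h"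

instance
proof
  fix a b c :: "'a isom"
  show "a + b + c = a + (b + c)" by transfer (simp add: comp_assoc)
  show "0 + a = a" "a + 0 = a" by (transfer; simp)+
  show "- a + a = 0" by transfer (simp add: bij_is_inj)
  show "a + - b = a - b" by (simp add: minus_isom_def)
qed

end

abbreviation compose_isom :: "'v::euclidean_space isom \<Rightarrow> 'v isom \<Rightarrow> 'v isom" (infixl \<open>\<circ>\<^sub>I\<close> 65)
  where "g \<circ>\<^sub>I h \<equiv> g + h"

lift_definition translation :: "'v::euclidean_space \<Rightarrow> 'v isom" is "\<lambda>y v. v + y"
  by (auto intro!: bijI' simp: dist_norm) (metis diff_add_cancel)

definition group_algebra :: "'v::euclidean_space isom set \<Rightarrow> ('v isom \<Rightarrow>\<^sub>0 complex) set"
  where "group_algebra G = {p. Poly_Mapping.keys p \<subseteq> G}"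

abbreviation group_elt :: "'v::euclidean_space isom \<Rightarrow> 'v isom \<Rightarrow>\<^sub>0 complex"
  where "group_elt g \<equiv> Poly_Mapping.single g 1"

definition group_module ::
    "'v::euclidean_space isom set \<Rightarrow> ('v isom \<Rightarrow> 'm::complex_vector \<Rightarrow> 'm) \<Rightarrow> bool"
  where "group_module G \<rho> \<longleftrightarrow>
    (\<forall>g\<in>G. clinear (\<rho> g)) \<and> \<rho> 0 = id \<and> (\<forall>g\<in>G. \<forall>h\<in>G. \<rho> (g \<circ>\<^sub>I h) = \<rho> g \<circ> \<rho> h)"


section \<open>Root data\<close>

type_synonym 'v dual = "'v \<Rightarrow>\<^sub>L real"

text \<open>The vector of \<open>V\<close> corresponding to a functional under the scalar product, and the scalar product
  it induces on the dual space.\<close>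

definition riesz :: "'v::euclidean_space dual \<Rightarrow> 'v"
  where "riesz \<xi> = (\<Sum>b\<in>Basis. \<xi> b *\<^sub>R b)"

definition dual_inner :: "'v::euclidean_space dual \<Rightarrow> 'v dual \<Rightarrow> real"
  where "dual_inner \<xi> \<eta> = riesz \<xi> \<bullet> riesz \<eta>"

definition coroot :: "'v::euclidean_space dual \<Rightarrow> 'v"
  where "coroot \<xi> = (2 / dual_inner \<xi> \<xi>) *\<^sub>R riesz \<xi>"

lemma inner_riesz: "v \<bullet> riesz \<xi> = blinfun_apply \<xi> v"
proof -
  have "blinfun_apply \<xi> v = blinfun_apply \<xi> (\<Sum>b\<in>Basis. (v \<bullet> b) *\<^sub>R b)"
    by (simp add: euclidean_representation)
  also have "\<dots> = (\<Sum>b\<in>Basis. (v \<bullet> b) * blinfun_apply \<xi> b)"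
    by (simp add: blinfun.sum_right blinfun.scaleR_right)
  finally show ?thesis
    by (simp add: riesz_def inner_sum_right mult.commute)
qed

lemma riesz_eq_0_iff: "riesz \<xi> = 0 \<longleftrightarrow> \<xi> = 0"
proof
  assume "riesz \<xi> = 0"
  then have "blinfun_apply \<xi> v = 0" for v
    by (simp add: inner_riesz[symmetric])
  then show "\<xi> = 0" by (auto intro: blinfun_eqI)
qed (simp add: riesz_def)

lemma apply_coroot: "blinfun_apply \<eta> (coroot \<xi>) = 2 * dual_inner \<eta> \<xi> / dual_inner \<xi> \<xi>"
  by (simp add: inner_riesz[symmetric] coroot_def dual_inner_def inner_commute)

lemma apply_coroot_self: "\<xi> \<noteq> 0 \<Longrightarrow> blinfun_apply \<xi> (coroot \<xi>) = 2"
  by (simp add: apply_coroot dual_inner_def riesz_eq_0_iff)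

definition reduced_root_system :: "'v::euclidean_space dual set \<Rightarrow> bool"
  where "reduced_root_system R \<longleftrightarrow>
    finite R \<and> 0 \<notin> R \<and>
    (\<forall>\<alpha>\<in>R. \<forall>\<beta>\<in>R. \<beta> - blinfun_apply \<beta> (coroot \<alpha>) *\<^sub>R \<alpha> \<in> R) \<and>
    (\<forall>\<alpha>\<in>R. \<forall>\<beta>\<in>R. blinfun_apply \<beta> (coroot \<alpha>) \<in> \<int>) \<and>
    (\<forall>\<alpha>\<in>R. \<forall>c. c *\<^sub>R \<alpha> \<in> R \<longrightarrow> c = 1 \<or> c = - 1)"

definition irreducible_roots :: "'v::euclidean_space dual set \<Rightarrow> bool"
  where "irreducible_roots R \<longleftrightarrow>
    R \<noteq> {} \<and>
    \<not> (\<exists>S T. S \<noteq> {} \<and> T \<noteq> {} \<and> S \<union> T = R \<and> S \<inter> T = {} \<and>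
          (\<forall>\<alpha>\<in>S. \<forall>\<beta>\<in>T. dual_inner \<alpha> \<beta> = 0))"

definition nonneg_comb :: "'v::euclidean_space dual set \<Rightarrow> 'v dual set"
  where "nonneg_comb F = {\<Sum>\<beta>\<in>F. real (n \<beta>) *\<^sub>R \<beta> | n :: 'v dual \<Rightarrow> nat. True}"

definition is_root_basis :: "'v::euclidean_space dual set \<Rightarrow> 'v dual set \<Rightarrow> bool"
  where "is_root_basis R F \<longleftrightarrow>
    F \<subseteq> R \<and> independent F \<and> (\<forall>\<alpha>\<in>R. \<alpha> \<in> nonneg_comb F \<or> - \<alpha> \<in> nonneg_comb F)"

definition pos_roots :: "'v::euclidean_space dual set \<Rightarrow> 'v dual set \<Rightarrow> 'v dual set"
  where "pos_roots R F = R \<inter> nonneg_comb F"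

definition is_highest_root :: "'v::euclidean_space dual set \<Rightarrow> 'v dual set \<Rightarrow> 'v dual \<Rightarrow> bool"
  where "is_highest_root R F \<theta> \<longleftrightarrow> \<theta> \<in> R \<and> (\<forall>\<beta>\<in>R. \<theta> - \<beta> \<in> nonneg_comb F)"

definition int_span :: "'a::real_vector set \<Rightarrow> 'a set"
  where "int_span S = {\<Sum>x\<in>T. of_int (n x) *\<^sub>R x | T n. finite T \<and> T \<subseteq> S}"

definition full_lattice :: "'a::real_vector set \<Rightarrow> bool"
  where "full_lattice L \<longleftrightarrow> (\<exists>B. independent B \<and> span B = UNIV \<and> L = int_span B)"

definition dual_lattice :: "'v::euclidean_space dual set \<Rightarrow> 'v set"
  where "dual_lattice X = {y. \<forall>\<xi>\<in>X. blinfun_apply \<xi> y \<in> \<int>}"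

definition affine_root_data ::
    "'v::euclidean_space dual set \<Rightarrow> 'v dual set \<Rightarrow> 'v dual set \<Rightarrow> 'v dual \<Rightarrow> bool"
  where "affine_root_data R X F \<theta> \<longleftrightarrow>
    reduced_root_system R \<and> irreducible_roots R \<and>
    full_lattice X \<and> int_span R \<subseteq> X \<and> int_span (coroot ` R) \<subseteq> dual_lattice X \<and>
    is_root_basis R F \<and> is_highest_root R F \<theta>"


section \<open>Affine roots and the extended affine Weyl group\<close>

definition affine_fun :: "'v::euclidean_space dual \<Rightarrow> int \<Rightarrow> 'v \<Rightarrow> real"
  where "affine_fun \<alpha> m = (\<lambda>v. blinfun_apply \<alpha> v + of_int m)"

text \<open>The gradient \<open>Da\<close> of an affine function \<open>a\<close>.\<close>

definition gradient :: "('v::euclidean_space \<Rightarrow> real) \<Rightarrow> 'v dual"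
  where "gradient a = Blinfun (\<lambda>v. a v - a 0)"

lemma gradient_affine_fun [simp]: "gradient (affine_fun \<alpha> m) = \<alpha>"
  by (simp add: gradient_def affine_fun_def blinfun_apply_inverse blinfun.zero_right)

definition affine_reflection :: "('v::euclidean_space \<Rightarrow> real) \<Rightarrow> 'v isom"
  where "affine_reflection a = Abs_isom (\<lambda>v. v - a v *\<^sub>R coroot (gradient a))"

lemma iapply_affine_reflection:
  assumes "\<alpha> \<noteq> 0"
  shows "iapply (affine_reflection (affine_fun \<alpha> m)) v = v - affine_fun \<alpha> m v *\<^sub>R coroot \<alpha>"
proof -
  define s where "s = (\<lambda>v. v - affine_fun \<alpha> m v *\<^sub>R coroot \<alpha>)"
  have s_s: "s (s v) = v" for v
    using apply_coroot_self[OF assms]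
    by (simp add: s_def affine_fun_def blinfun.diff_right blinfun.scaleR_right algebra_simps
        flip: scaleR_add_left)
  then have "bij s" by (rule involuntory_imp_bij)
  moreover have "dist (s x) (s y) = dist x y" for x y
  proof -
    define u where "u = x - y"
    have "s x - s y = u - blinfun_apply \<alpha> u *\<^sub>R coroot \<alpha>"
      by (simp add: s_def u_def affine_fun_def blinfun.diff_right algebra_simps)
    moreover have "(u - blinfun_apply \<alpha> u *\<^sub>R coroot \<alpha>) \<bullet> (u - blinfun_apply \<alpha> u *\<^sub>R coroot \<alpha>) = u \<bullet> u"
    proof -
      have "riesz \<alpha> \<bullet> riesz \<alpha> \<noteq> 0" using assms by (simp add: riesz_eq_0_iff)
      then show ?thesis
        by (simp add: inner_diff_left inner_diff_right coroot_def dual_inner_def inner_riesz[symmetric]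
            inner_commute field_simps)
    qed
    ultimately show ?thesis by (simp add: dist_norm norm_eq_sqrt_inner u_def)
  qed
  ultimately have "iapply (Abs_isom s) = s" by (simp add: Abs_isom_inverse)
  moreover have "affine_reflection (affine_fun \<alpha> m) = Abs_isom s"
    by (simp add: affine_reflection_def s_def)
  ultimately show ?thesis by (simp add: s_def)
qed

inductive_set weyl_group :: "'v::euclidean_space dual set \<Rightarrow> 'v isom set" for R where
  "0 \<in> weyl_group R"
| "\<alpha> \<in> R \<Longrightarrow> w \<in> weyl_group R \<Longrightarrow> affine_reflection (affine_fun \<alpha> 0) \<circ>\<^sub>I w \<in> weyl_group R"

definition ext_affine_weyl_group ::
    "'v::euclidean_space dual set \<Rightarrow> 'v dual set \<Rightarrow> 'v isom set"
  where "ext_affine_weyl_group R X =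
    {w \<circ>\<^sub>I translation y | w y. w \<in> weyl_group R \<and> y \<in> dual_lattice X}"

text \<open>The linear part \<open>D g\<close> of an isometry \<open>g\<close>; thus \<open>D (w t\<^sub>y) = w\<close> for \<open>w\<close> in the Weyl group.\<close>

definition linear_part :: "'v::euclidean_space isom \<Rightarrow> 'v \<Rightarrow> 'v"
  where "linear_part g = (\<lambda>v. iapply g v - iapply g 0)"

lemma linear_weyl_group:
  assumes "w \<in> weyl_group R" and "0 \<notin> R"
  shows "linear (iapply w)"
  using assms(1)
proof induction
  case 1
  then show ?case by (simp add: zero_isom.rep_eq linear_id[unfolded id_def] id_def)
next
  case (2 \<alpha> w)
  then have "iapply (affine_reflection (affine_fun \<alpha> 0)) = (\<lambda>v. v - blinfun_apply \<alpha> v *\<^sub>R coroot \<alpha>)"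
    using assms(2) by (metis affine_fun_def add_0_right iapply_affine_reflection of_int_0)
  then have "linear (iapply (affine_reflection (affine_fun \<alpha> 0)))"
    by (auto intro!: linearI simp: blinfun.add_right blinfun.scaleR_right algebra_simps)
  then show ?case
    unfolding plus_isom.rep_eq using 2 by (intro linear_compose)
qed

lemma linear_part_weyl_translation:
  assumes "w \<in> weyl_group R" and "0 \<notin> R"
  shows "linear_part (w \<circ>\<^sub>I translation y) = iapply w"
  using linear_weyl_group[OF assms]
  by (simp add: fun_eq_iff linear_part_def plus_isom.rep_eq translation.rep_eq linear_add)

definition affine_roots :: "'v::euclidean_space dual set \<Rightarrow> ('v \<Rightarrow> real) set"
  where "affine_roots R = {affine_fun \<alpha> m | \<alpha> m. \<alpha> \<in> R}"

definition isom_act :: "'v::euclidean_space isom \<Rightarrow> ('v \<Rightarrow> 'a) \<Rightarrow> ('v \<Rightarrow> 'a)"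
  where "isom_act w f = (\<lambda>v. f (iapply (- w) v))"

definition pos_affine_roots :: "'v::euclidean_space dual set \<Rightarrow> 'v dual set \<Rightarrow> ('v \<Rightarrow> real) set"
  where "pos_affine_roots R F =
    {affine_fun \<alpha> m | \<alpha> m. \<alpha> \<in> R \<and> m > 0} \<union> {affine_fun \<alpha> 0 | \<alpha>. \<alpha> \<in> pos_roots R F}"

definition neg_affine_roots :: "'v::euclidean_space dual set \<Rightarrow> 'v dual set \<Rightarrow> ('v \<Rightarrow> real) set"
  where "neg_affine_roots R F = (\<lambda>a v. - a v) ` pos_affine_roots R F"

definition simple_affine_roots :: "'v::euclidean_space dual set \<Rightarrow> 'v dual \<Rightarrow> ('v \<Rightarrow> real) set"
  where "simple_affine_roots F \<theta> = insert (affine_fun (- \<theta>) 1) ((\<lambda>\<beta>. affine_fun \<beta> 0) ` F)"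

text \<open>For \<open>w\<close> in the extended affine Weyl group the set of affine roots below is finite.\<close>

definition weyl_length :: "'v::euclidean_space dual set \<Rightarrow> 'v dual set \<Rightarrow> 'v isom \<Rightarrow> nat"
  where "weyl_length R F w =
    card (pos_affine_roots R F \<inter> isom_act (- w) ` neg_affine_roots R F)"

definition length_zero_group ::
    "'v::euclidean_space dual set \<Rightarrow> 'v dual set \<Rightarrow> 'v dual set \<Rightarrow> 'v isom set"
  where "length_zero_group R X F = {w \<in> ext_affine_weyl_group R X. weyl_length R F w = 0}"

definition multiplicity_function ::
    "'v::euclidean_space dual set \<Rightarrow> 'v dual set \<Rightarrow> (('v \<Rightarrow> real) \<Rightarrow> complex) \<Rightarrow> bool"
  where "multiplicity_function R X k \<longleftrightarrow>
    (\<forall>w\<in>ext_affine_weyl_group R X. \<forall>a\<in>affine_roots R. k (isom_act w a) = k a)"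


section \<open>The algebra \<open>A(k)\<close>\<close>

text \<open>The predicate characterises the algebra up to unique isomorphism: \<^typ>\<open>'a\<close> together with the
  embeddings \<open>\<iota>\<close> of the symmetric algebra and \<open>\<kappa>\<close> of the group algebra (only the values of \<open>\<kappa>\<close> on
  the group algebra of the extended affine Weyl group matter).  The map \<open>\<mu>\<close> is the multiplication
  map \<open>p \<otimes> g \<mapsto> p g\<close>; its linear extension to the ambient tensor product is immaterial.\<close>

definition is_algebra_A ::
    "'v::euclidean_space dual set \<Rightarrow> 'v dual set \<Rightarrow> 'v dual set \<Rightarrow> 'v dual \<Rightarrow>
     (('v \<Rightarrow> real) \<Rightarrow> complex) \<Rightarrow>
     ('v cplxn symalg \<Rightarrow> 'a::complex_algebra_1) \<Rightarrow> (('v isom \<Rightarrow>\<^sub>0 complex) \<Rightarrow> 'a) \<Rightarrow> bool"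
  where "is_algebra_A R X F \<theta> k \<iota> \<kappa> \<longleftrightarrow>
    (let CW = group_algebra (ext_affine_weyl_group R X) in
      algebra_hom_on UNIV \<iota> \<and> inj \<iota> \<and>
      algebra_hom_on CW \<kappa> \<and> inj_on \<kappa> CW \<and>
      (\<exists>\<mu> :: ('v cplxn symalg, 'v isom \<Rightarrow>\<^sub>0 complex) ctensor \<Rightarrow> 'a.
        clinear \<mu> \<and> (\<forall>p. \<forall>g\<in>CW. \<mu> (p \<otimes>\<^sub>C g) = \<iota> p * \<kappa> g) \<and>
        bij_betw \<mu> (subspace_tensor UNIV CW) UNIV) \<and>
      (\<forall>a\<in>simple_affine_roots F \<theta>. \<forall>v.
        \<kappa> (group_elt (affine_reflection a)) * \<iota> (sym_of v)
        - \<iota> (sym_of (cplxn_map (iapply (affine_reflection (affine_fun (gradient a) 0))) v))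
          * \<kappa> (group_elt (affine_reflection a))
        = - (k a * cplxn_eval (blinfun_apply (gradient a)) v) *\<^sub>C 1) \<and>
      (\<forall>\<omega>\<in>length_zero_group R X F. \<forall>v.
        \<kappa> (group_elt \<omega>) * \<iota> (sym_of v)
        = \<iota> (sym_of (cplxn_map (linear_part \<omega>) v)) * \<kappa> (group_elt \<omega>)))"


section \<open>Operators on real analytic functions\<close>

text \<open>Each function under \<open>Abs_canalytic\<close> below is again real analytic, \<open>a\<close> being an affine root in
  \<open>integral_op a\<close>.\<close>

definition directional_deriv :: "'v::euclidean_space \<Rightarrow> 'v canalytic \<Rightarrow> 'v canalytic"
  where "directional_deriv v f =
    Abs_canalytic (\<lambda>x. vector_derivative (\<lambda>t. capply f (x + t *\<^sub>R v)) (at 0))"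

definition canalytic_act :: "'v::euclidean_space isom \<Rightarrow> 'v canalytic \<Rightarrow> 'v canalytic"
  where "canalytic_act w f = Abs_canalytic (isom_act w (capply f))"

definition integral_op :: "('v::euclidean_space \<Rightarrow> real) \<Rightarrow> 'v canalytic \<Rightarrow> 'v canalytic"
  where "integral_op a f =
    Abs_canalytic (\<lambda>v. LBINT t=0..ereal (a v). capply f (v - t *\<^sub>R coroot (gradient a)))"

end

theory Submission
  imports Defs
begin

text \<open>
  The operators \<open>S a\<close> assigned to the simple reflections satisfy the commutation relations with the
  \<open>\<partial>\<^sub>v\<close> because \<open>I(a) f = g - s\<^sub>a g\<close> for every analytic \<open>g\<close> whose derivative along the co-root of \<open>a\<close>
  is \<open>f\<close>.  By the basis theorem for \<open>A(k)\<close> it then remains to extend \<open>s\<^sub>a \<mapsto> S a\<close>, \<open>\<omega> \<mapsto> \<omega> \<otimes> \<omega>\<close> to a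
  representation \<open>T\<close> of \<open>W\<^sup>a\<close>.  Instead of verifying braid relations one defines \<open>T w\<close> by recursion on
  the length and shows, by induction on the length, that \<open>S a (T (s\<^sub>a w))\<close> is the same for all simple
  \<open>a\<close> that \<open>w\<inverse>\<close> makes negative.  If \<open>a\<close> and \<open>b\<close> are two such roots, then the difference of the two operators
  intertwines \<open>\<partial>\<^sub>v\<close> with \<open>\<partial>\<^sub>w\<^sub>v\<close>, since the lower order terms in the commutators are the same sum over the
  inversions of \<open>w\<close>; and its values vanish at a point of the closed alcove where \<open>a\<close> and \<open>b\<close> vanish.
  Hence all derivatives of its values vanish at that point, and by analyticity it is zero.
\<close>

section \<open>Power series and real analytic functions\<close>

text \<open>What makes two descents comparable is that the correction terms in the commutator of
  \<open>T w\<close> with \<open>D v\<close> never mention the descent. For an inversion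
  \<open>c\<close> of \<open>s_a w\<close>, \<open>S a\<close> turns its summand into the summand of
  \<open>w\<close>, because \<open>s_a w s_c\<close> is shorter than \<open>s_a w\<close>; the term
  created by \<open>S a\<close> itself belongs to the one inversion that \<open>s_a w\<close> lacks.
  The vanishing of values is a separate induction: on the zero set of \<open>a\<close> the integral
  term drops out, so there \<open>S a\<close> acts on values just as \<open>s_a\<close> acts on
  \<open>M\<close>. The roots 1 - \<theta> and \<theta> have no common zero, which matters when
  \<theta> is itself simple; but their sum is the constant 1, so they are never negative at the same
  point. Analyticity is handled by coefficient norms because these survive sums, products,
  composition and integration in a parameter; that is what produces an analytic primitive in the
  direction of a co-root.\<close>

definition multi_indices :: "('v::euclidean_space \<Rightarrow> nat) set"
  where "multi_indices = {\<nu>. \<forall>b. b \<notin> Basis \<longrightarrow> \<nu> b = 0}"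

definition mdeg :: "('v::euclidean_space \<Rightarrow> nat) \<Rightarrow> nat"
  where "mdeg \<nu> = (\<Sum>b\<in>Basis. \<nu> b)"

definition mpow :: "'v::euclidean_space \<Rightarrow> ('v \<Rightarrow> nat) \<Rightarrow> real"
  where "mpow z \<nu> = (\<Prod>b\<in>Basis. (z \<bullet> b) ^ \<nu> b)"

text \<open>Cubes suit products of coordinates: a monomial of degree d is at most r^d on the cube of
  half-side r, with equality at a corner.\<close>

definition in_cube :: "real \<Rightarrow> 'v::euclidean_space \<Rightarrow> bool"
  where "in_cube r z \<longleftrightarrow> (\<forall>b\<in>Basis. \<bar>z \<bullet> b\<bar> \<le> r)"

text \<open>Power series expansions about \<open>x\<close>, with a bound on the \<open>\<ell>\<^sup>1\<close>-norm of the coefficients weighted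
  by the powers of \<open>r\<close>; this norm is submultiplicative and countably subadditive.\<close>

definition pseries :: "'v::euclidean_space \<Rightarrow> real \<Rightarrow> real \<Rightarrow> ('v \<Rightarrow> complex) \<Rightarrow> bool"
  where "pseries x r N f \<longleftrightarrow> r > 0 \<and> (\<exists>c.
    (\<lambda>\<nu>. norm (c \<nu>) * r ^ mdeg \<nu>) summable_on multi_indices \<and>
    (\<Sum>\<^sub>\<infinity>\<nu>\<in>multi_indices. norm (c \<nu>) * r ^ mdeg \<nu>) \<le> N \<and>
    (\<forall>y. in_cube r (y - x) \<longrightarrow> ((\<lambda>\<nu>. c \<nu> * of_real (mpow (y - x) \<nu>)) has_sum f y) multi_indices))"

lemma mpow_le:
  assumes "in_cube r z"
  shows "\<bar>mpow z \<nu>\<bar> \<le> r ^ mdeg \<nu>"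
proof -
  have "\<bar>mpow z \<nu>\<bar> = (\<Prod>b\<in>Basis. \<bar>z \<bullet> b\<bar> ^ \<nu> b)"
    by (simp add: mpow_def abs_prod power_abs)
  also have "\<dots> \<le> (\<Prod>b\<in>Basis. r ^ \<nu> b)"
    using assms by (intro prod_mono) (auto simp: in_cube_def intro!: power_mono)
  also have "\<dots> = r ^ mdeg \<nu>"
    by (simp add: mdeg_def power_sum)
  finally show ?thesis .
qed

lemma mpow_add: "mpow z (\<lambda>b. \<mu> b + \<nu> b) = mpow z \<mu> * mpow z \<nu>"
  by (simp add: mpow_def power_add prod.distrib)

lemma mdeg_add: "mdeg (\<lambda>b. \<mu> b + \<nu> b) = mdeg \<mu> + mdeg \<nu>"
  by (simp add: mdeg_def sum.distrib)

lemma in_cube_mono: "in_cube r z \<Longrightarrow> r \<le> s \<Longrightarrow> in_cube s z"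
  unfolding in_cube_def by (meson order_trans)

lemma in_cube_0: "0 \<le> r \<Longrightarrow> in_cube r 0"
  by (simp add: in_cube_def)

lemma in_cube_norm: "norm z \<le> r \<Longrightarrow> in_cube r z"
  unfolding in_cube_def by (meson Basis_le_norm order_trans)

text \<open>Several indices may share an exponent. Collecting them costs nothing: the norm of a sum
  of coefficients over a fibre of \<open>e\<close> is at most the sum of the norms, and absolute
  summability permits the rearrangement. Sums, monomial multiples, constants and coordinates below
  all pass through this lemma.\<close>

lemma pseries_regroup:
  fixes I :: "'i set" and e :: "'i \<Rightarrow> 'v::euclidean_space \<Rightarrow> nat"
  assumes r: "r > 0" and e: "\<And>i. i \<in> I \<Longrightarrow> e i \<in> multi_indices"
    and sum: "(\<lambda>i. norm (d i) * r ^ mdeg (e i)) summable_on I"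
    and N: "(\<Sum>\<^sub>\<infinity>i\<in>I. norm (d i) * r ^ mdeg (e i)) \<le> N"
    and f: "\<And>y. in_cube r (y - x) \<Longrightarrow> ((\<lambda>i. d i * of_real (mpow (y - x) (e i))) has_sum f y) I"
  shows "pseries x r N f"
proof -
  define fib where "fib \<nu> = {i \<in> I. e i = \<nu>}" for \<nu>
  have inj: "inj_on (\<lambda>i. (e i, i)) I" by (auto intro: inj_onI)
  have img: "(\<lambda>i. (e i, i)) ` I = Sigma multi_indices fib"
    using e by (auto simp: fib_def)
  have S: "(\<lambda>(\<nu>, i). norm (d i) * r ^ mdeg (e i)) summable_on Sigma multi_indices fib"
    unfolding img[symmetric] using sum by (subst summable_on_reindex[OF inj]) (simp add: o_def)
  have Sv: "(\<Sum>\<^sub>\<infinity>(\<nu>, i)\<in>Sigma multi_indices fib. norm (d i) * r ^ mdeg (e i)) \<le> N"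
    unfolding img[symmetric] using N by (subst infsum_reindex[OF inj]) (simp add: o_def)
  \<comment> \<open>On a fibre the weight \<open>r ^ mdeg \<nu>\<close> is a positive constant and
    can be divided out.\<close>
  have fibsum: "(\<lambda>i. norm (d i)) summable_on fib \<nu>" for \<nu>
  proof -
    have "(\<lambda>i. norm (d i) * r ^ mdeg (e i)) summable_on fib \<nu>"
      by (rule summable_on_subset_banach[OF sum]) (auto simp: fib_def)
    then have "(\<lambda>i. norm (d i) * r ^ mdeg \<nu>) summable_on fib \<nu>"
      by (rule summable_on_cong[THEN iffD1, rotated]) (auto simp: fib_def)
    then have "(\<lambda>i. norm (d i) * r ^ mdeg \<nu> * inverse (r ^ mdeg \<nu>)) summable_on fib \<nu>"
      by (rule summable_on_cmult_left)
    then show ?thesis using r by (simp add: mult.assoc)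
  qed
  define c where "c \<nu> = infsum d (fib \<nu>)" for \<nu>
  have c: "(d has_sum c \<nu>) (fib \<nu>)" for \<nu>
    unfolding c_def by (rule has_sum_infsum[OF abs_summable_summable[OF fibsum]])
  have c_le: "norm (c \<nu>) * r ^ mdeg \<nu> \<le> (\<Sum>\<^sub>\<infinity>i\<in>fib \<nu>. norm (d i) * r ^ mdeg (e i))" for \<nu>
  proof -
    have "norm (c \<nu>) * r ^ mdeg \<nu> \<le> (\<Sum>\<^sub>\<infinity>i\<in>fib \<nu>. norm (d i)) * r ^ mdeg \<nu>"
      unfolding c_def using r by (intro mult_right_mono norm_infsum_bound fibsum) auto
    also have "\<dots> = (\<Sum>\<^sub>\<infinity>i\<in>fib \<nu>. norm (d i) * r ^ mdeg \<nu>)"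
      by (rule infsum_cmult_left'[symmetric])
    also have "\<dots> = (\<Sum>\<^sub>\<infinity>i\<in>fib \<nu>. norm (d i) * r ^ mdeg (e i))"
      by (intro infsum_cong) (auto simp: fib_def)
    finally show ?thesis .
  qed
  have S2: "(\<lambda>\<nu>. \<Sum>\<^sub>\<infinity>i\<in>fib \<nu>. norm (d i) * r ^ mdeg (e i)) summable_on multi_indices"
    by (rule summable_on_Sigma_banach[OF S])
  have S1: "(\<lambda>\<nu>. norm (c \<nu>) * r ^ mdeg \<nu>) summable_on multi_indices"
    by (rule summable_on_comparison_test[OF S2 c_le]) (use r in auto)
  have "(\<Sum>\<^sub>\<infinity>\<nu>\<in>multi_indices. norm (c \<nu>) * r ^ mdeg \<nu>)
      \<le> (\<Sum>\<^sub>\<infinity>\<nu>\<in>multi_indices. \<Sum>\<^sub>\<infinity>i\<in>fib \<nu>. norm (d i) * r ^ mdeg (e i))"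
    by (rule infsum_mono[OF S1 S2 c_le])
  also have "\<dots> \<le> N"
    using Sv infsum_Sigma'_banach[OF S] by simp
  finally have *: "(\<Sum>\<^sub>\<infinity>\<nu>\<in>multi_indices. norm (c \<nu>) * r ^ mdeg \<nu>) \<le> N" .
  have "((\<lambda>\<nu>. c \<nu> * of_real (mpow (y - x) \<nu>)) has_sum f y) multi_indices"
    if "in_cube r (y - x)" for y
  proof (rule has_sum_SigmaD)
    show "((\<lambda>(\<nu>, i). d i * of_real (mpow (y - x) (e i))) has_sum f y) (Sigma multi_indices fib)"
      unfolding img[symmetric] using f[OF that] by (subst has_sum_reindex[OF inj]) (simp add: o_def)
    have "((\<lambda>i. d i * of_real (mpow (y - x) \<nu>)) has_sum (c \<nu> * of_real (mpow (y - x) \<nu>))) (fib \<nu>)" for \<nu>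
      by (rule has_sum_cmult_left[OF c])
    then show "((\<lambda>i. case (\<nu>, i) of (\<nu>, i) \<Rightarrow> d i * of_real (mpow (y - x) (e i)))
        has_sum (c \<nu> * of_real (mpow (y - x) \<nu>))) (fib \<nu>)" for \<nu>
      by (rule has_sum_cong[THEN iffD1, rotated]) (auto simp: fib_def)
  qed
  with r S1 * show ?thesis unfolding pseries_def by blast
qed

lemma pseries_bound:
  assumes "pseries x r N f" and y: "in_cube s (y - x)" and "0 \<le> s" "s \<le> r"
  shows "norm (f y) \<le> N"
proof -
  from assms obtain c where S: "(\<lambda>\<nu>. norm (c \<nu>) * r ^ mdeg \<nu>) summable_on multi_indices"
    and N: "(\<Sum>\<^sub>\<infinity>\<nu>\<in>multi_indices. norm (c \<nu>) * r ^ mdeg \<nu>) \<le> N"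
    and f: "((\<lambda>\<nu>. c \<nu> * of_real (mpow (y - x) \<nu>)) has_sum f y) multi_indices"
    unfolding pseries_def using in_cube_mono by blast
  have le: "norm (c \<nu> * of_real (mpow (y - x) \<nu>)) \<le> norm (c \<nu>) * r ^ mdeg \<nu>" for \<nu>
    using mpow_le[OF in_cube_mono[OF y \<open>s \<le> r\<close>], of \<nu>] by (simp add: norm_mult mult_left_mono)
  have "norm (f y) \<le> (\<Sum>\<^sub>\<infinity>\<nu>\<in>multi_indices. norm (c \<nu>) * r ^ mdeg \<nu>)"
    by (rule norm_has_sum_bound[OF _ f, THEN order_trans])
      (auto intro!: has_sum_infsum infsum_mono summable_on_comparison_test[OF S] S le)
  with N show ?thesis by simp
qed

text \<open>Choose an expansion for each \<open>i\<close> and regroup the double family on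
  \<open>I \<times> multi_indices\<close> by its second component. The norms add up, so their
  summability yields both the series and its bound.\<close>

lemma pseries_sum:
  fixes I :: "'i set" and f :: "'i \<Rightarrow> 'v::euclidean_space \<Rightarrow> complex"
  assumes r: "r > 0" and f: "\<And>i. i \<in> I \<Longrightarrow> pseries x r (N i) (f i)"
    and S: "N summable_on I" and M: "infsum N I \<le> M"
    and g: "\<And>y. in_cube r (y - x) \<Longrightarrow> ((\<lambda>i. f i y) has_sum g y) I"
  shows "pseries x r M g"
proof -
  define P where "P i c \<longleftrightarrow> (\<lambda>\<nu>. norm (c \<nu>) * r ^ mdeg \<nu>) summable_on multi_indices \<and>
    (\<Sum>\<^sub>\<infinity>\<nu>\<in>multi_indices. norm (c \<nu>) * r ^ mdeg \<nu>) \<le> N i \<and>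
    (\<forall>y. in_cube r (y - x) \<longrightarrow> ((\<lambda>\<nu>. c \<nu> * of_real (mpow (y - x) \<nu>)) has_sum f i y) multi_indices)" for i c
  have "\<forall>i\<in>I. \<exists>c. P i c"
    using f unfolding pseries_def P_def by blast
  from bchoice[OF this] obtain c where c: "\<And>i. i \<in> I \<Longrightarrow> P i (c i)"
    by blast
  have cS: "(\<lambda>\<nu>. norm (c i \<nu>) * r ^ mdeg \<nu>) summable_on multi_indices"
    and cN: "(\<Sum>\<^sub>\<infinity>\<nu>\<in>multi_indices. norm (c i \<nu>) * r ^ mdeg \<nu>) \<le> N i" if "i \<in> I" for i
    using c[OF that] unfolding P_def by auto
  have cf: "((\<lambda>\<nu>. c i \<nu> * of_real (mpow (y - x) \<nu>)) has_sum f i y) multi_indices"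
    if "i \<in> I" "in_cube r (y - x)" for i y
    using c[OF that(1)] that(2) unfolding P_def by auto
  let ?n = "\<lambda>i. \<Sum>\<^sub>\<infinity>\<nu>\<in>multi_indices. norm (c i \<nu>) * r ^ mdeg \<nu>"
  have nS: "?n summable_on I"
    by (rule summable_on_comparison_test[OF S cN]) (use r in \<open>auto intro: infsum_nonneg\<close>)
  have S2: "(\<lambda>p. norm (c (fst p) (snd p)) * r ^ mdeg (snd p)) summable_on I \<times> multi_indices"
    by (rule summable_on_SigmaI[OF _ nS]) (use cS r in auto)
  show ?thesis
  proof (rule pseries_regroup[where I = "I \<times> multi_indices" and e = snd and d = "\<lambda>p. c (fst p) (snd p)", OF r])
    show "(\<lambda>p. norm (c (fst p) (snd p)) * r ^ mdeg (snd p)) summable_on I \<times> multi_indices"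
      by (rule S2)
    have "(\<Sum>\<^sub>\<infinity>p\<in>I \<times> multi_indices. norm (c (fst p) (snd p)) * r ^ mdeg (snd p)) = infsum ?n I"
      using infsum_Sigma_banach[OF S2] by simp
    also have "\<dots> \<le> infsum N I"
      by (rule infsum_mono[OF nS S cN])
    finally show "(\<Sum>\<^sub>\<infinity>p\<in>I \<times> multi_indices. norm (c (fst p) (snd p)) * r ^ mdeg (snd p)) \<le> M"
      using M by simp
  next
    fix y assume y: "in_cube r (y - x)"
    have "(\<lambda>p. c (fst p) (snd p) * of_real (mpow (y - x) (snd p))) summable_on I \<times> multi_indices"
    proof (rule abs_summable_summable, rule Infinite_Sum.abs_summable_on_comparison_test'[OF S2])
      show "norm (c (fst p) (snd p) * of_real (mpow (y - x) (snd p)))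
          \<le> norm (c (fst p) (snd p)) * r ^ mdeg (snd p)" for p
        using mpow_le[OF y, of "snd p"] by (simp add: norm_mult mult_left_mono)
    qed
    then show "((\<lambda>p. c (fst p) (snd p) * of_real (mpow (y - x) (snd p))) has_sum g y) (I \<times> multi_indices)"
      by (intro has_sum_SigmaI[OF _ g[OF y]]) (use cf y in auto)
  qed auto
qed

lemma pseries_cong: "pseries x r N f \<Longrightarrow> (\<And>y. in_cube r (y - x) \<Longrightarrow> f y = g y) \<Longrightarrow> pseries x r N g"
  unfolding pseries_def by auto

lemma pseries_weaken: "pseries x r N f \<Longrightarrow> N \<le> M \<Longrightarrow> pseries x r M f"
  unfolding pseries_def by (meson order_trans)

text \<open>Multiplication by a monomial only shifts exponents. Products reduce to this case: one
  factor is expanded in monomials and the other is kept whole.\<close>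

lemma pseries_monomial:
  assumes r: "r > 0" and f: "pseries x r N f" and \<mu>: "\<mu> \<in> multi_indices"
  shows "pseries x r (norm a * r ^ mdeg \<mu> * N) (\<lambda>y. a * of_real (mpow (y - x) \<mu>) * f y)"
proof -
  from f obtain c where S: "(\<lambda>\<nu>. norm (c \<nu>) * r ^ mdeg \<nu>) summable_on multi_indices"
    and N: "(\<Sum>\<^sub>\<infinity>\<nu>\<in>multi_indices. norm (c \<nu>) * r ^ mdeg \<nu>) \<le> N"
    and f: "\<And>y. in_cube r (y - x) \<Longrightarrow> ((\<lambda>\<nu>. c \<nu> * of_real (mpow (y - x) \<nu>)) has_sum f y) multi_indices"
    unfolding pseries_def by blast
  let ?t = "\<lambda>\<nu>. norm (a * c \<nu>) * r ^ mdeg (\<lambda>b. \<mu> b + \<nu> b)"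
  have t: "?t = (\<lambda>\<nu>. (norm a * r ^ mdeg \<mu>) * (norm (c \<nu>) * r ^ mdeg \<nu>))"
    by (simp add: norm_mult mdeg_add power_add mult_ac fun_eq_iff)
  show ?thesis
  proof (rule pseries_regroup[where I = multi_indices and e = "\<lambda>\<nu> b. \<mu> b + \<nu> b" and d = "\<lambda>\<nu>. a * c \<nu>", OF r])
    show "?t summable_on multi_indices"
      unfolding t by (rule summable_on_cmult_right[OF S])
    show "infsum ?t multi_indices \<le> norm a * r ^ mdeg \<mu> * N"
      unfolding t using N r by (simp add: infsum_cmult_right' mult_left_mono)
    fix y assume "in_cube r (y - x)"
    from has_sum_cmult_right[OF f[OF this], of "a * of_real (mpow (y - x) \<mu>)"]
    show "((\<lambda>\<nu>. a * c \<nu> * of_real (mpow (y - x) (\<lambda>b. \<mu> b + \<nu> b)))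
        has_sum a * of_real (mpow (y - x) \<mu>) * f y) multi_indices"
      by (simp add: mpow_add mult_ac)
  qed (use \<mu> in \<open>auto simp: multi_indices_def\<close>)
qed

lemma pseries_mult:
  assumes f: "pseries x r N f" and g: "pseries x r M g"
  shows "pseries x r (N * M) (\<lambda>y. f y * g y)"
proof -
  from f obtain c where r: "r > 0" and S: "(\<lambda>\<nu>. norm (c \<nu>) * r ^ mdeg \<nu>) summable_on multi_indices"
    and N: "(\<Sum>\<^sub>\<infinity>\<nu>\<in>multi_indices. norm (c \<nu>) * r ^ mdeg \<nu>) \<le> N"
    and f: "\<And>y. in_cube r (y - x) \<Longrightarrow> ((\<lambda>\<nu>. c \<nu> * of_real (mpow (y - x) \<nu>)) has_sum f y) multi_indices"
    unfolding pseries_def by blast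
  \<comment> \<open>A norm bounds the value at the centre, hence it is nonnegative.\<close>
  have "M \<ge> 0"
    using order_trans[OF norm_ge_zero pseries_bound[OF g, of 0 x]] r by (simp add: in_cube_0)
  show ?thesis
  proof (rule pseries_sum[OF r pseries_monomial[OF r g]])
    show "(\<lambda>\<nu>. norm (c \<nu>) * r ^ mdeg \<nu> * M) summable_on multi_indices"
      by (rule summable_on_cmult_left[OF S])
    show "(\<Sum>\<^sub>\<infinity>\<nu>\<in>multi_indices. norm (c \<nu>) * r ^ mdeg \<nu> * M) \<le> N * M"
      using N \<open>M \<ge> 0\<close> by (simp add: infsum_cmult_left' mult_right_mono)
    show "((\<lambda>\<nu>. c \<nu> * of_real (mpow (y - x) \<nu>) * g y) has_sum f y * g y) multi_indices"
      if "in_cube r (y - x)" for y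
      by (rule has_sum_cmult_left[OF f[OF that]])
  qed
qed

lemma pseries_const:
  assumes r: "r > 0"
  shows "pseries x r (norm a) (\<lambda>_. a)"
  by (rule pseries_regroup[where I = "{()}" and e = "\<lambda>_ _. 0" and d = "\<lambda>_. a", OF r])
    (auto simp: multi_indices_def mdeg_def mpow_def has_sum_finite_iff)

lemma pseries_coord:
  assumes r: "r > 0" and b: "b \<in> Basis"
  shows "pseries x r r (\<lambda>y. of_real ((y - x) \<bullet> b))"
proof -
  let ?e = "\<lambda>b'. if b' = b then 1 else (0::nat)"
  have "mpow z ?e = z \<bullet> b" for z
    using b by (simp add: mpow_def if_distrib[of "\<lambda>n. _ ^ n"] prod.delta cong: if_cong)
  moreover have "mdeg ?e = 1"
    using b by (simp add: mdeg_def)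
  ultimately show ?thesis
    using r b by (intro pseries_regroup[where I = "{()}" and e = "\<lambda>_. ?e" and d = "\<lambda>_. 1", OF r])
      (auto simp: multi_indices_def has_sum_finite_iff)
qed

lemma pseries_power: "pseries x r N f \<Longrightarrow> pseries x r (N ^ n) (\<lambda>y. f y ^ n)"
proof (induction n)
  case 0
  then have "r > 0" by (simp add: pseries_def)
  from pseries_const[OF this, of x 1] show ?case by simp
next
  case (Suc n)
  from pseries_mult[OF Suc.prems Suc.IH[OF Suc.prems]] show ?case by simp
qed

lemma pseries_prod:
  assumes "finite A" and "r > 0" and "\<And>i. i \<in> A \<Longrightarrow> pseries x r (N i) (f i)"
  shows "pseries x r (\<Prod>i\<in>A. N i) (\<lambda>y. \<Prod>i\<in>A. f i y)"
  using assms
proof (induction A rule: finite_induct)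
  case empty
  then show ?case using pseries_const[of r x 1] by simp
next
  case (insert i A)
  then show ?case using pseries_mult[of x r "N i" "f i"] by simp
qed

lemma pseries_add: "pseries x r N f \<Longrightarrow> pseries x r M g \<Longrightarrow> pseries x r (N + M) (\<lambda>y. f y + g y)"
  by (rule pseries_sum[where I = UNIV and f = "case_bool f g" and N = "case_bool N M"])
    (auto simp: pseries_def[of x r N f] UNIV_bool has_sum_finite_iff split: bool.splits)

lemma mdeg_eq_0: "\<nu> \<in> multi_indices \<Longrightarrow> mdeg \<nu> = 0 \<longleftrightarrow> \<nu> = (\<lambda>_. 0)"
  by (auto simp: multi_indices_def mdeg_def fun_eq_iff)

lemma mpow_0_right: "mpow z (\<lambda>_. 0) = 1"
  by (simp add: mpow_def)

lemma mpow_0_left: "\<nu> \<in> multi_indices \<Longrightarrow> mpow 0 \<nu> = (if \<nu> = (\<lambda>_. 0) then 1 else 0)"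
  unfolding mpow_def multi_indices_def by (auto simp: fun_eq_iff prod_zero_iff)

text \<open>With no constant term every exponent has degree at least one, so passing from
  \<open>r\<close> to \<open>s\<close> gains a factor \<open>s / r\<close>. This makes the inner
  function of a composition as small as required.\<close>

lemma pseries_shrink_vanishing:
  assumes f: "pseries x r N f" and s: "0 < s" "s \<le> r" and "f x = 0"
  shows "pseries x s (s / r * N) f"
proof -
  from f obtain c where r: "r > 0" and S: "(\<lambda>\<nu>. norm (c \<nu>) * r ^ mdeg \<nu>) summable_on multi_indices"
    and N: "(\<Sum>\<^sub>\<infinity>\<nu>\<in>multi_indices. norm (c \<nu>) * r ^ mdeg \<nu>) \<le> N"
    and f: "\<And>y. in_cube r (y - x) \<Longrightarrow> ((\<lambda>\<nu>. c \<nu> * of_real (mpow (y - x) \<nu>)) has_sum f y) multi_indices"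
    unfolding pseries_def by blast
  have "((\<lambda>\<nu>. if \<nu> = (\<lambda>_. 0) then c \<nu> else 0) has_sum f x) multi_indices"
    using f[of x] r has_sum_cong[of multi_indices "\<lambda>\<nu>. c \<nu> * complex_of_real (mpow 0 \<nu>)"
        "\<lambda>\<nu>. if \<nu> = (\<lambda>_. 0) then c \<nu> else 0" "f x"]
    by (simp add: in_cube_0 mpow_0_left)
  moreover have "((\<lambda>\<nu>. if \<nu> = (\<lambda>_. 0) then c \<nu> else 0) has_sum c (\<lambda>_. 0)) multi_indices"
    by (rule has_sum_finite_neutralI[of "{\<lambda>_. 0}"]) (auto simp: multi_indices_def)
  ultimately have c0: "c (\<lambda>_. 0) = 0"
    using \<open>f x = 0\<close> has_sum_unique by metis
  have le: "norm (c \<nu>) * s ^ mdeg \<nu> \<le> s / r * (norm (c \<nu>) * r ^ mdeg \<nu>)" if "\<nu> \<in> multi_indices" for \<nu>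
  proof (cases "mdeg \<nu>")
    case 0
    then show ?thesis using c0 mdeg_eq_0[OF that] by simp
  next
    case (Suc n)
    have "s ^ n \<le> r ^ n" using s by (intro power_mono) auto
    then have "norm (c \<nu>) * s * s ^ n \<le> norm (c \<nu>) * s * r ^ n" using s by (intro mult_left_mono) auto
    then show ?thesis using r Suc by (simp add: field_simps)
  qed
  have S': "(\<lambda>\<nu>. s / r * (norm (c \<nu>) * r ^ mdeg \<nu>)) summable_on multi_indices"
    by (rule summable_on_cmult_right[OF S])
  have S2: "(\<lambda>\<nu>. norm (c \<nu>) * s ^ mdeg \<nu>) summable_on multi_indices"
    by (rule summable_on_comparison_test[OF S' le]) (use s in auto)
  have "(\<Sum>\<^sub>\<infinity>\<nu>\<in>multi_indices. s / r * (norm (c \<nu>) * r ^ mdeg \<nu>)) \<le> s / r * N"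
    unfolding infsum_cmult_right' using s r N by (intro mult_left_mono) auto
  with infsum_mono[OF S2 S' le]
  have "(\<Sum>\<^sub>\<infinity>\<nu>\<in>multi_indices. norm (c \<nu>) * s ^ mdeg \<nu>) \<le> s / r * N"
    by (rule order_trans)
  moreover have "((\<lambda>\<nu>. c \<nu> * of_real (mpow (y - x) \<nu>)) has_sum f y) multi_indices"
    if "in_cube s (y - x)" for y
    by (rule f[OF in_cube_mono[OF that s(2)]])
  ultimately show ?thesis
    unfolding pseries_def using S2 s by blast
qed

lemma pseries_shrink:
  assumes f: "pseries x r N f" and s: "0 < s" "s \<le> r"
  shows "pseries x s N f"
proof -
  from f obtain c where r: "r > 0" and S: "(\<lambda>\<nu>. norm (c \<nu>) * r ^ mdeg \<nu>) summable_on multi_indices"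
    and N: "(\<Sum>\<^sub>\<infinity>\<nu>\<in>multi_indices. norm (c \<nu>) * r ^ mdeg \<nu>) \<le> N"
    and f: "\<And>y. in_cube r (y - x) \<Longrightarrow> ((\<lambda>\<nu>. c \<nu> * of_real (mpow (y - x) \<nu>)) has_sum f y) multi_indices"
    unfolding pseries_def by blast
  have le: "norm (c \<nu>) * s ^ mdeg \<nu> \<le> norm (c \<nu>) * r ^ mdeg \<nu>" for \<nu>
    using s by (intro mult_left_mono power_mono) auto
  have S2: "(\<lambda>\<nu>. norm (c \<nu>) * s ^ mdeg \<nu>) summable_on multi_indices"
    by (rule summable_on_comparison_test[OF S le]) (use s in auto)
  have f': "((\<lambda>\<nu>. c \<nu> * of_real (mpow (y - x) \<nu>)) has_sum f y) multi_indices"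
    if "in_cube s (y - x)" for y
    by (rule f[OF in_cube_mono[OF that s(2)]])
  show ?thesis
    unfolding pseries_def using S2 s f' order_trans[OF infsum_mono[OF S2 S le] N] by blast
qed

text \<open>As the norm is submultiplicative, substituting series of norm at most \<open>R\<close>
  for the coordinates turns the monomial of exponent \<nu> into a series of norm at most
  \<open>R ^ mdeg \<nu>\<close>. The norm of \<open>f\<close> at radius \<open>R\<close> therefore
  bounds the composite.\<close>

lemma pseries_compose:
  fixes g :: "'w::euclidean_space \<Rightarrow> 'v::euclidean_space"
  assumes f: "pseries (g x) R N f" and r: "r > 0"
    and g: "\<And>b. b \<in> Basis \<Longrightarrow> pseries x r R (\<lambda>y. of_real ((g y - g x) \<bullet> b))"
  shows "pseries x r N (\<lambda>y. f (g y))"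
proof -
  from f obtain c where R: "R > 0" and S: "(\<lambda>\<nu>. norm (c \<nu>) * R ^ mdeg \<nu>) summable_on multi_indices"
    and N: "(\<Sum>\<^sub>\<infinity>\<nu>\<in>multi_indices. norm (c \<nu>) * R ^ mdeg \<nu>) \<le> N"
    and f: "\<And>y. in_cube R (y - g x) \<Longrightarrow> ((\<lambda>\<nu>. c \<nu> * of_real (mpow (y - g x) \<nu>)) has_sum f y) multi_indices"
    unfolding pseries_def by blast
  have cube: "in_cube R (g y - g x)" if "in_cube r (y - x)" for y
    unfolding in_cube_def using pseries_bound[OF g that] r by (auto simp flip: of_real_diff)
  show ?thesis
  proof (rule pseries_sum[OF r _ S N])
    show "pseries x r (norm (c \<nu>) * R ^ mdeg \<nu>) (\<lambda>y. c \<nu> * of_real (mpow (g y - g x) \<nu>))" for \<nu>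
    proof -
      have "pseries x r (\<Prod>b\<in>Basis. R ^ \<nu> b) (\<lambda>y. \<Prod>b\<in>Basis. of_real ((g y - g x) \<bullet> b) ^ \<nu> b)"
        using r by (intro pseries_prod pseries_power g) auto
      from pseries_mult[OF pseries_const[OF r, of x "c \<nu>"] this] show ?thesis
        by (simp add: mpow_def mdeg_def power_sum)
    qed
    show "((\<lambda>\<nu>. c \<nu> * of_real (mpow (g y - g x) \<nu>)) has_sum f (g y)) multi_indices"
      if "in_cube r (y - x)" for y
      by (rule f[OF cube[OF that]])
  qed
qed

section \<open>Analyticity at a point\<close>

definition real_analytic_at :: "('v::euclidean_space \<Rightarrow> complex) \<Rightarrow> 'v \<Rightarrow> bool"
  where "real_analytic_at f x \<longleftrightarrow> (\<exists>r N. pseries x r N f)"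

text \<open>The definition gives convergence on a ball without any bound on the coefficients.
  Summability of a complex family is absolute, so the value at a corner of a cube inside the ball
  provides the bound.\<close>

lemma real_analytic_iff: "real_analytic f \<longleftrightarrow> (\<forall>x. real_analytic_at f x)"
proof (intro iffI allI)
  fix x assume "real_analytic f"
  then obtain R c where R: "R > 0" and f: "\<And>y. y \<in> ball x R \<Longrightarrow>
      ((\<lambda>\<nu>. c \<nu> * of_real (mpow (y - x) \<nu>)) has_sum f y) multi_indices"
    unfolding real_analytic_def mpow_def multi_indices_def by blast
  \<comment> \<open>The sum of the absolute coordinates on the cube is at most R / 2, so the cube
    lies in the open ball.\<close>
  define r where "r = R / (2 * DIM('a))"
  have r: "r > 0" using R by (simp add: r_def)
  have ball: "y \<in> ball x R" if "in_cube r (y - x)" for y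
  proof -
    have "norm (y - x) \<le> (\<Sum>b\<in>Basis. \<bar>(y - x) \<bullet> b\<bar>)" by (rule norm_le_l1)
    also have "\<dots> \<le> (\<Sum>b\<in>(Basis::'a set). r)" using that by (intro sum_mono) (auto simp: in_cube_def)
    also have "\<dots> < R" using R by (simp add: r_def)
    finally show ?thesis by (simp add: dist_norm norm_minus_commute)
  qed
  \<comment> \<open>The corner at which every monomial attains its bound
    \<open>r ^ mdeg \<nu>\<close>.\<close>
  let ?y = "x + (\<Sum>b\<in>Basis. r *\<^sub>R b)"
  have yb: "(?y - x) \<bullet> b = r" if "b \<in> Basis" for b
    using that by (simp add: inner_sum_left inner_Basis if_distrib cong: if_cong)
  have "mpow (?y - x) \<nu> = r ^ mdeg \<nu>" for \<nu>
    unfolding mpow_def mdeg_def power_sum using yb by (intro prod.cong) auto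
  moreover have "in_cube r (?y - x)" unfolding in_cube_def using yb r by auto
  ultimately have "((\<lambda>\<nu>. c \<nu> * of_real (r ^ mdeg \<nu>)) has_sum f ?y) multi_indices"
    using f[OF ball, of ?y] by simp
  from has_sum_imp_summable[OF this]
  have "(\<lambda>\<nu>. norm (c \<nu> * of_real (r ^ mdeg \<nu>))) summable_on multi_indices"
    by (simp only: summable_on_iff_abs_summable_on_complex)
  then have "(\<lambda>\<nu>. norm (c \<nu>) * r ^ mdeg \<nu>) summable_on multi_indices"
    using r by (simp add: norm_mult norm_power)
  then show "real_analytic_at f x"
    unfolding real_analytic_at_def pseries_def using r f ball by blast
next
  assume *: "\<forall>x. real_analytic_at f x"
  show "real_analytic f"
    unfolding real_analytic_def
  proof
    fix x
    obtain r c where r: "r > 0" and f: "\<And>y. in_cube r (y - x) \<Longrightarrow>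
        ((\<lambda>\<nu>. c \<nu> * of_real (mpow (y - x) \<nu>)) has_sum f y) multi_indices"
      using *[rule_format, of x] unfolding real_analytic_at_def pseries_def by blast
    have "in_cube r (y - x)" if "y \<in> ball x r" for y
      using that by (intro in_cube_norm) (simp add: dist_norm norm_minus_commute)
    then show "\<exists>r>0. \<exists>c. \<forall>y\<in>ball x r. ((\<lambda>\<nu>. c \<nu> * of_real (\<Prod>b\<in>Basis. ((y - x) \<bullet> b) ^ \<nu> b))
        has_sum f y) {\<nu>. \<forall>b. b \<notin> Basis \<longrightarrow> \<nu> b = 0}"
      using r f unfolding mpow_def multi_indices_def by blast
  qed
qed

lemma pseries_common_radius:
  assumes "real_analytic_at f x" and "real_analytic_at g x"
  obtains r N M where "pseries x r N f" "pseries x r M g"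
proof -
  from assms obtain r N s M where f: "pseries x r N f" and g: "pseries x s M g"
    unfolding real_analytic_at_def by blast
  then have "r > 0" "s > 0" by (auto simp: pseries_def)
  then show ?thesis
    using that[of "min r s" N M] pseries_shrink[OF f, of "min r s"] pseries_shrink[OF g, of "min r s"] by auto
qed

lemma real_analytic_at_add:
  "real_analytic_at f x \<Longrightarrow> real_analytic_at g x \<Longrightarrow> real_analytic_at (\<lambda>y. f y + g y) x"
  by (erule (1) pseries_common_radius) (auto simp: real_analytic_at_def intro: pseries_add)

lemma real_analytic_at_mult:
  "real_analytic_at f x \<Longrightarrow> real_analytic_at g x \<Longrightarrow> real_analytic_at (\<lambda>y. f y * g y) x"
  by (erule (1) pseries_common_radius) (auto simp: real_analytic_at_def intro: pseries_mult)

lemma real_analytic_at_const: "real_analytic_at (\<lambda>_. c) x"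
  unfolding real_analytic_at_def using pseries_const[of 1 x c] by auto

lemma real_analytic_at_sum:
  "(\<And>i. i \<in> A \<Longrightarrow> real_analytic_at (f i) x) \<Longrightarrow> real_analytic_at (\<lambda>y. \<Sum>i\<in>A. f i y) x"
  by (induction A rule: infinite_finite_induct)
    (auto intro: real_analytic_at_const real_analytic_at_add)

lemma real_analytic_at_linear:
  fixes h :: "'v::euclidean_space \<Rightarrow> real"
  assumes "linear h"
  shows "real_analytic_at (\<lambda>y. of_real (h y)) x"
proof -
  have "real_analytic_at (\<lambda>y. of_real ((y - x) \<bullet> b)) x" if "b \<in> Basis" for b
    unfolding real_analytic_at_def using pseries_coord[of 1 b x] that by auto
  then have "real_analytic_at (\<lambda>y. \<Sum>b\<in>Basis. of_real (h b) * of_real ((y - x) \<bullet> b)) x"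
    by (intro real_analytic_at_sum real_analytic_at_mult real_analytic_at_const)
  then have "real_analytic_at (\<lambda>y. of_real (h x) + (\<Sum>b\<in>Basis. of_real (h b) * of_real ((y - x) \<bullet> b))) x"
    by (intro real_analytic_at_add real_analytic_at_const)
  moreover have "h x + (\<Sum>b\<in>Basis. h b * ((y - x) \<bullet> b)) = h y" for y
  proof -
    have "h (y - x) = h (\<Sum>b\<in>Basis. ((y - x) \<bullet> b) *\<^sub>R b)" by (simp only: euclidean_representation)
    also have "\<dots> = (\<Sum>b\<in>Basis. h b * ((y - x) \<bullet> b))"
      by (subst linear_sum[OF assms]) (simp add: linear_scale[OF assms] mult.commute)
    finally show ?thesis using linear_diff[OF assms, of y x] by simp
  qed
  then have "(\<lambda>y. of_real (h x) + (\<Sum>b\<in>Basis. of_real (h b) * of_real ((y - x) \<bullet> b))) = (\<lambda>y. complex_of_real (h y))"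
    by (simp add: fun_eq_iff flip: of_real_mult of_real_sum of_real_add)
  ultimately show ?thesis by simp
qed

text \<open>After subtraction of \<open>g x\<close> the inner coordinates vanish at
  \<open>x\<close>, so \<open>pseries_shrink_vanishing\<close> brings their norms below the radius
  \<open>R\<close> of \<open>f\<close>.\<close>

lemma real_analytic_at_compose:
  fixes g :: "'w::euclidean_space \<Rightarrow> 'v::euclidean_space"
  assumes f: "real_analytic_at f (g x)"
    and g: "\<And>b. b \<in> Basis \<Longrightarrow> real_analytic_at (\<lambda>y. of_real (g y \<bullet> b)) x"
  shows "real_analytic_at (\<lambda>y. f (g y)) x"
proof -
  from f obtain R N where f: "pseries (g x) R N f" unfolding real_analytic_at_def by blast
  then have R: "R > 0" by (simp add: pseries_def)
  have "\<exists>r>0. \<forall>s. 0 < s \<longrightarrow> s \<le> r \<longrightarrow> pseries x s R (\<lambda>y. of_real ((g y - g x) \<bullet> b))" if b: "b \<in> Basis" for b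
  proof -
    have "real_analytic_at (\<lambda>y. of_real (g y \<bullet> b) + of_real (- g x \<bullet> b)) x"
      by (intro real_analytic_at_add g b real_analytic_at_const)
    then obtain r M where p: "pseries x r M (\<lambda>y. of_real ((g y - g x) \<bullet> b))"
      unfolding real_analytic_at_def by (auto simp: inner_diff_left)
    then have r: "r > 0" by (simp add: pseries_def)
    \<comment> \<open>For \<open>s \<le> q\<close> the shrunken norm \<open>s / r * M\<close> is at
      most \<open>R\<close>; the summand 1 keeps the denominator positive.\<close>
    define q where "q = min r (R * r / (\<bar>M\<bar> + 1))"
    show ?thesis
    proof (intro exI conjI allI impI)
      show "q > 0" using r R by (simp add: q_def)
      fix s :: real assume s: "0 < s" "s \<le> q"
      then have "pseries x s (s / r * M) (\<lambda>y. of_real ((g y - g x) \<bullet> b))"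
        by (intro pseries_shrink_vanishing[OF p]) (auto simp: q_def)
      moreover have "s / r * M \<le> R"
      proof -
        have "s / r * M \<le> s / r * (\<bar>M\<bar> + 1)" using s r by (intro mult_left_mono) auto
        also have "\<dots> \<le> (R * r / (\<bar>M\<bar> + 1)) / r * (\<bar>M\<bar> + 1)"
          using s r by (intro mult_right_mono divide_right_mono) (auto simp: q_def)
        also have "\<dots> = R" using r abs_ge_zero[of M] by (simp del: abs_ge_zero)
        finally show ?thesis .
      qed
      ultimately show "pseries x s R (\<lambda>y. of_real ((g y - g x) \<bullet> b))"
        by (rule pseries_weaken)
    qed
  qed
  then obtain q where q: "\<And>b. b \<in> Basis \<Longrightarrow> q b > 0"
    "\<And>b s. b \<in> Basis \<Longrightarrow> 0 < s \<Longrightarrow> s \<le> q b \<Longrightarrow> pseries x s R (\<lambda>y. of_real ((g y - g x) \<bullet> b))"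
    by metis
  define r where "r = Min (q ` Basis)"
  have r: "r > 0" "\<And>b. b \<in> Basis \<Longrightarrow> r \<le> q b" using q(1) by (auto simp: r_def)
  have "pseries x r N (\<lambda>y. f (g y))"
    by (rule pseries_compose[where g = g, OF f r(1)]) (use r q(2) in blast)
  then show ?thesis unfolding real_analytic_at_def by blast
qed

section \<open>Slices of power series and integrals with a parameter\<close>

lemma multi_indices_prod_bij:
  fixes h :: "nat \<times> ('v::euclidean_space \<Rightarrow> nat) \<Rightarrow> 'v \<times> real \<Rightarrow> nat"
  defines "h \<equiv> \<lambda>(n, \<nu>) p. if p = (0, 1) then n else if snd p = 0 then \<nu> (fst p) else 0"
  shows "bij_betw h (UNIV \<times> multi_indices) multi_indices"
    and "mdeg (h (n, \<nu>)) = mdeg \<nu> + n"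
    and "mpow (z, t) (h (n, \<nu>)) = mpow z \<nu> * t ^ n"
proof -
  \<comment> \<open>A multi-index on the product is an exponent \<open>n\<close> for the coordinate
    (0, 1) together with a multi-index on the first factor.\<close>
  have B: "(Basis :: ('v \<times> real) set) = insert (0, 1) ((\<lambda>u. (u, 0)) ` Basis)"
    by (auto simp: Basis_prod_def)
  have h1: "h (n, \<nu>) (0, 1) = n" and h2: "h (n, \<nu>) (b, 0) = \<nu> b" for n \<nu> b
    by (simp_all add: h_def)
  show "bij_betw h (UNIV \<times> multi_indices) multi_indices"
  proof (rule bij_betw_byWitness[where f' = "\<lambda>\<mu>. (\<mu> (0, 1), \<lambda>b. \<mu> (b, 0))"])
    show "\<forall>p\<in>UNIV \<times> multi_indices. (h p (0, 1), \<lambda>b. h p (b, 0)) = p"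
      by (auto simp: h1 h2)
    show "\<forall>\<mu>\<in>multi_indices. h (\<mu> (0, 1), \<lambda>b. \<mu> (b, 0)) = \<mu>"
      by (auto simp: multi_indices_def B h_def fun_eq_iff)
    show "h ` (UNIV \<times> multi_indices) \<subseteq> multi_indices"
      by (auto simp: multi_indices_def B h_def image_iff split: if_splits)
    show "(\<lambda>\<mu>. (\<mu> (0, 1), \<lambda>b. \<mu> (b, 0))) ` (multi_indices :: ('v \<times> real \<Rightarrow> nat) set) \<subseteq> UNIV \<times> multi_indices"
      by (auto simp: multi_indices_def B image_iff)
  qed
  have inj: "inj_on (\<lambda>u. (u, 0::real)) Basis" by (auto intro: inj_onI)
  show "mdeg (h (n, \<nu>)) = mdeg \<nu> + n"
    unfolding mdeg_def B by (subst sum.insert) (auto simp: sum.reindex[OF inj] h1 h2)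
  show "mpow (z, t) (h (n, \<nu>)) = mpow z \<nu> * t ^ n"
    unfolding mpow_def B by (subst prod.insert) (auto simp: prod.reindex[OF inj] h1 h2)
qed

text \<open>Sort the terms by the power of the last variable. Fubini for the absolutely summable
  coefficients shows that the norms \<open>M n\<close> of the slices are summable against
  \<open>r ^ n\<close>.\<close>

lemma pseries_slice:
  fixes f :: "'v::euclidean_space \<times> real \<Rightarrow> complex"
  assumes "pseries (x, t0) r N f"
  shows "\<exists>M g. (\<forall>n. pseries x r (M n) (g n)) \<and> (\<lambda>n. M n * r ^ n) summable_on UNIV \<and>
    (\<forall>y t. in_cube r (y - x) \<longrightarrow> \<bar>t - t0\<bar> \<le> r \<longrightarrow>
      ((\<lambda>n. g n y * of_real (t - t0) ^ n) has_sum f (y, t)) UNIV)"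
proof -
  define h where "h = (\<lambda>(n, \<nu>) p. if p = (0::'v, 1::real) then n else if snd p = 0 then \<nu> (fst p) else (0::nat))"
  note h = multi_indices_prod_bij[where 'v = 'v, folded h_def]
  have inj: "inj_on h (UNIV \<times> multi_indices)" and img: "h ` (UNIV \<times> multi_indices) = multi_indices"
    using h(1) by (auto simp: bij_betw_def)
  from assms obtain c where r: "r > 0" and S: "(\<lambda>\<nu>. norm (c \<nu>) * r ^ mdeg \<nu>) summable_on multi_indices"
    and f: "\<And>p. in_cube r (p - (x, t0)) \<Longrightarrow>
      ((\<lambda>\<nu>. c \<nu> * of_real (mpow (p - (x, t0)) \<nu>)) has_sum f p) multi_indices"
    unfolding pseries_def by blast
  have S': "(\<lambda>p. norm (c (h p)) * r ^ mdeg (h p)) summable_on UNIV \<times> multi_indices"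
    using S unfolding img[symmetric] by (subst (asm) summable_on_reindex[OF inj]) (simp add: o_def)
  have S'': "(\<lambda>(n, \<nu>). norm (c (h (n, \<nu>))) * r ^ mdeg \<nu> * r ^ n) summable_on UNIV \<times> multi_indices"
    by (rule summable_on_cong[THEN iffD1, OF _ S']) (auto simp: h(2) power_add)
  have S1: "(\<lambda>\<nu>. norm (c (h (n, \<nu>))) * r ^ mdeg \<nu>) summable_on multi_indices" for n
  proof -
    have "(\<lambda>\<nu>. norm (c (h (n, \<nu>))) * r ^ mdeg \<nu> * r ^ n) summable_on multi_indices"
      by (rule summable_on_SigmaD1[OF S'']) simp
    from summable_on_cmult_left[OF this, of "inverse (r ^ n)"] show ?thesis
      using r by (simp add: mult.assoc)
  qed
  define M where "M n = (\<Sum>\<^sub>\<infinity>\<nu>\<in>multi_indices. norm (c (h (n, \<nu>))) * r ^ mdeg \<nu>)" for n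
  define g where "g n y = (\<Sum>\<^sub>\<infinity>\<nu>\<in>multi_indices. c (h (n, \<nu>)) * of_real (mpow (y - x) \<nu>))" for n y
  have g: "((\<lambda>\<nu>. c (h (n, \<nu>)) * of_real (mpow (y - x) \<nu>)) has_sum g n y) multi_indices"
    if y: "in_cube r (y - x)" for n y
    unfolding g_def
  proof (intro has_sum_infsum, rule abs_summable_summable,
      rule Infinite_Sum.abs_summable_on_comparison_test'[OF S1[of n]])
    show "norm (c (h (n, \<nu>)) * of_real (mpow (y - x) \<nu>)) \<le> norm (c (h (n, \<nu>))) * r ^ mdeg \<nu>" for \<nu>
      using mpow_le[OF y, of \<nu>] by (simp add: norm_mult mult_left_mono)
  qed
  show ?thesis
  proof (intro exI conjI allI impI)
    show "pseries x r (M n) (g n)" for n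
      unfolding pseries_def using r S1[of n] g[of _ n] by (auto simp: M_def intro!: exI[of _ "\<lambda>\<nu>. c (h (n, \<nu>))"])
    have "(\<lambda>n. \<Sum>\<^sub>\<infinity>\<nu>\<in>multi_indices. norm (c (h (n, \<nu>))) * r ^ mdeg \<nu> * r ^ n) summable_on UNIV"
      by (rule summable_on_Sigma_banach[OF S''])
    then show "(\<lambda>n. M n * r ^ n) summable_on UNIV"
      by (simp add: M_def infsum_cmult_left')
  next
    fix y t assume y: "in_cube r (y - x)" and t: "\<bar>t - t0\<bar> \<le> r"
    have "in_cube r ((y, t) - (x, t0))"
      using y t by (auto simp: in_cube_def Basis_prod_def)
    from f[OF this]
    have "((\<lambda>p. c (h p) * of_real (mpow ((y, t) - (x, t0)) (h p))) has_sum f (y, t)) (UNIV \<times> multi_indices)"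
      unfolding img[symmetric] by (subst (asm) has_sum_reindex[OF inj]) (simp add: o_def)
    moreover have "((\<lambda>\<nu>. c (h (n, \<nu>)) * of_real (mpow ((y, t) - (x, t0)) (h (n, \<nu>))))
        has_sum g n y * of_real (t - t0) ^ n) multi_indices" for n
      using has_sum_cmult_left[OF g[OF y], of n "of_real (t - t0) ^ n"]
      by (simp add: h(3) mult.assoc)
    ultimately show "((\<lambda>n. g n y * of_real (t - t0) ^ n) has_sum f (y, t)) UNIV"
      by (rule has_sum_SigmaD)
  qed
qed

text \<open>Complex termwise differentiation, restricted to the real line. \<open>h\<close> is tied
  to the series only within distance \<open>r\<close> of \<open>t0\<close>, so the derivative is
  obtained at points of the open interval.\<close>

lemma power_series_real_has_vector_derivative:
  fixes a :: "nat \<Rightarrow> complex" and r :: real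
  assumes sums: "\<And>t. \<bar>t - t0\<bar> \<le> r \<Longrightarrow> (\<lambda>n. a n * of_real (t - t0) ^ n) sums h t" and t: "\<bar>t - t0\<bar> < r"
  shows "(h has_vector_derivative (suminf (\<lambda>n. diffs a n * of_real (t - t0) ^ n))) (at t)"
    and "summable (\<lambda>n. diffs a n * of_real (t - t0) ^ n)"
proof -
  define \<phi> where "\<phi> z = (suminf (\<lambda>n. a n * z ^ n))" for z
  have r: "r > 0" using t by linarith
  have sm: "summable (\<lambda>n. a n * of_real r ^ n)"
    using sums_summable[OF sums[of "t0 + r"]] r by simp
  have lt: "norm (complex_of_real (t - t0)) < norm (complex_of_real r)"
    using t r by (simp flip: of_real_diff)
  have "(\<phi> has_field_derivative (suminf (\<lambda>n. diffs a n * of_real (t - t0) ^ n))) (at (of_real (t - t0)))"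
    unfolding \<phi>_def by (rule termdiffs_strong[OF sm lt])
  then have "((\<lambda>s. \<phi> (of_real s)) has_vector_derivative (suminf (\<lambda>n. diffs a n * of_real (t - t0) ^ n)))
      (at (t - t0))"
    by (rule has_vector_derivative_real_field)
  then have "((\<lambda>s. \<phi> (of_real s)) \<circ> (\<lambda>s. s - t0) has_vector_derivative
      1 *\<^sub>R (suminf (\<lambda>n. diffs a n * of_real (t - t0) ^ n))) (at t)"
    by (intro vector_diff_chain_at) (auto intro!: derivative_eq_intros)
  then have "((\<lambda>s. \<phi> (of_real (s - t0))) has_vector_derivative (suminf (\<lambda>n. diffs a n * of_real (t - t0) ^ n))) (at t)"
    by (simp add: o_def)
  then show "(h has_vector_derivative (suminf (\<lambda>n. diffs a n * of_real (t - t0) ^ n))) (at t)"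
  proof (rule has_vector_derivative_transform_within_open[where S = "{t0 - r<..<t0 + r}"])
    fix s assume "s \<in> {t0 - r<..<t0 + r}"
    then have "\<bar>s - t0\<bar> \<le> r" by auto
    from sums[OF this] show "\<phi> (of_real (s - t0)) = h s"
      unfolding \<phi>_def by (rule sums_unique[symmetric])
  qed (use t in auto)
  show "summable (\<lambda>n. diffs a n * of_real (t - t0) ^ n)"
  proof (rule termdiff_converges[where K = r])
    show "norm (complex_of_real (t - t0)) < r" using lt r by simp
    fix z :: complex assume "norm z < r"
    then show "summable (\<lambda>n. a n * z ^ n)"
      using powser_inside[OF sm, of z] r by simp
  qed
qed

text \<open>Analyticity in \<open>y\<close> is additive over adjacent intervals. By bisection only
  short intervals around each \<open>t0\<close> remain, and there the expansion in \<open>t\<close>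
  is integrated term by term.\<close>

lemma real_analytic_at_integral:
  fixes f :: "'v::euclidean_space \<times> real \<Rightarrow> complex"
  assumes f: "\<And>p. real_analytic_at f p" and cont: "\<And>y. continuous_on UNIV (\<lambda>t. f (y, t))" and "a \<le> b"
  shows "real_analytic_at (\<lambda>y. integral {a..b} (\<lambda>t. f (y, t))) x"
  using \<open>a \<le> b\<close>
proof (induction rule: Bolzano)
  case (trans a b c)
  have "integral {a..c} (\<lambda>t. f (y, t)) = integral {a..b} (\<lambda>t. f (y, t)) + integral {b..c} (\<lambda>t. f (y, t))" for y
    using trans(3,4) by (intro Henstock_Kurzweil_Integration.integral_combine[symmetric] integrable_continuous_real
      continuous_on_subset[OF cont]) auto
  then show ?case using real_analytic_at_add[OF trans(1,2)] by simp
next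
  case (local t0)
  from f[of "(x, t0)"] obtain r N where "pseries (x, t0) r N f" unfolding real_analytic_at_def by blast
  then have r: "r > 0" and p: "pseries (x, t0) r N f" by (auto simp: pseries_def)
  obtain M g where g: "\<forall>n. pseries x r (M n) (g n)"
    and M: "(\<lambda>n. M n * r ^ n) summable_on UNIV"
    and s: "\<forall>y t. in_cube r (y - x) \<longrightarrow> \<bar>t - t0\<bar> \<le> r \<longrightarrow>
      ((\<lambda>n. g n y * of_real (t - t0) ^ n) has_sum f (y, t)) UNIV"
    using pseries_slice[OF p] by (elim exE conjE) (rule that)
  note g = g[rule_format] and s = s[rule_format]
  \<comment> \<open>Coefficients of the antiderivative in \<open>t\<close>: the index moves up by
    one and the constant term is 0.\<close>
  define e where "e n y = (if n = 0 then 0 else g (n - 1) y / of_nat n)" for n y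
  define K where "K n = (if n = 0 then 0 else M (n - 1) / of_nat n)" for n
  have e: "pseries x r (K n) (e n)" for n
  proof (cases n)
    case 0
    then show ?thesis using pseries_const[OF r, of x 0] by (simp add: e_def[abs_def] K_def)
  next
    case (Suc m)
    have "pseries x r (norm (1 / of_nat n :: complex) * M m) (\<lambda>y. 1 / of_nat n * g m y)"
      by (rule pseries_mult[OF pseries_const[OF r] g])
    then show ?thesis using Suc by (simp add: e_def[abs_def] K_def norm_divide del: of_nat_Suc)
  qed
  have M0: "M n \<ge> 0" for n
    using order_trans[OF norm_ge_zero pseries_bound[OF g, of 0 x]] r by (simp add: in_cube_0)
  have K: "(\<lambda>n. K n * r ^ n) summable_on UNIV"
  proof -
    have sr: "summable (\<lambda>n. r * (M n * r ^ n))"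
      using summable_on_imp_summable[OF M] by (rule summable_mult)
    \<comment> \<open>Division by the new exponent only helps and the shift costs one factor
      \<open>r\<close>, so these norms are summable as well.\<close>
    have le: "norm (K (Suc n) * r ^ Suc n) \<le> r * (M n * r ^ n)" for n
    proof -
      have "K (Suc n) \<le> M n" "K (Suc n) \<ge> 0"
        using M0[of n] by (auto simp: K_def field_simps)
      then show ?thesis using r by (simp add: abs_mult mult_right_mono mult.assoc mult.left_commute)
    qed
    have "summable (\<lambda>n. norm (K (Suc n) * r ^ Suc n))"
      by (rule summable_comparison_test'[OF sr, where N = 0]) (use le in \<open>simp only: norm_ge_zero real_norm_def abs_abs\<close>)
    then have "summable (\<lambda>n. norm (K n * r ^ n))"
      by (subst (asm) summable_Suc_iff)
    then show ?thesis by (rule norm_summable_imp_summable_on)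
  qed
  \<comment> \<open>The antiderivative that vanishes at \<open>t0\<close>; its norm as a series in
    \<open>y\<close> is bounded uniformly in \<open>t\<close>.\<close>
  define \<Phi> where "\<Phi> t y = (\<Sum>\<^sub>\<infinity>n. e n y * of_real (t - t0) ^ n)" for t y
  have \<Phi>: "pseries x r (infsum (\<lambda>n. K n * r ^ n) UNIV) (\<Phi> t)" "in_cube r (y - x) \<Longrightarrow>
      ((\<lambda>n. e n y * of_real (t - t0) ^ n) has_sum \<Phi> t y) UNIV" if t: "\<bar>t - t0\<bar> \<le> r" for t y
  proof -
    have pow: "\<bar>t - t0\<bar> ^ n \<le> r ^ n" for n using t by (intro power_mono) auto
    have K0: "K n \<ge> 0" for n using M0 by (simp add: K_def)
    have p: "pseries x r (K n * r ^ n) (\<lambda>y. e n y * of_real (t - t0) ^ n)" for n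
    proof -
      have "pseries x r (K n * norm (complex_of_real (t - t0) ^ n)) (\<lambda>y. e n y * of_real (t - t0) ^ n)"
        by (rule pseries_mult[OF e pseries_const[OF r]])
      then show ?thesis
        by (rule pseries_weaken) (use pow[of n] K0[of n] in \<open>simp add: norm_power mult_left_mono flip: of_real_diff\<close>)
    qed
    show hs: "((\<lambda>n. e n y * of_real (t - t0) ^ n) has_sum \<Phi> t y) UNIV" if "in_cube r (y - x)" for y
      unfolding \<Phi>_def
    proof (intro has_sum_infsum, rule abs_summable_summable,
        rule Infinite_Sum.abs_summable_on_comparison_test'[OF K])
      show "norm (e n y * of_real (t - t0) ^ n) \<le> K n * r ^ n" for n
        using pseries_bound[OF p that] r by simp
    qed
    show "pseries x r (infsum (\<lambda>n. K n * r ^ n) UNIV) (\<Phi> t)"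
      by (rule pseries_sum[OF r p K _ hs]) simp
  qed
  have deriv: "((\<lambda>t. \<Phi> t y) has_vector_derivative f (y, t)) (at t)"
    if y: "in_cube r (y - x)" and t: "\<bar>t - t0\<bar> < r" for y t
  proof -
    have "diffs (\<lambda>n. e n y) = (\<lambda>n. g n y)"
      by (simp add: diffs_def e_def fun_eq_iff del: of_nat_Suc)
    moreover have "(suminf (\<lambda>n. g n y * of_real (t - t0) ^ n)) = f (y, t)"
      using has_sum_imp_sums[OF s[OF y, of t]] t by (simp add: sums_unique[symmetric])
    ultimately show ?thesis
      using power_series_real_has_vector_derivative(1)[OF has_sum_imp_sums[OF \<Phi>(2)[OF _ y]] t] by simp
  qed
  show ?case
  proof (intro exI[of _ r] conjI allI impI r)
    \<comment> \<open>Both end points are within distance \<open>r\<close> of \<open>t0\<close>, so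
      the integral is a difference of two values of \<Phi>, each a power series in
      \<open>y\<close>.\<close>
    fix a b assume ab: "a \<le> t0 \<and> t0 \<le> b \<and> b - a < r"
    have "pseries x r (infsum (\<lambda>n. K n * r ^ n) UNIV + norm (-1 :: complex) * infsum (\<lambda>n. K n * r ^ n) UNIV)
        (\<lambda>y. \<Phi> b y + -1 * \<Phi> a y)"
      by (intro pseries_add pseries_mult pseries_const \<Phi>(1) r) (use ab in auto)
    then have "pseries x r (infsum (\<lambda>n. K n * r ^ n) UNIV + norm (-1 :: complex) * infsum (\<lambda>n. K n * r ^ n) UNIV)
        (\<lambda>y. integral {a..b} (\<lambda>t. f (y, t)))"
    proof (rule pseries_cong)
      fix y assume y: "in_cube r (y - x)"
      have "((\<lambda>t. f (y, t)) has_integral \<Phi> b y - \<Phi> a y) {a..b}"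
      proof (rule fundamental_theorem_of_calculus)
        fix t assume "t \<in> {a..b}"
        then have "\<bar>t - t0\<bar> < r" using ab by auto
        from deriv[OF y this] show "((\<lambda>t. \<Phi> t y) has_vector_derivative f (y, t)) (at t within {a..b})"
          by (rule has_vector_derivative_at_within)
      qed (use ab in auto)
      then show "\<Phi> b y + -1 * \<Phi> a y = integral {a..b} (\<lambda>t. f (y, t))"
        by (simp add: integral_unique)
    qed
    then show "real_analytic_at (\<lambda>y. integral {a..b} (\<lambda>t. f (y, t))) x"
      unfolding real_analytic_at_def by blast
  qed
qed

section \<open>Derivatives of analytic functions\<close>

lemma real_analytic_at_line_expansion:
  fixes f :: "'v::euclidean_space \<Rightarrow> complex"
  assumes "real_analytic_at f x"
  shows "\<exists>r M g. r > 0 \<and> (\<forall>n. pseries x r (M n) (g n)) \<and>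
    (\<forall>y t. in_cube r (y - x) \<longrightarrow> \<bar>t\<bar> \<le> r \<longrightarrow> (\<lambda>n. g n y * of_real t ^ n) sums f (y + t *\<^sub>R u))"
proof -
  \<comment> \<open>Base point and line parameter are treated as one variable; slicing in the
    parameter then gives coefficients that are analytic in the base point.\<close>
  have "real_analytic_at (\<lambda>p. f (fst p + snd p *\<^sub>R u)) (x, 0)"
  proof (rule real_analytic_at_compose[where f = f and g = "\<lambda>p. fst p + snd p *\<^sub>R u"])
    show "real_analytic_at (\<lambda>p. complex_of_real ((fst p + snd p *\<^sub>R u) \<bullet> b)) (x, 0)" for b
      by (rule real_analytic_at_linear) (auto intro!: linearI simp: algebra_simps inner_add_left)
  qed (use assms in simp)
  then obtain r N where p: "pseries (x, 0) r N (\<lambda>p. f (fst p + snd p *\<^sub>R u))"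
    unfolding real_analytic_at_def by blast
  then have "r > 0" by (simp add: pseries_def)
  obtain M g where g: "\<forall>n. pseries x r (M n) (g n)"
    and "(\<lambda>n. M n * r ^ n) summable_on UNIV"
    and s: "\<forall>y t. in_cube r (y - x) \<longrightarrow> \<bar>t - 0\<bar> \<le> r \<longrightarrow>
      ((\<lambda>n. g n y * of_real (t - 0) ^ n) has_sum f (fst (y, t) + snd (y, t) *\<^sub>R u)) UNIV"
    using pseries_slice[OF p] by (elim exE conjE) (rule that)
  note g = g[rule_format] and s = s[rule_format]
  show ?thesis
  proof (rule exI[of _ r], rule exI[of _ M], rule exI[of _ g], intro conjI allI impI)
    show "r > 0" by fact
    show "pseries x r (M n) (g n)" for n by (rule g)
    show "(\<lambda>n. g n y * of_real t ^ n) sums f (y + t *\<^sub>R u)"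
      if "in_cube r (y - x)" "\<bar>t\<bar> \<le> r" for y t
      using has_sum_imp_sums[OF s[of y t]] that by simp
  qed
qed

text \<open>The coefficient of the first power in the line expansion is the derivative along
  \<open>u\<close>, and it is a power series in the base point; this is why derivatives stay
  analytic.\<close>

lemma real_analytic_at_has_directional_derivative:
  assumes "real_analytic_at f x"
  obtains g where "real_analytic_at g x"
    and "eventually (\<lambda>y. ((\<lambda>t. f (y + t *\<^sub>R u)) has_vector_derivative g y) (at 0)) (nhds x)"
proof -
  obtain r M g where r: "r > 0" and g: "\<forall>n. pseries x r (M n) (g n)"
    and s: "\<forall>y t. in_cube r (y - x) \<longrightarrow> \<bar>t\<bar> \<le> r \<longrightarrow>
      (\<lambda>n. g n y * of_real t ^ n) sums f (y + t *\<^sub>R u)"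
    using real_analytic_at_line_expansion[OF assms, of u] by (elim exE conjE) (rule that)
  note g = g[rule_format] and s = s[rule_format]
  have "((\<lambda>t. f (y + t *\<^sub>R u)) has_vector_derivative g 1 y) (at 0)" if "in_cube r (y - x)" for y
    using power_series_real_has_vector_derivative(1)[of 0 r "\<lambda>n. g n y" "\<lambda>t. f (y + t *\<^sub>R u)" 0] s[OF that] r
    by (simp add: diffs_def)
  moreover have "eventually (\<lambda>y. in_cube r (y - x)) (nhds x)"
    unfolding eventually_nhds_metric using r
    by (intro exI[of _ r]) (auto intro!: in_cube_norm simp: dist_norm)
  ultimately show ?thesis
    using g[of 1] by (intro that[of "g 1"]) (auto simp: real_analytic_at_def elim: eventually_mono)
qed

text \<open>The terms of degree at least two are bounded by a constant times the square of the
  distance to \<open>x\<close>, so the linear terms form the total derivative. Linearity of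
  directional derivatives in the direction is drawn from this.\<close>

lemma real_analytic_at_has_derivative:
  fixes f :: "'v::euclidean_space \<Rightarrow> complex"
  assumes "real_analytic_at f x"
  shows "\<exists>f'. (f has_derivative f') (at x)"
proof -
  from assms obtain r c where r: "r > 0" and S: "(\<lambda>\<nu>. norm (c \<nu>) * r ^ mdeg \<nu>) summable_on multi_indices"
    and f: "\<And>y. in_cube r (y - x) \<Longrightarrow> ((\<lambda>\<nu>. c \<nu> * of_real (mpow (y - x) \<nu>)) has_sum f y) multi_indices"
    unfolding real_analytic_at_def pseries_def by blast
  define e where "e b b' = (if b' = b then 1 else (0::nat))" for b b' :: 'v
  \<comment> \<open>The multi-indices of degree zero and one.\<close>
  define A where "A = insert (\<lambda>_. 0) (e ` Basis)"
  have "e b b = 1" for b by (simp add: e_def)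
  then have e0: "(\<lambda>_. 0) \<notin> e ` Basis" by (metis imageE zero_neq_one)
  have inj: "inj_on e Basis" by (rule inj_onI) (metis e_def zero_neq_one)
  have me: "mpow z (e b) = z \<bullet> b" if "b \<in> Basis" for b z
    using that by (simp add: e_def mpow_def if_distrib[of "\<lambda>n. _ ^ n"] prod.delta cong: if_cong)
  have A: "finite A" "A \<subseteq> multi_indices"
    by (auto simp: A_def e_def multi_indices_def)
  have sumA: "(\<Sum>\<nu>\<in>A. c \<nu> * of_real (mpow z \<nu>)) = c (\<lambda>_. 0) + (\<Sum>b\<in>Basis. c (e b) * of_real (z \<bullet> b))" for z
    unfolding A_def using e0 by (simp add: sum.reindex[OF inj] mpow_0_right me)
  have deg: "mdeg \<nu> \<ge> 2" if "\<nu> \<in> multi_indices - A" for \<nu>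
  proof (rule ccontr)
    assume "\<not> mdeg \<nu> \<ge> 2"
    then consider "mdeg \<nu> = 0" | "mdeg \<nu> = 1" by linarith
    then show False
    proof cases
      case 1
      then show False using that mdeg_eq_0 by (auto simp: A_def)
    next
      case 2
      then obtain b where b: "b \<in> Basis" "\<nu> b = 1" "\<And>b'. b' \<in> Basis \<Longrightarrow> b \<noteq> b' \<Longrightarrow> \<nu> b' = 0"
        unfolding mdeg_def by (subst (asm) sum_eq_1_iff) auto
      have "\<nu> b' = e b b'" for b'
        using that b by (cases "b' \<in> Basis") (auto simp: e_def multi_indices_def)
      then have "\<nu> = e b" by blast
      then show False using that b by (simp add: A_def)
    qed
  qed
  have S': "(\<lambda>\<nu>. norm (c \<nu>) * r ^ mdeg \<nu>) summable_on multi_indices - A"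
    by (rule summable_on_subset_banach[OF S]) auto
  define N where "N = (\<Sum>\<^sub>\<infinity>\<nu>\<in>multi_indices - A. norm (c \<nu>) * r ^ mdeg \<nu>)"
  have N: "N \<ge> 0" unfolding N_def using r by (intro infsum_nonneg) auto
  define L where "L z = (\<Sum>b\<in>Basis. c (e b) * of_real (z \<bullet> b))" for z
  have rem: "norm (f y - (c (\<lambda>_. 0) + L (y - x))) \<le> (norm (y - x) / r) ^ 2 * N" if y: "norm (y - x) \<le> r" for y
  proof -
    let ?\<rho> = "norm (y - x)"
    \<comment> \<open>On the cube whose half-side is the distance \<open>?\<rho>\<close> itself, a
      monomial of degree at least two yields two factors \<open>?\<rho> / r\<close>.\<close>
    have cube: "in_cube ?\<rho> (y - x)" by (rule in_cube_norm) simp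
    have hs: "((\<lambda>\<nu>. c \<nu> * of_real (mpow (y - x) \<nu>)) has_sum f y - (c (\<lambda>_. 0) + L (y - x))) (multi_indices - A)"
      unfolding L_def sumA[symmetric]
      by (intro has_sum_Diff f in_cube_mono[OF cube y] has_sum_finite A)
    have le: "norm (c \<nu> * of_real (mpow (y - x) \<nu>)) \<le> (?\<rho> / r) ^ 2 * (norm (c \<nu>) * r ^ mdeg \<nu>)"
      if \<nu>: "\<nu> \<in> multi_indices - A" for \<nu>
    proof -
      obtain m where m: "mdeg \<nu> = 2 + m" using deg[OF \<nu>] le_Suc_ex by blast
      have "\<bar>mpow (y - x) \<nu>\<bar> \<le> ?\<rho> ^ (2 + m)" using mpow_le[OF cube, of \<nu>] m by simp
      also have "\<dots> = ?\<rho> ^ 2 * ?\<rho> ^ m" by (rule power_add)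
      also have "\<dots> \<le> ?\<rho> ^ 2 * r ^ m" using y by (intro mult_left_mono power_mono) auto
      also have "\<dots> = (?\<rho> / r) ^ 2 * r ^ mdeg \<nu>" using r m by (simp add: power_divide power_add power2_eq_square)
      finally have "norm (c \<nu>) * \<bar>mpow (y - x) \<nu>\<bar> \<le> norm (c \<nu>) * ((?\<rho> / r) ^ 2 * r ^ mdeg \<nu>)"
        by (rule mult_left_mono) simp
      then show ?thesis by (simp add: norm_mult mult_ac)
    qed
    have S2: "(\<lambda>\<nu>. (?\<rho> / r) ^ 2 * (norm (c \<nu>) * r ^ mdeg \<nu>)) summable_on multi_indices - A"
      by (rule summable_on_cmult_right[OF S'])
    have S3: "(\<lambda>\<nu>. norm (c \<nu> * of_real (mpow (y - x) \<nu>))) summable_on multi_indices - A"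
      by (rule Infinite_Sum.abs_summable_on_comparison_test'[OF S2 le])
    have "norm (f y - (c (\<lambda>_. 0) + L (y - x))) \<le> (\<Sum>\<^sub>\<infinity>\<nu>\<in>multi_indices - A. norm (c \<nu> * of_real (mpow (y - x) \<nu>)))"
      by (rule norm_has_sum_bound[OF has_sum_infsum[OF S3] hs])
    also have "\<dots> \<le> (\<Sum>\<^sub>\<infinity>\<nu>\<in>multi_indices - A. (?\<rho> / r) ^ 2 * (norm (c \<nu>) * r ^ mdeg \<nu>))"
      by (rule infsum_mono[OF S3 S2 le])
    also have "\<dots> = (?\<rho> / r) ^ 2 * N"
      unfolding N_def by (rule infsum_cmult_right')
    finally show ?thesis .
  qed
  have f0: "f x = c (\<lambda>_. 0)"
    using rem[of x] r by (simp add: L_def)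
  have "(f has_derivative L) (at x)"
  proof (rule has_derivativeI_sandwich[where e = r and H = "\<lambda>y. norm (y - x) * (N / r\<^sup>2)"])
    show "bounded_linear L"
      unfolding L_def by (intro bounded_linear_sum bounded_linear_const_mult
        bounded_linear_compose[OF bounded_linear_of_real] bounded_linear_inner_left)
    fix y assume "y \<noteq> x" "dist y x < r"
    then have "norm (f y - f x - L (y - x)) \<le> (norm (y - x) / r) ^ 2 * N"
      using rem[of y] f0 by (simp add: dist_norm diff_diff_add)
    then show "norm (f y - f x - L (y - x)) / norm (y - x) \<le> norm (y - x) * (N / r\<^sup>2)"
      using \<open>y \<noteq> x\<close> r by (simp add: field_simps power2_eq_square)
  next
    have "((\<lambda>y. norm (y - x) * (N / r\<^sup>2)) \<longlongrightarrow> norm (x - x) * (N / r\<^sup>2)) (at x)"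
      by (intro tendsto_intros)
    then show "((\<lambda>y. norm (y - x) * (N / r\<^sup>2)) \<longlongrightarrow> 0) (at x)" by simp
  qed (use r in auto)
  then show ?thesis by blast
qed

lemma real_analytic_at_cong:
  fixes f g :: "'v::euclidean_space \<Rightarrow> complex"
  assumes eq: "eventually (\<lambda>y. f y = g y) (nhds x)" and f: "real_analytic_at f x"
  shows "real_analytic_at g x"
proof -
  from f obtain r N where p: "pseries x r N f" unfolding real_analytic_at_def by blast
  then have r: "r > 0" by (simp add: pseries_def)
  from eq obtain d where d: "d > 0" "\<And>y. dist y x < d \<Longrightarrow> f y = g y"
    unfolding eventually_nhds_metric by blast
  \<comment> \<open>On the cube of half-side \<open>s\<close> the absolute coordinates sum to at
    most d / 2, so it lies in the ball of radius \<open>d\<close>.\<close>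
  define s where "s = min r (d / (2 * DIM('v)))"
  have s: "0 < s" "s \<le> r" using r d by (auto simp: s_def)
  have "pseries x s N g"
  proof (rule pseries_cong[OF pseries_shrink[OF p s]])
    fix y assume "in_cube s (y - x)"
    then have "(\<Sum>b\<in>Basis. \<bar>(y - x) \<bullet> b\<bar>) \<le> (\<Sum>b\<in>(Basis::'v set). d / (2 * DIM('v)))"
      by (intro sum_mono) (auto simp: in_cube_def s_def)
    also have "\<dots> < d" using d by simp
    finally show "f y = g y"
      using norm_le_l1[of "y - x"] by (intro d(2)) (simp add: dist_norm)
  qed
  then show ?thesis unfolding real_analytic_at_def by blast
qed

section \<open>The space of analytic functions and its directional derivatives\<close>

lemma capply_analytic: "real_analytic_at (capply f) x"
  using capply[of f] by (simp add: real_analytic_iff)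

lemma capply_Abs_canalytic:
  assumes "\<And>x. real_analytic_at f x"
  shows "capply (Abs_canalytic f) = f"
  by (intro Abs_canalytic_inverse CollectI real_analytic_iff[THEN iffD2] allI assms)

lemma canalytic_eqI: "(\<And>x. capply f x = capply g x) \<Longrightarrow> f = g"
  by (simp add: capply_inject[symmetric] fun_eq_iff)

lemmas capply_simps [simp] = plus_canalytic.rep_eq minus_canalytic.rep_eq uminus_canalytic.rep_eq
  zero_canalytic.rep_eq scaleC_canalytic.rep_eq

text \<open>\<open>Abs_canalytic\<close> is meaningful here because near every point the derivative
  agrees with the analytic coefficient of the line expansion.\<close>

lemma capply_directional_deriv:
  "capply (directional_deriv v f) x = vector_derivative (\<lambda>t. capply f (x + t *\<^sub>R v)) (at 0)"
proof -
  have "real_analytic_at (\<lambda>x. vector_derivative (\<lambda>t. capply f (x + t *\<^sub>R v)) (at 0)) x" for x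
  proof (rule real_analytic_at_has_directional_derivative[OF capply_analytic[of f x], where u = v])
    fix g assume g: "real_analytic_at g x"
      and ev: "eventually (\<lambda>y. ((\<lambda>t. capply f (y + t *\<^sub>R v)) has_vector_derivative g y) (at 0)) (nhds x)"
    from ev have "eventually (\<lambda>y. g y = vector_derivative (\<lambda>t. capply f (y + t *\<^sub>R v)) (at 0)) (nhds x)"
      by (rule eventually_mono) (simp add: vector_derivative_at)
    then show ?thesis using g by (rule real_analytic_at_cong)
  qed
  then show ?thesis by (simp add: directional_deriv_def capply_Abs_canalytic)
qed

lemma capply_has_derivative: "(capply f has_derivative (\<lambda>h. capply (directional_deriv h f) x)) (at x)"
proof -
  obtain f' where f': "(capply f has_derivative f') (at x)"
    using real_analytic_at_has_derivative[OF capply_analytic] by blast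
  have "f' v = capply (directional_deriv v f) x" for v
  proof -
    have 1: "((\<lambda>t. x + t *\<^sub>R v) has_derivative (\<lambda>t. t *\<^sub>R v)) (at 0)"
      by (auto intro!: derivative_eq_intros)
    have "((\<lambda>t. capply f (x + t *\<^sub>R v)) has_derivative (\<lambda>t. f' (t *\<^sub>R v))) (at 0)"
      using has_derivative_compose[OF 1, of "capply f" f'] f' by simp
    then have "((\<lambda>t. capply f (x + t *\<^sub>R v)) has_vector_derivative f' v) (at 0)"
      using has_derivative_linear[OF f'] by (simp add: has_vector_derivative_def linear_cmul)
    then show ?thesis by (simp add: capply_directional_deriv vector_derivative_at)
  qed
  then have "f' = (\<lambda>h. capply (directional_deriv h f) x)" by (rule ext)
  with f' show ?thesis by simp
qed

lemma continuous_on_capply [continuous_intros]: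
  "continuous_on S g \<Longrightarrow> continuous_on S (\<lambda>x. capply f (g x))"
  by (rule continuous_on_compose2[of UNIV])
    (auto intro!: continuous_at_imp_continuous_on has_derivative_continuous[OF capply_has_derivative])

lemma capply_line_has_vector_derivative:
  "((\<lambda>t. capply f (x + t *\<^sub>R v)) has_vector_derivative capply (directional_deriv v f) (x + t *\<^sub>R v)) (at t within S)"
proof -
  have 1: "((\<lambda>t. x + t *\<^sub>R v) has_derivative (\<lambda>t. t *\<^sub>R v)) (at t within S)"
    by (auto intro!: derivative_eq_intros)
  have "((\<lambda>t. capply f (x + t *\<^sub>R v)) has_derivative
      (\<lambda>s. capply (directional_deriv (s *\<^sub>R v) f) (x + t *\<^sub>R v))) (at t within S)"
    using has_derivative_compose[OF 1 capply_has_derivative] by simp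
  then show ?thesis
    using linear_cmul[OF has_derivative_linear[OF capply_has_derivative[of f "x + t *\<^sub>R v"]]]
    by (simp add: has_vector_derivative_def)
qed

lemma directional_deriv_eqI:
  assumes "\<And>x. ((\<lambda>t. capply f (x + t *\<^sub>R v)) has_vector_derivative capply g x) (at 0)"
  shows "directional_deriv v f = g"
  by (rule canalytic_eqI) (simp add: capply_directional_deriv vector_derivative_at[OF assms])

lemma directional_deriv_add_left: "directional_deriv (u + v) f = directional_deriv u f + directional_deriv v f"
  using linear_add[OF has_derivative_linear[OF capply_has_derivative]] by (intro canalytic_eqI) simp

lemma directional_deriv_scaleR: "directional_deriv (c *\<^sub>R v) f = complex_of_real c *\<^sub>C directional_deriv v f"
  using linear_cmul[OF has_derivative_linear[OF capply_has_derivative]]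
  by (intro canalytic_eqI) (simp add: scaleR_conv_of_real)

lemma directional_deriv_minus: "directional_deriv (- v) f = - directional_deriv v f"
  using directional_deriv_scaleR[of "-1" v f] by (intro canalytic_eqI) simp

lemma directional_deriv_diff_left: "directional_deriv (u - v) f = directional_deriv u f - directional_deriv v f"
  using directional_deriv_add_left[of u "- v" f] by (simp add: directional_deriv_minus)

lemma clinear_directional_deriv: "clinear (directional_deriv v)"
proof unfold_locales
  show "directional_deriv v (f + g) = directional_deriv v f + directional_deriv v g" for f g
    using capply_line_has_vector_derivative[of _ _ v 0 UNIV]
    by (intro directional_deriv_eqI) (auto intro!: derivative_eq_intros)
  show "directional_deriv v (c *\<^sub>C f) = c *\<^sub>C directional_deriv v f" for c f
    using capply_line_has_vector_derivative[of f _ v 0 UNIV]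
    by (intro directional_deriv_eqI) (auto intro!: derivative_eq_intros)
qed

text \<open>Write f(x + b v + s u) - f(x + s u) as the integral of the derivative along
  \<open>v\<close>, differentiate under the integral sign in \<open>s\<close>, and then
  differentiate the result in \<open>b\<close>.\<close>

lemma directional_deriv_commute:
  "directional_deriv u (directional_deriv v f) = directional_deriv v (directional_deriv u f)"
proof (rule canalytic_eqI)
  fix x
  let ?fu = "directional_deriv u f" and ?fv = "directional_deriv v f"
  let ?fuv = "directional_deriv u ?fv"
  have eq: "capply ?fu (x + b *\<^sub>R v) = capply ?fu x + integral {0..b} (\<lambda>t. capply ?fuv (x + t *\<^sub>R v))"
    if "b \<ge> 0" for b
  proof -
    have I: "((\<lambda>t. capply ?fv ((x + s *\<^sub>R u) + t *\<^sub>R v)) has_integral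
        capply f ((x + s *\<^sub>R u) + b *\<^sub>R v) - capply f (x + s *\<^sub>R u)) {0..b}" for s
      using fundamental_theorem_of_calculus[OF that capply_line_has_vector_derivative[of f "x + s *\<^sub>R u" v]]
      by simp
    have "((\<lambda>s. integral (cbox 0 b) (\<lambda>t. capply ?fv ((x + s *\<^sub>R u) + t *\<^sub>R v))) has_vector_derivative
        integral (cbox 0 b) (\<lambda>t. capply ?fuv ((x + 0 *\<^sub>R u) + t *\<^sub>R v))) (at 0 within UNIV)"
    proof (rule leibniz_rule_vector_derivative)
      show "((\<lambda>s. capply ?fv ((x + s *\<^sub>R u) + t *\<^sub>R v)) has_vector_derivative
          capply ?fuv ((x + s *\<^sub>R u) + t *\<^sub>R v)) (at s within UNIV)" for s t
        using capply_line_has_vector_derivative[of ?fv "x + t *\<^sub>R v" u s UNIV] by (simp add: add_ac)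
    qed (use I in \<open>auto simp: split_def intro!: continuous_intros\<close>)
    then have "((\<lambda>s. capply f ((x + b *\<^sub>R v) + s *\<^sub>R u) - capply f (x + s *\<^sub>R u)) has_vector_derivative
        integral {0..b} (\<lambda>t. capply ?fuv (x + t *\<^sub>R v))) (at 0)"
      unfolding cbox_interval integral_unique[OF I] by (simp add: add_ac)
    moreover have "((\<lambda>s. capply f ((x + b *\<^sub>R v) + s *\<^sub>R u) - capply f (x + s *\<^sub>R u)) has_vector_derivative
        capply ?fu ((x + b *\<^sub>R v) + 0 *\<^sub>R u) - capply ?fu (x + 0 *\<^sub>R u)) (at 0)"
      by (intro has_vector_derivative_diff capply_line_has_vector_derivative)
    ultimately show ?thesis
      using vector_derivative_unique_at by fastforce
  qed
  \<comment> \<open>The identity \<open>eq\<close> is available for \<open>b \<ge> 0\<close> only,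
    hence derivatives within the interval from 0 to 1.\<close>
  have "((\<lambda>b. capply ?fu x + integral {0..b} (\<lambda>t. capply ?fuv (x + t *\<^sub>R v))) has_vector_derivative
      0 + capply ?fuv (x + 0 *\<^sub>R v)) (at 0 within {0..1})"
    by (intro has_vector_derivative_add has_vector_derivative_const integral_has_vector_derivative
        continuous_intros) auto
  moreover have "((\<lambda>b. capply ?fu x + integral {0..b} (\<lambda>t. capply ?fuv (x + t *\<^sub>R v))) has_vector_derivative
      capply (directional_deriv v ?fu) (x + 0 *\<^sub>R v)) (at 0 within {0..1})"
    using capply_line_has_vector_derivative[of ?fu x v 0 "{0..1}"]
    by (rule has_vector_derivative_transform[rotated 2]) (auto simp: eq)
  ultimately show "capply ?fuv x = capply (directional_deriv v ?fu) x"
    using vector_derivative_unique_within_closed_interval[of 0 1 0] by force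
qed

section \<open>The identity theorem\<close>

lemma power_series_coeff_zero:
  fixes a :: "nat \<Rightarrow> complex" and h :: "nat \<Rightarrow> real \<Rightarrow> complex"
  assumes "r > 0" and "\<And>k t. (h k has_vector_derivative h (Suc k) t) (at t)"
    and "\<And>t. \<bar>t - t0\<bar> \<le> r \<Longrightarrow> (\<lambda>n. a n * of_real (t - t0) ^ n) sums h 0 t"
    and "\<And>k. h k t0 = 0"
  shows "a n = 0"
  using assms
proof (induction n arbitrary: a h r)
  case 0
  have "(\<lambda>n. a n * 0 ^ n) sums h 0 t0"
    using 0(3)[of t0] 0(1) by simp
  with powser_sums_zero[of a] show ?case
    using 0(4)[of 0] sums_unique2 by metis
next
  case (Suc n)
  have "diffs a n = 0"
  \<comment> \<open>Termwise differentiation holds in the open interval while the hypothesis asks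
    for a closed one; halving the radius bridges the gap.\<close>
  proof (rule Suc.IH[of "r / 2" "\<lambda>k. h (Suc k)" "diffs a"])
    fix t :: real assume "\<bar>t - t0\<bar> \<le> r / 2"
    then have "\<bar>t - t0\<bar> < r" using Suc.prems(1) by linarith
    note d = power_series_real_has_vector_derivative[OF Suc.prems(3) this]
    have "suminf (\<lambda>n. diffs a n * of_real (t - t0) ^ n) = h (Suc 0) t"
      using vector_derivative_unique_at[OF d(1) Suc.prems(2)] by simp
    then show "(\<lambda>n. diffs a n * of_real (t - t0) ^ n) sums h (Suc 0) t"
      using summable_sums[OF d(2)] by simp
  qed (use Suc.prems in auto)
  then show ?case by (simp add: diffs_def del: of_nat_Suc)
qed

text \<open>On the line from \<open>x\<close> to \<open>y\<close> the parameters at which all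
  derivatives along the line vanish form a closed set. The power series at such a parameter has zero
  coefficients, so the set is also open, and it contains 0. Pure powers of one derivative suffice,
  without mixed ones.\<close>

theorem canalytic_identity:
  assumes zero: "\<And>w n. capply ((directional_deriv w ^^ n) f) x = 0"
  shows "f = 0"
proof (rule canalytic_eqI)
  fix y
  define w where "w = y - x"
  define h where "h n t = capply ((directional_deriv w ^^ n) f) (x + t *\<^sub>R w)" for n t
  have deriv: "(h n has_vector_derivative h (Suc n) t) (at t)" for n t
    unfolding h_def[abs_def] using capply_line_has_vector_derivative[of "(directional_deriv w ^^ n) f" x w t UNIV] by simp
  define Z where "Z = {t. \<forall>n. h n t = 0}"
  have "Z = (\<Inter>n. h n -` {0})" by (auto simp: Z_def)
  moreover have "closed (h n -` {0})" for n
    unfolding h_def[abs_def] by (intro closed_vimage continuous_intros)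
  ultimately have "closed Z" by auto
  moreover have "open Z"
  proof (subst open_subopen, intro ballI)
    fix t0 assume t0: "t0 \<in> Z"
    obtain r M g where r: "r > 0" and "\<forall>n. pseries (x + t0 *\<^sub>R w) r (M n) (g n)"
      and s: "\<forall>y t. in_cube r (y - (x + t0 *\<^sub>R w)) \<longrightarrow> \<bar>t\<bar> \<le> r \<longrightarrow> (\<lambda>n. g n y * of_real t ^ n) sums capply f (y + t *\<^sub>R w)"
      using real_analytic_at_line_expansion[OF capply_analytic, of "x + t0 *\<^sub>R w" f w] by (elim exE conjE) (rule that)
    define a where "a n = g n (x + t0 *\<^sub>R w)" for n
    have sums: "(\<lambda>n. a n * of_real (t - t0) ^ n) sums h 0 t" if "\<bar>t - t0\<bar> \<le> r" for t
      using s[rule_format, of "x + t0 *\<^sub>R w" "t - t0"] that r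
      by (simp add: a_def h_def in_cube_0 algebra_simps)
    have "a n = 0" for n
      by (rule power_series_coeff_zero[of r h t0 a, OF r deriv sums]) (use t0 in \<open>auto simp: Z_def\<close>)
    then have h0: "h 0 t = 0" if "\<bar>t - t0\<bar> \<le> r" for t
      using sums[OF that] by (simp add: sums_iff)
    \<comment> \<open>Membership in \<open>Z\<close> concerns all orders, so the vanishing of
      \<open>h 0\<close> is passed on to every derivative.\<close>
    have "\<bar>t - t0\<bar> < r \<longrightarrow> h n t = 0" for n t
    proof (induction n arbitrary: t)
      case 0
      then show ?case using h0 by simp
    next
      case (Suc n)
      show ?case
      proof
        assume t: "\<bar>t - t0\<bar> < r"
        have "((\<lambda>_. 0) has_vector_derivative h (Suc n) t) (at t)"
          by (rule has_vector_derivative_transform_within_open[OF deriv, of "{t0 - r<..<t0 + r}"])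
            (use t Suc.IH in auto)
        then show "h (Suc n) t = 0"
          using vector_derivative_unique_at has_vector_derivative_const by blast
      qed
    qed
    then show "\<exists>T. open T \<and> t0 \<in> T \<and> T \<subseteq> Z"
      using r by (intro exI[of _ "{t0 - r<..<t0 + r}"]) (auto simp: Z_def)
  qed
  moreover have "0 \<in> Z" using zero by (simp add: Z_def h_def)
  ultimately have "Z = UNIV" using clopen[of Z] by auto
  then have "h 0 1 = 0" by (auto simp: Z_def)
  then show "capply f y = capply 0 y" by (simp add: h_def w_def)
qed

section \<open>Isometries and integral operators\<close>

lemma iapply_plus [simp]: "iapply (g + h) x = iapply g (iapply h x)"
  by (simp add: plus_isom.rep_eq)

lemma iapply_zero [simp]: "iapply 0 x = x"
  by (simp add: zero_isom.rep_eq)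

lemma iapply_cancel [simp]: "iapply (- g) (iapply g x) = x" "iapply g (iapply (- g) x) = x"
  by (simp_all flip: iapply_plus)

lemma iapply_minus [simp]: "iapply (g - h) x = iapply g (iapply (- h) x)"
  by (simp only: minus_isom_def iapply_plus)

lemma isom_eqI: "(\<And>x. iapply g x = iapply h x) \<Longrightarrow> g = h"
  by (simp add: iapply_inject[symmetric] fun_eq_iff)

lemma orthogonal_linear_part: "orthogonal_transformation (linear_part g)"
  unfolding orthogonal_transformation_isometry linear_part_def
  using iapply[of g] by (simp add: dist_norm)

lemma linear_linear_part: "linear (linear_part g)"
  using orthogonal_linear_part by (rule orthogonal_transformation_linear)

lemma iapply_add: "iapply g (x + v) = iapply g x + linear_part g v"
  using linear_add[OF linear_linear_part[of g], of x v] by (simp add: linear_part_def)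

text \<open>An isometry is a constant plus a linear map, so composition with it preserves
  analyticity.\<close>

lemma capply_canalytic_act: "capply (canalytic_act w f) x = capply f (iapply (- w) x)"
proof -
  have "real_analytic_at (\<lambda>x. capply f (iapply (- w) x)) x" for x
  proof (rule real_analytic_at_compose[where f = "capply f" and g = "iapply (- w)"])
    fix b
    have "real_analytic_at (\<lambda>y. complex_of_real (iapply (- w) 0 \<bullet> b) + complex_of_real (linear_part (- w) y \<bullet> b)) x"
      by (intro real_analytic_at_add real_analytic_at_const real_analytic_at_linear
        linear_compose[OF linear_linear_part, unfolded o_def] bounded_linear.linear[OF bounded_linear_inner_left])
    moreover have "iapply (- w) y = iapply (- w) 0 + linear_part (- w) y" for y
      using iapply_add[of "- w" 0 y] by simp
    ultimately show "real_analytic_at (\<lambda>y. complex_of_real (iapply (- w) y \<bullet> b)) x"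
      by (metis (no_types, lifting) inner_add_left of_real_add ext)
  qed (rule capply_analytic)
  then show ?thesis
    unfolding canalytic_act_def isom_act_def by (simp add: capply_Abs_canalytic)
qed

lemma canalytic_act_plus: "canalytic_act (g + h) f = canalytic_act g (canalytic_act h f)"
  by (rule canalytic_eqI) (simp only: capply_canalytic_act minus_add iapply_plus)

lemma canalytic_act_zero [simp]: "canalytic_act 0 f = f"
  by (rule canalytic_eqI) (simp add: capply_canalytic_act)

lemma clinear_canalytic_act: "clinear (canalytic_act w)"
  by unfold_locales (auto intro!: canalytic_eqI simp: capply_canalytic_act)

lemma canalytic_act_directional_deriv:
  "canalytic_act w (directional_deriv v f) = directional_deriv (linear_part w v) (canalytic_act w f)"
proof (rule directional_deriv_eqI[symmetric])
  fix x
  have "iapply (- w) (x + t *\<^sub>R linear_part w v) = iapply (- w) x + t *\<^sub>R v" for t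
  proof -
    have "iapply w (iapply (- w) x + t *\<^sub>R v) = x + t *\<^sub>R linear_part w v"
      by (simp add: iapply_add linear_cmul[OF linear_linear_part])
    then show ?thesis by (metis iapply_cancel(1))
  qed
  then show "((\<lambda>t. capply (canalytic_act w f) (x + t *\<^sub>R linear_part w v)) has_vector_derivative
      capply (canalytic_act w (directional_deriv v f)) x) (at 0)"
    using capply_line_has_vector_derivative[of f "iapply (- w) x" v 0 UNIV]
    by (simp add: capply_canalytic_act)
qed

text \<open>The primitive at \<open>y\<close> is the integral of \<open>f\<close> along the
  direction \<open>u\<close> from the hyperplane \<open>l = 0\<close> up to
  \<open>y\<close>.\<close>

lemma ex_primitive:
  fixes f :: "'v::euclidean_space canalytic" and l :: "'v \<Rightarrow> real"
  assumes l: "linear l" and lu: "l u = 1"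
  shows "\<exists>g. directional_deriv u g = f"
proof -
  \<comment> \<open>Substituting \<tau> = \<open>s * l y\<close> makes the limits 0 and 1, so that
    \<open>y\<close> enters through the integrand and an outer factor, and
    \<open>real_analytic_at_integral\<close> applies.\<close>
  define G where "G p = capply f (fst p + ((snd p - 1) * l (fst p)) *\<^sub>R u)" for p :: "'v \<times> real"
  define g where "g y = complex_of_real (l y) * integral {0..1} (\<lambda>s. G (y, s))" for y
  have G: "real_analytic_at G p" for p
    unfolding G_def[abs_def]
  proof (rule real_analytic_at_compose[where f = "capply f" and g = "\<lambda>p. fst p + ((snd p - 1) * l (fst p)) *\<^sub>R u"])
    fix b
    have "real_analytic_at (\<lambda>p::'v \<times> real. complex_of_real (fst p \<bullet> b)
        + (complex_of_real (snd p) + (-1)) * complex_of_real (l (fst p)) * complex_of_real (u \<bullet> b)) p"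
      by (intro real_analytic_at_add real_analytic_at_mult real_analytic_at_const real_analytic_at_linear)
        (auto intro!: linearI simp: inner_add_left linear_add[OF l] linear_cmul[OF l])
    then show "real_analytic_at (\<lambda>p::'v \<times> real. complex_of_real ((fst p + ((snd p - 1) * l (fst p)) *\<^sub>R u) \<bullet> b)) p"
      by (simp add: inner_add_left)
  qed (rule capply_analytic)
  have "continuous_on UNIV (\<lambda>s. G (y, s))" for y
    unfolding G_def fst_conv snd_conv by (intro continuous_intros)
  from real_analytic_at_integral[OF G this, of 0 1]
  have "real_analytic_at g x" for x
    unfolding g_def[abs_def] by (intro real_analytic_at_mult real_analytic_at_linear[OF l]) auto
  then have g: "capply (Abs_canalytic g) = g"
    by (rule capply_Abs_canalytic)
  have "directional_deriv u (Abs_canalytic g) = f"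
  proof (rule directional_deriv_eqI)
    fix x
    \<comment> \<open>The projection of \<open>x\<close> to the hyperplane along \<open>u\<close>.
      On the line through it \<open>g\<close> is \<open>H \<tau> - H 0\<close> for an antiderivative
      \<open>H\<close> of \<open>f\<close> restricted to that line.\<close>
    define x' where "x' = x - l x *\<^sub>R u"
    define h where "h \<tau> = capply f (x' + \<tau> *\<^sub>R u)" for \<tau>
    have "continuous_on UNIV h"
      unfolding h_def[abs_def] by (intro continuous_intros)
    then have "isCont h \<tau>" for \<tau> by (simp add: continuous_on_eq_continuous_at)
    then obtain H where H: "\<And>\<tau>. (H has_vector_derivative h \<tau>) (at \<tau>)"
      using einterval_antiderivative[of "-\<infinity>" \<infinity> h] by auto
    have gH: "g (x + t *\<^sub>R u) = H (l x + t) - H 0" for t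
    proof -
      define \<tau> where "\<tau> = l x + t"
      have l\<tau>: "l (x + t *\<^sub>R u) = \<tau>"
        by (simp add: \<tau>_def linear_add[OF l] linear_cmul[OF l] lu)
      have G': "G (x + t *\<^sub>R u, s) = h (s * \<tau>)" for s
        unfolding G_def h_def x'_def fst_conv snd_conv l\<tau> by (simp add: \<tau>_def algebra_simps)
      have "((\<lambda>s. s * \<tau>) has_vector_derivative \<tau>) (at s within {0..1})" for s
        by (auto intro!: derivative_eq_intros simp flip: has_real_derivative_iff_has_vector_derivative)
      from vector_diff_chain_within[OF this has_vector_derivative_at_within[OF H]]
      have "((\<lambda>s. H (s * \<tau>)) has_vector_derivative \<tau> *\<^sub>R h (s * \<tau>)) (at s within {0..1})" for s
        by (simp add: o_def)
      then have "((\<lambda>s. \<tau> *\<^sub>R h (s * \<tau>)) has_integral H (1 * \<tau>) - H (0 * \<tau>)) {0..1}"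
        by (intro fundamental_theorem_of_calculus) auto
      from integral_unique[OF this]
      have "\<tau> *\<^sub>R integral {0..1} (\<lambda>s. h (s * \<tau>)) = H \<tau> - H 0"
        by simp
      then show ?thesis
        by (simp add: g_def l\<tau> G' scaleR_conv_of_real flip: \<tau>_def)
    qed
    have "((\<lambda>t. H (l x + t) - H 0) has_vector_derivative 1 *\<^sub>R h (l x + 0) - 0) (at 0)"
      by (intro has_vector_derivative_diff has_vector_derivative_const
        vector_diff_chain_at[of "\<lambda>t. l x + t" 1 0 H, unfolded o_def] H)
        (auto intro!: derivative_eq_intros simp flip: has_real_derivative_iff_has_vector_derivative)
    moreover have "h (l x) = capply f x" by (simp add: h_def x'_def)
    ultimately show "((\<lambda>t. capply (Abs_canalytic g) (x + t *\<^sub>R u)) has_vector_derivative capply f x) (at 0)"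
      by (simp add: g gH)
  qed
  then show ?thesis by blast
qed

section \<open>Affine reflections and integral operators\<close>

abbreviation refl :: "'v::euclidean_space dual \<Rightarrow> int \<Rightarrow> 'v isom"
  where "refl \<alpha> m \<equiv> affine_reflection (affine_fun \<alpha> m)"

abbreviation refl_integral :: "'v::euclidean_space dual \<Rightarrow> int \<Rightarrow> 'v canalytic \<Rightarrow> 'v canalytic"
  where "refl_integral \<alpha> m \<equiv> integral_op (affine_fun \<alpha> m)"

context
  fixes \<alpha> :: "'v::euclidean_space dual" and m :: int
  assumes \<alpha>: "\<alpha> \<noteq> 0"
begin

lemma iapply_reflection: "iapply (refl \<alpha> m) v = v - affine_fun \<alpha> m v *\<^sub>R coroot \<alpha>"
  by (rule iapply_affine_reflection[OF \<alpha>])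

lemma affine_fun_diff_coroot: "affine_fun \<alpha> m (v - t *\<^sub>R coroot \<alpha>) = affine_fun \<alpha> m v - 2 * t"
  using apply_coroot_self[OF \<alpha>] by (simp add: affine_fun_def blinfun.diff_right blinfun.scaleR_right)

lemma reflection_plus_self: "refl \<alpha> m + refl \<alpha> m = 0"
  by (rule isom_eqI) (simp add: iapply_reflection affine_fun_diff_coroot flip: scaleR_add_left)

lemma uminus_reflection: "- refl \<alpha> m = refl \<alpha> m"
  using reflection_plus_self by (simp add: eq_neg_iff_add_eq_0 minus_unique)

lemma linear_part_reflection: "linear_part (refl \<alpha> m) v = v - blinfun_apply \<alpha> v *\<^sub>R coroot \<alpha>"
  unfolding linear_part_def iapply_reflection by (simp add: affine_fun_def algebra_simps blinfun.zero_right)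

text \<open>The path of integration leaves \<open>v\<close> against the co-root and ends, at
  parameter \<open>a v\<close>, in the reflected point \<open>s_a v\<close>; along it the integrand
  has the antiderivative \<open>- g\<close>. The algebra of integral operators is thereby reduced to
  that of reflections.\<close>

lemma integral_op_primitive:
  assumes g: "directional_deriv (coroot \<alpha>) g = f"
  shows "refl_integral \<alpha> m f = g - canalytic_act (refl \<alpha> m) g"
proof -
  have "(LBINT t=0..ereal (affine_fun \<alpha> m v). capply f (v - t *\<^sub>R coroot \<alpha>)) = capply (g - canalytic_act (refl \<alpha> m) g) v" for v
  proof -
    have "(LBINT t=ereal 0..ereal (affine_fun \<alpha> m v). capply f (v - t *\<^sub>R coroot \<alpha>)) =
        - capply g (v - affine_fun \<alpha> m v *\<^sub>R coroot \<alpha>) - - capply g (v - 0 *\<^sub>R coroot \<alpha>)"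
    proof (rule interval_integral_FTC_finite)
      fix t
      have "((\<lambda>t. capply g (v + t *\<^sub>R (- coroot \<alpha>))) has_vector_derivative
          capply (directional_deriv (- coroot \<alpha>) g) (v + t *\<^sub>R (- coroot \<alpha>))) (at t within S)" for S
        by (rule capply_line_has_vector_derivative)
      from has_vector_derivative_minus[OF this]
      show "((\<lambda>t. - capply g (v - t *\<^sub>R coroot \<alpha>)) has_vector_derivative capply f (v - t *\<^sub>R coroot \<alpha>))
        (at t within {min 0 (affine_fun \<alpha> m v)..max 0 (affine_fun \<alpha> m v)})"
        by (simp add: directional_deriv_minus g)
    qed (intro continuous_intros)
    then show ?thesis
      by (simp add: capply_canalytic_act uminus_reflection iapply_reflection zero_ereal_def)
  qed
  then have "(\<lambda>v. LBINT t=0..ereal (affine_fun \<alpha> m v). capply f (v - t *\<^sub>R coroot \<alpha>)) = capply (g - canalytic_act (refl \<alpha> m) g)"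
    by (rule ext)
  then show ?thesis
    unfolding integral_op_def gradient_affine_fun by (simp only: capply_inverse)
qed

text \<open>Half of \<alpha> is a linear form with value 1 on the co-root.\<close>

lemma ex_coroot_primitive: "\<exists>g. directional_deriv (coroot \<alpha>) g = f"
proof (rule ex_primitive[where l = "\<lambda>v. blinfun_apply \<alpha> v / 2"])
  show "linear (\<lambda>v. blinfun_apply \<alpha> v / 2)"
    by (auto intro!: linearI simp: blinfun.add_right blinfun.scaleR_right add_divide_distrib)
qed (simp add: apply_coroot_self[OF \<alpha>])

lemma clinear_integral_op: "clinear (refl_integral \<alpha> m)"
proof -
  interpret D: Vector_Spaces.linear scaleC scaleC "directional_deriv (coroot \<alpha>)" by (rule clinear_directional_deriv)
  interpret S: Vector_Spaces.linear scaleC scaleC "canalytic_act (refl \<alpha> m)" by (rule clinear_canalytic_act)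
  show ?thesis
  proof unfold_locales
    fix f1 f2 :: "'v canalytic" and c
    obtain g1 g2 where g: "directional_deriv (coroot \<alpha>) g1 = f1" "directional_deriv (coroot \<alpha>) g2 = f2"
      using ex_coroot_primitive by blast
    have "directional_deriv (coroot \<alpha>) (g1 + g2) = f1 + f2" by (simp add: D.add g)
    then show "refl_integral \<alpha> m (f1 + f2) = refl_integral \<alpha> m f1 + refl_integral \<alpha> m f2"
      using g by (simp add: integral_op_primitive S.add)
    have "directional_deriv (coroot \<alpha>) (c *\<^sub>C g1) = c *\<^sub>C f1" by (simp add: D.scale g)
    then show "refl_integral \<alpha> m (c *\<^sub>C f1) = c *\<^sub>C refl_integral \<alpha> m f1"
      using g by (simp add: integral_op_primitive S.scale complex_vector.scale_right_diff_distrib)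
  qed
qed

text \<open>If \<open>g\<close> is a primitive of \<open>f\<close>, then its derivative along
  \<open>v\<close> is a primitive of that of \<open>f\<close>. The last term appears on writing
  \<open>v\<close> as its reflection plus \<alpha>(v) times the co-root, along which the derivative
  of \<open>g\<close> is \<open>f\<close>.\<close>

lemma integral_op_directional_deriv:
  "refl_integral \<alpha> m (directional_deriv v f) =
    directional_deriv (linear_part (refl \<alpha> m) v) (refl_integral \<alpha> m f) + complex_of_real (blinfun_apply \<alpha> v) *\<^sub>C f"
proof -
  obtain g where g: "directional_deriv (coroot \<alpha>) g = f"
    using ex_coroot_primitive by blast
  interpret D: Vector_Spaces.linear scaleC scaleC "directional_deriv (linear_part (refl \<alpha> m) v)" by (rule clinear_directional_deriv)
  have "directional_deriv (coroot \<alpha>) (directional_deriv v g) = directional_deriv v f"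
    using directional_deriv_commute g by metis
  then have "refl_integral \<alpha> m (directional_deriv v f) = directional_deriv v g - canalytic_act (refl \<alpha> m) (directional_deriv v g)"
    by (rule integral_op_primitive)
  also have "\<dots> = directional_deriv (linear_part (refl \<alpha> m) v) (g - canalytic_act (refl \<alpha> m) g)
      + complex_of_real (blinfun_apply \<alpha> v) *\<^sub>C directional_deriv (coroot \<alpha>) g"
    unfolding D.diff canalytic_act_directional_deriv
    by (simp add: linear_part_reflection directional_deriv_diff_left directional_deriv_scaleR)
  finally show ?thesis by (simp add: g integral_op_primitive[OF g])
qed

lemma canalytic_act_reflection_self: "canalytic_act (refl \<alpha> m) (canalytic_act (refl \<alpha> m) f) = f"
  by (simp flip: canalytic_act_plus add: reflection_plus_self)

text \<open>Reflecting \<open>g - s g\<close> changes its sign. This and the next two identities are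
  what \<open>S_S\<close> needs.\<close>

lemma reflection_integral_op: "canalytic_act (refl \<alpha> m) (refl_integral \<alpha> m f) = - refl_integral \<alpha> m f"
proof -
  obtain g where g: "directional_deriv (coroot \<alpha>) g = f"
    using ex_coroot_primitive by blast
  interpret S: Vector_Spaces.linear scaleC scaleC "canalytic_act (refl \<alpha> m)" by (rule clinear_canalytic_act)
  show ?thesis by (simp add: integral_op_primitive[OF g] S.diff canalytic_act_reflection_self)
qed

text \<open>The reflection reverses the co-root, so \<open>- s g\<close> is a primitive of
  \<open>s f\<close>, and it leads to the same difference \<open>g - s g\<close>.\<close>

lemma integral_op_reflection: "refl_integral \<alpha> m (canalytic_act (refl \<alpha> m) f) = refl_integral \<alpha> m f"
proof -
  obtain g where g: "directional_deriv (coroot \<alpha>) g = f"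
    using ex_coroot_primitive by blast
  interpret S: Vector_Spaces.linear scaleC scaleC "canalytic_act (refl \<alpha> m)" by (rule clinear_canalytic_act)
  interpret D: Vector_Spaces.linear scaleC scaleC "directional_deriv (coroot \<alpha>)" by (rule clinear_directional_deriv)
  have "linear_part (refl \<alpha> m) (coroot \<alpha>) = - coroot \<alpha>"
    using apply_coroot_self[OF \<alpha>] by (simp add: linear_part_reflection scaleR_2)
  then have "canalytic_act (refl \<alpha> m) f = directional_deriv (coroot \<alpha>) (- canalytic_act (refl \<alpha> m) g)"
    using canalytic_act_directional_deriv[of "refl \<alpha> m" "coroot \<alpha>" g] by (simp add: g directional_deriv_minus D.neg)
  from integral_op_primitive[OF this[symmetric]] show ?thesis
    by (simp add: integral_op_primitive[OF g] S.neg canalytic_act_reflection_self)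
qed

text \<open>The reflection negates the inner integral, yet the outer operator does not notice a
  reflection of its argument; so the result equals its own negative.\<close>

lemma integral_op_integral_op: "refl_integral \<alpha> m (refl_integral \<alpha> m f) = 0"
proof -
  interpret I: Vector_Spaces.linear scaleC scaleC "refl_integral \<alpha> m" by (rule clinear_integral_op)
  have "refl_integral \<alpha> m (refl_integral \<alpha> m f) = - refl_integral \<alpha> m (refl_integral \<alpha> m f)"
    using integral_op_reflection[of "refl_integral \<alpha> m f"] by (simp add: reflection_integral_op I.neg)
  then have "2 *\<^sub>C refl_integral \<alpha> m (refl_integral \<alpha> m f) = 0"
    using scaleC_add_left[of 1 1 "refl_integral \<alpha> m (refl_integral \<alpha> m f)"]
    by (simp add: scaleC_one eq_neg_iff_add_eq_0)
  then show ?thesis by simp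
qed

lemma capply_integral_op_zero: "affine_fun \<alpha> m x = 0 \<Longrightarrow> capply (refl_integral \<alpha> m f) x = 0"
proof -
  assume "affine_fun \<alpha> m x = 0"
  moreover obtain g where g: "directional_deriv (coroot \<alpha>) g = f"
    using ex_coroot_primitive by blast
  ultimately show ?thesis
    by (simp add: integral_op_primitive[OF g] capply_canalytic_act uminus_reflection iapply_reflection)
qed

text \<open>The linear part of \<open>w\<close> is orthogonal, so it carries the Riesz vector of one
  gradient to that of the other; co-roots and reflections follow.\<close>

lemma isom_act_affine_fun:
  assumes eq: "isom_act w (affine_fun \<alpha> m) = affine_fun \<beta> n"
  shows "coroot \<beta> = linear_part w (coroot \<alpha>)" and "\<beta> \<noteq> 0"
    and "affine_reflection (affine_fun \<beta> n) = w + refl \<alpha> m + - w"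
proof -
  have \<beta>: "blinfun_apply \<beta> (linear_part w v) = blinfun_apply \<alpha> v" for v
  proof -
    have "affine_fun \<beta> n (iapply w 0 + linear_part w v) = affine_fun \<alpha> m v"
      and "affine_fun \<beta> n (iapply w 0) = affine_fun \<alpha> m 0"
      using iapply_add[of w 0 v, symmetric] by (simp_all flip: eq add: isom_act_def)
    then show ?thesis by (simp add: affine_fun_def blinfun.add_right blinfun.zero_right)
  qed
  have ot: "linear_part w u \<bullet> linear_part w v = u \<bullet> v" for u v
    using orthogonal_linear_part[of w] by (simp add: orthogonal_transformation_def)
  have surj: "\<exists>v. u = linear_part w v" for u
    using orthogonal_transformation_surj[OF orthogonal_linear_part[of w]] by (metis surjD)
  have riesz: "riesz \<beta> = linear_part w (riesz \<alpha>)"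
  proof (rule vector_eq_ldot[THEN iffD1, rule_format])
    fix u
    obtain v where "u = linear_part w v" using surj by blast
    then show "u \<bullet> riesz \<beta> = u \<bullet> linear_part w (riesz \<alpha>)"
      by (simp add: inner_riesz \<beta> ot)
  qed
  then show co: "coroot \<beta> = linear_part w (coroot \<alpha>)"
    by (simp add: coroot_def dual_inner_def ot linear_cmul[OF linear_linear_part])
  have "riesz \<beta> \<bullet> riesz \<beta> \<noteq> 0"
    using \<alpha> by (simp add: riesz ot riesz_eq_0_iff)
  then show \<beta>0: "\<beta> \<noteq> 0"
    using riesz_eq_0_iff[of \<beta>] by auto
  show "affine_reflection (affine_fun \<beta> n) = w + refl \<alpha> m + - w"
  proof (rule isom_eqI)
    fix x
    have "affine_fun \<beta> n x = affine_fun \<alpha> m (iapply (- w) x)"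
      by (simp flip: eq add: isom_act_def)
    moreover have "iapply w (y - t *\<^sub>R v) = iapply w y - t *\<^sub>R linear_part w v" for y t v
      using iapply_add[of w y "- t *\<^sub>R v"] by (simp add: linear_cmul[OF linear_linear_part] linear_neg[OF linear_linear_part])
    ultimately show "iapply (affine_reflection (affine_fun \<beta> n)) x = iapply (w + refl \<alpha> m + - w) x"
      by (simp add: iapply_affine_reflection[OF \<beta>0] iapply_reflection co)
  qed
qed

end

lemma canalytic_act_integral_op:
  assumes \<alpha>: "\<alpha> \<noteq> 0" and eq: "isom_act w (affine_fun \<alpha> m) = affine_fun \<beta> n"
  shows "canalytic_act w (refl_integral \<alpha> m f) = integral_op (affine_fun \<beta> n) (canalytic_act w f)"
proof -
  obtain g where g: "directional_deriv (coroot \<alpha>) g = f"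
    using ex_coroot_primitive[OF \<alpha>] by blast
  interpret S: Vector_Spaces.linear scaleC scaleC "canalytic_act w" by (rule clinear_canalytic_act)
  note w = isom_act_affine_fun[OF \<alpha> eq]
  have "directional_deriv (coroot \<beta>) (canalytic_act w g) = canalytic_act w f"
    by (simp add: w(1) flip: canalytic_act_directional_deriv g)
  from integral_op_primitive[OF w(2) this] show ?thesis
    by (simp add: integral_op_primitive[OF \<alpha> g] S.diff w(3) flip: canalytic_act_plus)
qed

section \<open>The alcove and the length function\<close>

text \<open>The prescribed values extend to a linear form on the dual space, and in finite dimension
  such a form is evaluation at a vector.\<close>

lemma independent_functionals_prescribed_values:
  fixes F :: "'v::euclidean_space dual set"
  assumes "independent F"
  shows "\<exists>v. \<forall>\<beta>\<in>F. blinfun_apply \<beta> v = x \<beta>"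
proof -
  obtain g where g: "linear g" and gx: "\<And>\<beta>. \<beta> \<in> F \<Longrightarrow> g \<beta> = x \<beta>"
    using linear_independent_extend[OF assms, of x] by blast
  define v where "v = (\<Sum>b\<in>Basis. g (blinfun_inner_right b) *\<^sub>R b)"
  have "blinfun_apply \<beta> v = g \<beta>" for \<beta>
  proof -
    have "\<beta> = (\<Sum>b\<in>Basis. blinfun_apply \<beta> b *\<^sub>R blinfun_inner_right b)"
    proof (rule blinfun_eqI)
      fix y
      have "blinfun_apply \<beta> y = blinfun_apply \<beta> (\<Sum>b\<in>Basis. (y \<bullet> b) *\<^sub>R b)"
        by (simp add: euclidean_representation)
      then show "blinfun_apply \<beta> y = blinfun_apply (\<Sum>b\<in>Basis. blinfun_apply \<beta> b *\<^sub>R blinfun_inner_right b) y"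
        by (simp add: blinfun.sum_left blinfun.sum_right blinfun.scaleR_left blinfun.scaleR_right
            blinfun_inner_right.rep_eq inner_commute mult.commute)
    qed
    then have "g \<beta> = g (\<Sum>b\<in>Basis. blinfun_apply \<beta> b *\<^sub>R blinfun_inner_right b)"
      by simp
    then have "g \<beta> = (\<Sum>b\<in>Basis. blinfun_apply \<beta> b * g (blinfun_inner_right b))"
      by (simp add: linear_sum[OF g] linear_cmul[OF g])
    then show ?thesis
      by (simp add: v_def blinfun.sum_right blinfun.scaleR_right mult.commute)
  qed
  then show ?thesis using gx by (intro exI[of _ v]) simp
qed

lemma isom_act_plus: "isom_act (g + h) a = isom_act g (isom_act h a)"
  by (simp only: isom_act_def minus_add iapply_plus)

lemma isom_act_zero [simp]: "isom_act 0 a = a"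
  by (simp add: isom_act_def)

lemma isom_act_apply [simp]: "isom_act g a (iapply g v) = a v" "isom_act (- g) a v = a (iapply g v)"
  by (simp_all add: isom_act_def)

section \<open>The extended affine Weyl group and its action on affine roots\<close>

locale affine_root_datum =
  fixes R X F :: "'v::euclidean_space dual set" and \<theta> :: "'v dual"
  assumes data: "affine_root_data R X F \<theta>"
begin

abbreviation W where "W \<equiv> ext_affine_weyl_group R X"
abbreviation \<Phi> where "\<Phi> \<equiv> affine_roots R"
abbreviation \<Delta> where "\<Delta> \<equiv> simple_affine_roots F \<theta>"

lemma finite_R: "finite R" and zero_notin_R: "0 \<notin> R"
  and reflection_in_R: "\<alpha> \<in> R \<Longrightarrow> \<beta> \<in> R \<Longrightarrow> \<beta> - blinfun_apply \<beta> (coroot \<alpha>) *\<^sub>R \<alpha> \<in> R"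
  and reduced: "\<alpha> \<in> R \<Longrightarrow> c *\<^sub>R \<alpha> \<in> R \<Longrightarrow> c = 1 \<or> c = - 1"
  and R_subset_X: "int_span R \<subseteq> X" and coroots_subset: "int_span (coroot ` R) \<subseteq> dual_lattice X"
  and F_subset: "F \<subseteq> R" and indep_F: "independent F"
  and pos_or_neg: "\<alpha> \<in> R \<Longrightarrow> \<alpha> \<in> nonneg_comb F \<or> - \<alpha> \<in> nonneg_comb F"
  and \<theta>_in_R: "\<theta> \<in> R" and highest: "\<beta> \<in> R \<Longrightarrow> \<theta> - \<beta> \<in> nonneg_comb F"
  using data unfolding affine_root_data_def reduced_root_system_def is_root_basis_def is_highest_root_def
  by auto

lemma finite_F: "finite F"
  using F_subset finite_R finite_subset by blast

lemma finite_\<Delta>: "finite \<Delta>"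
  by (simp add: simple_affine_roots_def finite_F)

lemma root_nonzero: "\<alpha> \<in> R \<Longrightarrow> \<alpha> \<noteq> 0"
  using zero_notin_R by blast

lemma reflection0_apply: "\<alpha> \<in> R \<Longrightarrow>
    iapply (affine_reflection (affine_fun \<alpha> 0)) v = v - blinfun_apply \<alpha> v *\<^sub>R coroot \<alpha>"
  by (simp only: iapply_affine_reflection root_nonzero not_False_eq_True) (simp add: affine_fun_def)

lemma uminus_in_R: "\<alpha> \<in> R \<Longrightarrow> - \<alpha> \<in> R"
  using reflection_in_R[of \<alpha> \<alpha>] by (simp add: apply_coroot_self root_nonzero scaleR_2)

lemma root_integral: "\<alpha> \<in> R \<Longrightarrow> y \<in> dual_lattice X \<Longrightarrow> blinfun_apply \<alpha> y \<in> \<int>"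
proof -
  assume "\<alpha> \<in> R" and y: "y \<in> dual_lattice X"
  then have "\<alpha> \<in> int_span R"
    unfolding int_span_def by (auto intro!: exI[of _ "{\<alpha>}"] exI[of _ "\<lambda>_. 1"])
  then show ?thesis using R_subset_X y by (auto simp: dual_lattice_def)
qed

lemma coroot_in_dual_lattice: "\<alpha> \<in> R \<Longrightarrow> coroot \<alpha> \<in> dual_lattice X"
proof -
  assume "\<alpha> \<in> R"
  then have "coroot \<alpha> \<in> int_span (coroot ` R)"
    unfolding int_span_def by (auto intro!: exI[of _ "{coroot \<alpha>}"] exI[of _ "\<lambda>_. 1"])
  then show ?thesis using coroots_subset by blast
qed

lemma dual_lattice_closed:
  "y \<in> dual_lattice X \<Longrightarrow> z \<in> dual_lattice X \<Longrightarrow> y + z \<in> dual_lattice X"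
  "y \<in> dual_lattice X \<Longrightarrow> c \<in> \<int> \<Longrightarrow> c *\<^sub>R y \<in> dual_lattice X"
  "y \<in> dual_lattice X \<Longrightarrow> - y \<in> dual_lattice X" "0 \<in> dual_lattice X"
  by (auto simp: dual_lattice_def blinfun.add_right blinfun.scaleR_right blinfun.minus_right)

lemma reflection_dual_lattice:
  assumes "\<alpha> \<in> R" and "y \<in> dual_lattice X"
  shows "iapply (affine_reflection (affine_fun \<alpha> 0)) y \<in> dual_lattice X"
proof -
  have "y + - (blinfun_apply \<alpha> y *\<^sub>R coroot \<alpha>) \<in> dual_lattice X"
    using assms by (intro dual_lattice_closed root_integral coroot_in_dual_lattice)
  then show ?thesis
    using assms(1) by (simp add: reflection0_apply)
qed

lemma translation_reflection:
  assumes "\<alpha> \<in> R"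
  shows "translation y + affine_reflection (affine_fun \<alpha> 0) =
    affine_reflection (affine_fun \<alpha> 0) + translation (iapply (affine_reflection (affine_fun \<alpha> 0)) y)"
  using apply_coroot_self[OF root_nonzero[OF assms]]
  by (intro isom_eqI) (simp add: translation.rep_eq reflection0_apply[OF assms]
      blinfun.add_right blinfun.diff_right blinfun.scaleR_right algebra_simps)

text \<open>Moving a translation across \<open>w\<close> keeps it in the lattice; this restores the
  normal form \<open>w + translation z\<close> of products.\<close>

lemma translation_weyl:
  assumes "w \<in> weyl_group R" and "y \<in> dual_lattice X"
  shows "\<exists>z\<in>dual_lattice X. translation y + w = w + translation z"
  using assms
proof (induction arbitrary: y)
  case 1
  then show ?case by auto
next
  case (2 \<alpha> w)
  let ?s = "affine_reflection (affine_fun \<alpha> 0)"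
  obtain z where z: "z \<in> dual_lattice X" "translation (iapply ?s y) + w = w + translation z"
    using 2 reflection_dual_lattice by blast
  have "translation y + (?s + w) = ?s + (translation (iapply ?s y) + w)"
    using translation_reflection[OF 2(1)] by (simp add: add.assoc[symmetric])
  also have "\<dots> = ?s + w + translation z" by (simp add: z add.assoc)
  finally show ?case using z(1) by blast
qed

lemma translation_plus: "translation y + translation z = translation (y + z)"
  by (rule isom_eqI) (simp add: translation.rep_eq add_ac)

lemma W_I: "w \<in> weyl_group R \<Longrightarrow> y \<in> dual_lattice X \<Longrightarrow> w + translation y \<in> W"
  by (auto simp: ext_affine_weyl_group_def)

lemma W_E:
  assumes "g \<in> W"
  obtains w y where "g = w + translation y" "w \<in> weyl_group R" "y \<in> dual_lattice X"
  using assms by (auto simp: ext_affine_weyl_group_def)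

lemma translation_0: "translation 0 = 0"
  by (rule isom_eqI) (simp add: translation.rep_eq)

lemma W_0: "0 \<in> W"
  using W_I[OF weyl_group.intros(1) dual_lattice_closed(4)] by (simp add: translation_0)

lemma W_reflection_plus:
  assumes "\<alpha> \<in> R" and "g \<in> W"
  shows "affine_reflection (affine_fun \<alpha> 0) + g \<in> W"
proof -
  obtain w y where g: "g = w + translation y" "w \<in> weyl_group R" "y \<in> dual_lattice X"
    using assms(2) by (rule W_E)
  then show ?thesis
    using W_I[OF weyl_group.intros(2)[OF assms(1) g(2)] g(3)] by (simp add: add.assoc)
qed

lemma W_translation_plus: "y \<in> dual_lattice X \<Longrightarrow> g \<in> W \<Longrightarrow> translation y + g \<in> W"
proof -
  assume y: "y \<in> dual_lattice X" and "g \<in> W"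
  then obtain w z where g: "g = w + translation z" "w \<in> weyl_group R" "z \<in> dual_lattice X"
    by (auto simp: ext_affine_weyl_group_def)
  obtain z' where "z' \<in> dual_lattice X" "translation y + w = w + translation z'"
    using translation_weyl[OF g(2) y] by blast
  then show ?thesis using g W_I dual_lattice_closed(1)
    by (metis add.assoc translation_plus)
qed

lemma weyl_plus_W: "w \<in> weyl_group R \<Longrightarrow> g \<in> W \<Longrightarrow> w + g \<in> W"
  by (induction rule: weyl_group.induct) (auto simp: add.assoc intro: W_reflection_plus)

lemma W_plus:
  assumes "g \<in> W" and "h \<in> W"
  shows "g + h \<in> W"
proof -
  obtain w y where g: "g = w + translation y" "w \<in> weyl_group R" "y \<in> dual_lattice X"
    using assms(1) by (rule W_E)
  have "w + (translation y + h) \<in> W"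
    using g assms(2) by (intro weyl_plus_W W_translation_plus)
  then show ?thesis by (simp add: g(1) add.assoc)
qed

lemma W_reflection0: "\<alpha> \<in> R \<Longrightarrow> affine_reflection (affine_fun \<alpha> 0) \<in> W"
  using W_reflection_plus[OF _ W_0] by simp

lemma W_translation: "y \<in> dual_lattice X \<Longrightarrow> translation y \<in> W"
  using W_translation_plus[OF _ W_0] by simp

lemma uminus_weyl: "w \<in> weyl_group R \<Longrightarrow> - w \<in> W"
proof (induction rule: weyl_group.induct)
  case 1
  then show ?case by (simp add: W_0)
next
  case (2 \<alpha> w)
  then have "- w + affine_reflection (affine_fun \<alpha> 0) \<in> W"
    by (intro W_plus W_reflection0)
  then show ?case
    unfolding minus_add by (simp add: uminus_reflection root_nonzero[OF 2(1)])
qed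

lemma W_uminus: "g \<in> W \<Longrightarrow> - g \<in> W"
proof -
  assume "g \<in> W"
  then obtain w z where g: "g = w + translation z" "w \<in> weyl_group R" "z \<in> dual_lattice X"
    by (auto simp: ext_affine_weyl_group_def)
  have "translation z + translation (- z) = 0"
    by (simp add: translation_plus translation_0)
  then have "- translation z = translation (- z)" by (simp add: minus_unique)
  then have "- g = translation (- z) + - w" unfolding g(1) minus_add by simp
  then show ?thesis using g by (simp only: W_plus W_translation dual_lattice_closed uminus_weyl)
qed

lemma affine_fun_in_\<Phi>: "\<alpha> \<in> R \<Longrightarrow> affine_fun \<alpha> m \<in> \<Phi>"
  by (auto simp: affine_roots_def)

lemma \<Phi>_cases:
  assumes "c \<in> \<Phi>"
  obtains \<alpha> m where "c = affine_fun \<alpha> m" "\<alpha> \<in> R" "\<alpha> \<noteq> 0"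
  using assms root_nonzero by (auto simp: affine_roots_def)

lemma uminus_in_\<Phi>: "c \<in> \<Phi> \<Longrightarrow> (\<lambda>v. - c v) \<in> \<Phi>"
proof -
  assume "c \<in> \<Phi>"
  then obtain \<alpha> m where "c = affine_fun \<alpha> m" "\<alpha> \<in> R" by (rule \<Phi>_cases)
  then have "(\<lambda>v. - c v) = affine_fun (- \<alpha>) (- m)" "- \<alpha> \<in> R"
    by (auto simp: affine_fun_def blinfun.minus_left uminus_in_R)
  then show ?thesis by (simp add: affine_fun_in_\<Phi>)
qed

text \<open>The constant \<open>m\<close> is absorbed by first translating by \<open>m\<close> times
  the co-root, a vector of the dual lattice.\<close>

lemma W_reflection:
  assumes "c \<in> \<Phi>"
  shows "affine_reflection c \<in> W"
proof -
  obtain \<alpha> m where c: "c = affine_fun \<alpha> m" "\<alpha> \<in> R" "\<alpha> \<noteq> 0" using assms by (rule \<Phi>_cases)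
  have "affine_reflection c = affine_reflection (affine_fun \<alpha> 0) + translation (of_int m *\<^sub>R coroot \<alpha>)"
  proof (rule isom_eqI)
    fix v
    have 2: "(of_int m * 2) *\<^sub>R coroot \<alpha> = of_int m *\<^sub>R coroot \<alpha> + of_int m *\<^sub>R coroot \<alpha>"
      by (simp flip: scaleR_add_left)
    show "iapply (affine_reflection c) v =
        iapply (affine_reflection (affine_fun \<alpha> 0) + translation (of_int m *\<^sub>R coroot \<alpha>)) v"
      unfolding c(1) iapply_plus iapply_affine_reflection[OF c(3)] translation.rep_eq
      by (simp add: affine_fun_def blinfun.add_right blinfun.scaleR_right apply_coroot_self[OF c(3)]
          algebra_simps 2)
  qed
  then show ?thesis
    using c by (simp only:) (intro W_plus W_reflection0 W_translation dual_lattice_closed coroot_in_dual_lattice Ints_of_int)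
qed

lemma isom_act_reflection_root:
  assumes "c \<in> \<Phi>" "\<alpha> \<in> R"
  shows "isom_act (affine_reflection (affine_fun \<alpha> 0)) c \<in> \<Phi>"
proof -
  obtain \<beta> m where c: "c = affine_fun \<beta> m" "\<beta> \<in> R" using assms by (blast elim: \<Phi>_cases)
  have "isom_act (affine_reflection (affine_fun \<alpha> 0)) c = affine_fun (\<beta> - blinfun_apply \<beta> (coroot \<alpha>) *\<^sub>R \<alpha>) m"
    using root_nonzero[OF assms(2)]
    by (simp add: fun_eq_iff isom_act_def uminus_reflection reflection0_apply[OF assms(2)] c(1))
      (simp add: affine_fun_def blinfun.diff_right blinfun.scaleR_right blinfun.diff_left blinfun.scaleR_left)
  then show ?thesis using reflection_in_R assms(2) c(2) by (simp add: affine_fun_in_\<Phi>)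
qed

lemma isom_act_translation_root:
  assumes "c \<in> \<Phi>" "y \<in> dual_lattice X"
  shows "isom_act (translation y) c \<in> \<Phi>"
proof -
  obtain \<beta> m where c: "c = affine_fun \<beta> m" "\<beta> \<in> R" using assms by (blast elim: \<Phi>_cases)
  obtain j where j: "blinfun_apply \<beta> y = of_int j"
    using root_integral[OF c(2) assms(2)] by (auto elim: Ints_cases)
  have "iapply (- translation y) v = v - y" for v
    using iapply_cancel(1)[of "translation y" "v - y"] by (simp add: translation.rep_eq)
  then have "isom_act (translation y) c = affine_fun \<beta> (m - j)"
    by (simp add: fun_eq_iff isom_act_def c(1) affine_fun_def blinfun.diff_right j)
  then show ?thesis using c(2) by (simp add: affine_fun_in_\<Phi>)
qed

lemma isom_act_root:
  assumes "g \<in> W" and "c \<in> \<Phi>"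
  shows "isom_act g c \<in> \<Phi>"
proof -
  have weyl: "isom_act w d \<in> \<Phi>" if "w \<in> weyl_group R" "d \<in> \<Phi>" for w d
    using that by (induction arbitrary: d) (auto simp: isom_act_plus intro: isom_act_reflection_root)
  obtain w y where g: "g = w + translation y" "w \<in> weyl_group R" "y \<in> dual_lattice X"
    using assms(1) by (rule W_E)
  then show ?thesis
    using assms(2) by (simp only: isom_act_plus weyl isom_act_translation_root)
qed

lemma root_compose:
  assumes "g \<in> W" and "c \<in> \<Phi>"
  shows "(\<lambda>v. c (iapply g v)) \<in> \<Phi>"
  using isom_act_root[OF W_uminus[OF assms(1)] assms(2)] by (simp add: isom_act_def)

lemma root_reflection_self: "c \<in> \<Phi> \<Longrightarrow> c (iapply (affine_reflection c) v) = - c v"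
proof -
  assume "c \<in> \<Phi>"
  then obtain \<alpha> m where c: "c = affine_fun \<alpha> m" "\<alpha> \<in> R" "\<alpha> \<noteq> 0" by (rule \<Phi>_cases)
  show ?thesis unfolding c(1) iapply_reflection[OF c(3)] affine_fun_diff_coroot[OF c(3)] by simp
qed

lemma root_reflection: "c \<in> \<Phi> \<Longrightarrow> d \<in> \<Phi> \<Longrightarrow> \<exists>k. \<forall>v. d (iapply (affine_reflection c) v) = d v - k * c v"
proof -
  assume "c \<in> \<Phi>" "d \<in> \<Phi>"
  then obtain \<alpha> m \<beta> n where c: "c = affine_fun \<alpha> m" "\<alpha> \<noteq> 0" and d: "d = affine_fun \<beta> n"
    by (metis \<Phi>_cases)
  show ?thesis
    by (rule exI[of _ "blinfun_apply \<beta> (coroot \<alpha>)"])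
      (simp add: c(1) iapply_reflection[OF c(2)] d, simp add: affine_fun_def blinfun.diff_right blinfun.scaleR_right)
qed

lemma reflection_self_inverse:
  assumes "c \<in> \<Phi>"
  shows "affine_reflection c + affine_reflection c = 0" and "- affine_reflection c = affine_reflection c"
    and "affine_reflection c + (affine_reflection c + g) = g"
    and "iapply (affine_reflection c) (iapply (affine_reflection c) v) = v"
proof -
  obtain \<alpha> m where c: "c = affine_fun \<alpha> m" "\<alpha> \<in> R" "\<alpha> \<noteq> 0" using assms by (rule \<Phi>_cases)
  show 1: "affine_reflection c + affine_reflection c = 0" and "- affine_reflection c = affine_reflection c"
    using c by (simp_all add: reflection_plus_self uminus_reflection)
  then show "affine_reflection c + (affine_reflection c + g) = g"
    by (simp flip: add.assoc)
  show "iapply (affine_reflection c) (iapply (affine_reflection c) v) = v"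
    using 1 by (metis iapply_plus iapply_zero)
qed

section \<open>Positive affine roots as combinations of simple ones\<close>

lemma \<Delta>_subset_\<Phi>: "\<Delta> \<subseteq> \<Phi>"
  using F_subset \<theta>_in_R uminus_in_R by (auto simp: simple_affine_roots_def intro!: affine_fun_in_\<Phi>)

lemma nonneg_comb_apply:
  assumes "\<xi> \<in> nonneg_comb F"
  shows "\<exists>n :: 'v dual \<Rightarrow> nat. \<xi> = (\<Sum>\<beta>\<in>F. real (n \<beta>) *\<^sub>R \<beta>) \<and>
    (\<forall>v. blinfun_apply \<xi> v = (\<Sum>\<beta>\<in>F. real (n \<beta>) * blinfun_apply \<beta> v))"
  using assms by (auto simp: nonneg_comb_def blinfun.sum_left blinfun.scaleR_left)

lemma sum_\<Delta>: "(\<Sum>a\<in>\<Delta>. f a) = f (affine_fun (- \<theta>) 1) + (\<Sum>\<beta>\<in>F. f (affine_fun \<beta> 0))"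
proof -
  have "affine_fun (- \<theta>) 1 0 \<noteq> affine_fun \<beta> 0 0" for \<beta> :: "'v dual"
    by (simp add: affine_fun_def blinfun.zero_right)
  then have "affine_fun (- \<theta>) 1 \<notin> (\<lambda>\<beta>. affine_fun \<beta> 0) ` F" by force
  moreover have "inj_on (\<lambda>\<beta>. affine_fun \<beta> 0) F"
    by (rule inj_onI) (metis gradient_affine_fun)
  ultimately show ?thesis
    unfolding simple_affine_roots_def using finite_F by (simp add: sum.reindex)
qed

lemma pos_subset_\<Phi>: "pos_affine_roots R F \<subseteq> \<Phi>"
  by (auto simp: pos_affine_roots_def affine_roots_def pos_roots_def)

lemma root_nonconstant: "c \<in> \<Phi> \<Longrightarrow> \<exists>v. c v \<noteq> 0"
proof -
  assume "c \<in> \<Phi>"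
  then obtain \<alpha> m where c: "c = affine_fun \<alpha> m" "\<alpha> \<in> R" "\<alpha> \<noteq> 0" by (rule \<Phi>_cases)
  have "affine_fun \<alpha> m (coroot \<alpha>) - affine_fun \<alpha> m 0 = 2"
    using apply_coroot_self[OF c(3)] by (simp add: affine_fun_def blinfun.zero_right)
  then show ?thesis unfolding c(1) by (metis diff_zero zero_neq_numeral)
qed

lemma a0_apply [simp]: "affine_fun (- \<theta>) 1 v = 1 - blinfun_apply \<theta> v"
  and affine_fun_0_apply [simp]: "affine_fun \<beta> 0 v = blinfun_apply \<beta> v"
  by (simp_all add: affine_fun_def blinfun.minus_left)

text \<open>Real coefficients suffice, as only signs of values are used later. For m > 0, \<alpha> +
  m is m (1 - \<theta>) + (m - 1) \<theta> + (\<theta> + \<alpha>), and by \<open>highest\<close>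
  both 2 \<theta> and \<theta> + \<alpha> are nonnegative combinations of \<open>F\<close>.\<close>

lemma pos_root_comb:
  assumes "c \<in> pos_affine_roots R F"
  shows "\<exists>n. (\<forall>a\<in>\<Delta>. n a \<ge> 0) \<and> (\<forall>v. c v = (\<Sum>a\<in>\<Delta>. n a * a v)) \<and> (\<exists>b\<in>\<Delta>. n b > 0)"
proof -
  have key: ?thesis if n0: "n0 \<ge> 0" and n: "\<And>\<beta>. n \<beta> \<ge> 0"
    and c: "\<And>v. c v = n0 * (1 - blinfun_apply \<theta> v) + (\<Sum>\<beta>\<in>F. n \<beta> * blinfun_apply \<beta> v)" for n0 n
  proof -
    \<comment> \<open>The value at 0 is 1 for 1 - \<theta> and 0 for the simple roots in
      \<open>F\<close>, so the two cases do not clash.\<close>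
    let ?n = "\<lambda>a. if a = affine_fun (- \<theta>) 1 then n0 else n (gradient a)"
    have n_nonneg: "?n a \<ge> 0" for a using n0 n by simp
    have "affine_fun (- \<theta>) 1 0 \<noteq> affine_fun \<beta> 0 0" for \<beta> :: "'v dual"
      by (simp add: affine_fun_def blinfun.zero_right)
    then have ne: "affine_fun \<beta> 0 \<noteq> affine_fun (- \<theta>) 1" for \<beta> by metis
    have cv: "c v = (\<Sum>a\<in>\<Delta>. ?n a * a v)" for v
      unfolding c sum_\<Delta> using ne by simp
    obtain v where "c v \<noteq> 0" using root_nonconstant assms pos_subset_\<Phi> by blast
    have "\<exists>b\<in>\<Delta>. ?n b \<noteq> 0"
    proof (rule ccontr)
      assume "\<not> (\<exists>b\<in>\<Delta>. ?n b \<noteq> 0)"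
      then have "c v = 0" unfolding cv by (intro sum.neutral) auto
      with \<open>c v \<noteq> 0\<close> show False by simp
    qed
    then obtain b where b: "b \<in> \<Delta>" "?n b \<noteq> 0" by blast
    then have "?n b > 0" using n_nonneg[of b] by linarith
    with n_nonneg cv b(1) show ?thesis by (intro exI[of _ ?n]) blast
  qed
  from assms consider \<alpha> m where "c = affine_fun \<alpha> m" "\<alpha> \<in> R" "m > 0"
    | \<alpha> where "c = affine_fun \<alpha> 0" "\<alpha> \<in> pos_roots R F"
    unfolding pos_affine_roots_def by blast
  then show ?thesis
  proof cases
    case 1
    obtain k where k: "\<forall>v. blinfun_apply (\<theta> - - \<theta>) v = (\<Sum>\<beta>\<in>F. real (k \<beta>) * blinfun_apply \<beta> v)"
      using nonneg_comb_apply[OF highest[OF uminus_in_R[OF \<theta>_in_R]]] by blast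
    note k = k[rule_format]
    obtain j where j: "\<forall>v. blinfun_apply (\<theta> - - \<alpha>) v = (\<Sum>\<beta>\<in>F. real (j \<beta>) * blinfun_apply \<beta> v)"
      using nonneg_comb_apply[OF highest[OF uminus_in_R[OF 1(2)]]] by blast
    note j = j[rule_format]
    \<comment> \<open>The halves arise because \<open>highest\<close> yields 2 \<theta>, as \<theta>
      - (- \<theta>), rather than \<theta> itself.\<close>
    show ?thesis
    proof (rule key[of "of_int m" "\<lambda>\<beta>. of_int (m - 1) / 2 * k \<beta> + j \<beta>"])
      fix v
      have "(\<Sum>\<beta>\<in>F. (of_int (m - 1) / 2 * real (k \<beta>) + real (j \<beta>)) * blinfun_apply \<beta> v)
          = of_int (m - 1) / 2 * blinfun_apply (\<theta> - - \<theta>) v + blinfun_apply (\<theta> - - \<alpha>) v"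
        unfolding k j by (simp add: sum.distrib sum_distrib_left distrib_right mult.assoc)
      also have "\<dots> = of_int (m - 1) * blinfun_apply \<theta> v + blinfun_apply \<theta> v + blinfun_apply \<alpha> v"
        by (simp add: blinfun.add_left)
      finally show "c v = of_int m * (1 - blinfun_apply \<theta> v)
          + (\<Sum>\<beta>\<in>F. (of_int (m - 1) / 2 * real (k \<beta>) + real (j \<beta>)) * blinfun_apply \<beta> v)"
        by (simp add: 1(1) affine_fun_def algebra_simps)
    qed (use 1 in auto)
  next
    case 2
    then have "\<alpha> \<in> nonneg_comb F" by (simp add: pos_roots_def)
    from nonneg_comb_apply[OF this]
    obtain n where n: "\<forall>v. blinfun_apply \<alpha> v = (\<Sum>\<beta>\<in>F. real (n \<beta>) * blinfun_apply \<beta> v)"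
      by blast
    show ?thesis by (rule key[of 0 "\<lambda>\<beta>. real (n \<beta>)"]) (auto simp: 2(1) affine_fun_def n)
  qed
qed

lemma pos_or_neg_affine:
  assumes "c \<in> \<Phi>"
  shows "c \<in> pos_affine_roots R F \<or> (\<lambda>v. - c v) \<in> pos_affine_roots R F"
proof -
  obtain \<alpha> m where c: "c = affine_fun \<alpha> m" "\<alpha> \<in> R" using assms by (blast elim: \<Phi>_cases)
  have neg: "(\<lambda>v. - c v) = affine_fun (- \<alpha>) (- m)"
    by (simp add: c(1) affine_fun_def blinfun.minus_left)
  consider "m > 0" | "m < 0" | "m = 0" by linarith
  then show ?thesis
  proof cases
    case 2
    then have "- m > 0" by simp
    then show ?thesis unfolding neg using uminus_in_R[OF c(2)] unfolding pos_affine_roots_def by blast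
  next
    case 3
    then show ?thesis
      unfolding neg using c pos_or_neg[OF c(2)] uminus_in_R[OF c(2)]
      by (auto simp: pos_affine_roots_def pos_roots_def)
  qed (use c in \<open>auto simp: pos_affine_roots_def\<close>)
qed

text \<open>A positive root vanishing at a point \<open>x\<close> of the closed alcove is a combination of those simple
  roots that vanish at \<open>x\<close>.\<close>

lemma pos_root_face:
  assumes c: "c \<in> pos_affine_roots R F" and x: "\<forall>a\<in>\<Delta>. a x \<ge> 0" and "c x = 0"
    and z: "\<forall>a\<in>\<Delta>. a x = 0 \<longrightarrow> a z > 0"
  shows "c z > 0"
proof -
  note x = x[rule_format] and z = z[rule_format]
  obtain n b where n: "\<forall>a\<in>\<Delta>. n a \<ge> 0" and cv: "\<forall>v. c v = (\<Sum>a\<in>\<Delta>. n a * a v)"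
    and b: "b \<in> \<Delta>" "n b > 0"
    using pos_root_comb[OF c] by blast
  note n = n[rule_format] and cv = cv[rule_format]
  have n0: "n a * a x = 0" if "a \<in> \<Delta>" for a
    using \<open>c x = 0\<close> sum_nonneg_eq_0_iff[OF finite_\<Delta>, of "\<lambda>a. n a * a x"] n x that by (simp add: cv)
  have ge: "n a * a z \<ge> 0" if "a \<in> \<Delta>" for a
    using n0[OF that] n[OF that] z[OF that] by (cases "a x = 0") auto
  have "n b * b z > 0"
    using n0[of b] b z[of b] by simp
  then show ?thesis
    unfolding cv by (intro sum_pos2[OF finite_\<Delta> b(1)] ge)
qed

lemma pos_root_nonneg:
  assumes "c \<in> pos_affine_roots R F" and "\<forall>a\<in>\<Delta>. a x \<ge> 0"
  shows "c x \<ge> 0"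
proof -
  obtain n where n: "\<forall>a\<in>\<Delta>. n a \<ge> 0" and cv: "\<forall>v. c v = (\<Sum>a\<in>\<Delta>. n a * a v)"
    using pos_root_comb[OF assms(1)] by blast
  note n = n[rule_format] and cv = cv[rule_format]
  show ?thesis unfolding cv using n assms(2) by (auto intro: sum_nonneg)
qed

lemma pos_root_pos:
  assumes "c \<in> pos_affine_roots R F" and z: "\<forall>a\<in>\<Delta>. a z > 0"
  shows "c z > 0"
proof -
  obtain n b where n: "\<forall>a\<in>\<Delta>. n a \<ge> 0" and cv: "\<forall>v. c v = (\<Sum>a\<in>\<Delta>. n a * a v)"
    and b: "b \<in> \<Delta>" "n b > 0"
    using pos_root_comb[OF assms(1)] by blast
  note n = n[rule_format] and cv = cv[rule_format]
  show ?thesis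
    unfolding cv using n b z by (intro sum_pos2[OF finite_\<Delta> b(1)]) (auto intro!: mult_nonneg_nonneg simp: less_imp_le)
qed

text \<open>Rescaling such \<open>v\<close> gives points of the closed alcove. The last clause
  controls when rescaling fails: if \<theta> vanishes at \<open>v\<close> and only \<beta>0 may have
  the value 0, then 2 \<theta> is a multiple of \<beta>0, and reducedness leaves \<theta> =
  \<beta>0.\<close>

lemma ex_dual_point:
  assumes f: "\<forall>\<beta>\<in>F. f \<beta> \<ge> 0"
  shows "\<exists>v. (\<forall>\<beta>\<in>F. blinfun_apply \<beta> v = f \<beta>) \<and> blinfun_apply \<theta> v \<ge> 0 \<and>
    (\<forall>\<beta>0\<in>F. blinfun_apply \<theta> v = 0 \<longrightarrow> (\<forall>\<beta>\<in>F. \<beta> \<noteq> \<beta>0 \<longrightarrow> f \<beta> > 0) \<longrightarrow> \<theta> = \<beta>0)"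
proof -
  obtain v where v: "\<And>\<beta>. \<beta> \<in> F \<Longrightarrow> blinfun_apply \<beta> v = f \<beta>"
    using independent_functionals_prescribed_values[OF indep_F] by metis
  obtain n where n: "\<theta> - - \<theta> = (\<Sum>\<beta>\<in>F. real (n \<beta>) *\<^sub>R \<beta>)"
    "\<forall>v. blinfun_apply (\<theta> - - \<theta>) v = (\<Sum>\<beta>\<in>F. real (n \<beta>) * blinfun_apply \<beta> v)"
    using nonneg_comb_apply[OF highest[OF uminus_in_R[OF \<theta>_in_R]]] by blast
  note n = n[rule_format]
  have sum: "2 * blinfun_apply \<theta> v = (\<Sum>\<beta>\<in>F. real (n \<beta>) * f \<beta>)"
    using n(2)[of v] v by (simp add: blinfun.add_left)
  show ?thesis
  proof (rule exI[of _ v], intro conjI ballI impI)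
    show "blinfun_apply \<theta> v \<ge> 0"
      using sum f sum_nonneg[of F "\<lambda>\<beta>. real (n \<beta>) * f \<beta>"] by simp
    fix \<beta>0
    assume 0: "blinfun_apply \<theta> v = 0" and \<beta>0: "\<beta>0 \<in> F" and pos: "\<forall>\<beta>\<in>F. \<beta> \<noteq> \<beta>0 \<longrightarrow> f \<beta> > 0"
    have "real (n \<beta>) * f \<beta> = 0" if "\<beta> \<in> F" for \<beta>
      using sum 0 sum_nonneg_eq_0_iff[OF finite_F, of "\<lambda>\<beta>. real (n \<beta>) * f \<beta>"] f that by simp
    then have "n \<beta> = 0" if "\<beta> \<in> F" "\<beta> \<noteq> \<beta>0" for \<beta>
      using pos that by fastforce
    then have "(\<Sum>\<beta>\<in>F. real (n \<beta>) *\<^sub>R \<beta>) = (\<Sum>\<beta>\<in>{\<beta>0}. real (n \<beta>) *\<^sub>R \<beta>)"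
      using \<beta>0 by (intro sum.mono_neutral_right finite_F) auto
    then have "2 *\<^sub>R \<theta> = real (n \<beta>0) *\<^sub>R \<beta>0" using n(1) by (simp add: scaleR_2)
    then have \<theta>: "\<theta> = (real (n \<beta>0) / 2) *\<^sub>R \<beta>0"
      by (metis (no_types, lifting) divide_inverse_commute inverse_eq_divide mult.commute
          scaleR_half_double scaleR_scaleR scaleR_2)
    then have "real (n \<beta>0) / 2 = 1 \<or> real (n \<beta>0) / 2 = - 1"
      using reduced[of \<beta>0 "real (n \<beta>0) / 2"] \<beta>0 F_subset \<theta>_in_R by (metis subsetD)
    then show "\<theta> = \<beta>0" using \<theta> by auto
  qed (rule v)
qed

section \<open>Points of the closed alcove and signs of roots\<close>

lemma \<Delta>_cases:
  assumes "a \<in> \<Delta>"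
  obtains "a = affine_fun (- \<theta>) 1" | \<beta> where "\<beta> \<in> F" "a = affine_fun \<beta> 0"
  using assms by (auto simp: simple_affine_roots_def)

lemma ex_alcove_point: "\<exists>v. \<forall>a\<in>\<Delta>. a v > 0"
proof -
  obtain v where v: "\<forall>\<beta>\<in>F. blinfun_apply \<beta> v = 1" "blinfun_apply \<theta> v \<ge> 0"
    using ex_dual_point[of "\<lambda>_. 1"] by auto
  \<comment> \<open>The scaling brings \<theta> below 1, which makes 1 - \<theta> positive and keeps
    the roots in \<open>F\<close> positive.\<close>
  let ?t = "1 / (1 + blinfun_apply \<theta> v)"
  have "a (?t *\<^sub>R v) > 0" if "a \<in> \<Delta>" for a
    using that v by (cases rule: \<Delta>_cases) (auto simp: blinfun.scaleR_right)
  then show ?thesis by blast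
qed

text \<open>Positivity of an affine root is the sign of its value at this point
  (\<open>pos_iff\<close>). Inversions and descents then become sign conditions on the orbit of the
  point, with no words in generators.\<close>

definition alcove_point where "alcove_point = (SOME v. \<forall>a\<in>\<Delta>. a v > 0)"

lemma simple_p: "a \<in> \<Delta> \<Longrightarrow> a alcove_point > 0"
  using someI_ex[OF ex_alcove_point] unfolding alcove_point_def by blast

text \<open>Nonnegative because 2 \<theta> is a nonnegative combination of \<open>F\<close>; nonzero
  because \<theta> or - \<theta> is a positive affine root.\<close>

lemma \<theta>_p: "blinfun_apply \<theta> alcove_point > 0"
proof -
  obtain n where n: "\<forall>v. blinfun_apply (\<theta> - - \<theta>) v = (\<Sum>\<beta>\<in>F. real (n \<beta>) * blinfun_apply \<beta> v)"
    using nonneg_comb_apply[OF highest[OF uminus_in_R[OF \<theta>_in_R]]] by blast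
  note n = n[rule_format]
  have "blinfun_apply \<beta> alcove_point > 0" if "\<beta> \<in> F" for \<beta>
    using simple_p[of "affine_fun \<beta> 0"] that by (auto simp: simple_affine_roots_def)
  then have "blinfun_apply (\<theta> - - \<theta>) alcove_point \<ge> 0"
    unfolding n by (intro sum_nonneg mult_nonneg_nonneg) (auto intro: less_imp_le)
  then have "blinfun_apply \<theta> alcove_point \<ge> 0"
    by (simp add: blinfun.add_left)
  moreover have "blinfun_apply \<theta> alcove_point \<noteq> 0"
    using pos_or_neg_affine[OF affine_fun_in_\<Phi>[OF \<theta>_in_R, of 0]] pos_root_pos[of _ alcove_point] simple_p by force
  ultimately show ?thesis by simp
qed

text \<open>For 1 - \<theta> the alcove point is scaled to the wall. For \<beta> in \<open>F\<close>
  the value 0 is prescribed for \<beta> and 1 for the rest. A positive root vanishing at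
  \<open>q\<close> can only be a multiple of \<open>a\<close>.\<close>

lemma ex_wall_point:
  assumes "a \<in> \<Delta>"
  shows "\<exists>q. a q = 0 \<and> (\<forall>b\<in>\<Delta>. b \<noteq> a \<longrightarrow> b q > 0)"
  using assms
proof (cases rule: \<Delta>_cases)
  case 1
  let ?q = "(1 / blinfun_apply \<theta> alcove_point) *\<^sub>R alcove_point"
  have "b ?q > 0" if "b \<in> \<Delta>" "b \<noteq> a" for b
    using that(1)
  proof (cases rule: \<Delta>_cases)
    case (2 \<beta>)
    then show ?thesis using \<theta>_p simple_p[OF that(1)] by (simp add: blinfun.scaleR_right)
  qed (use 1 that in simp)
  moreover have "a ?q = 0" using \<theta>_p by (simp add: 1 blinfun.scaleR_right)
  ultimately show ?thesis by blast
next
  case (2 \<beta>)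
  define f where "f \<gamma> = (if \<gamma> = \<beta> then 0 else 1 :: real)" for \<gamma>
  have f: "\<forall>\<gamma>\<in>F. f \<gamma> \<ge> 0" by (simp add: f_def)
  obtain v where v: "\<forall>\<gamma>\<in>F. blinfun_apply \<gamma> v = f \<gamma>" "blinfun_apply \<theta> v \<ge> 0"
    using ex_dual_point[OF f] by blast
  note v = v[unfolded f_def]
  let ?t = "1 / (1 + blinfun_apply \<theta> v)"
  have "b (?t *\<^sub>R v) > 0" if "b \<in> \<Delta>" "b \<noteq> a" for b
    using that(1)
  proof (cases rule: \<Delta>_cases)
    case 1
    then show ?thesis using v(2) by (simp add: blinfun.scaleR_right)
  next
    case (2 \<gamma>)
    then have "\<gamma> \<noteq> \<beta>" using that \<open>a = affine_fun \<beta> 0\<close> by auto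
    then show ?thesis using 2 v by (simp add: blinfun.scaleR_right)
  qed
  moreover have "a (?t *\<^sub>R v) = 0" using v 2 by (simp add: blinfun.scaleR_right)
  ultimately show ?thesis by blast
qed

lemma ex_vertex_aux:
  assumes \<beta>: "\<beta> \<in> F" "\<theta> \<noteq> \<beta>"
  shows "\<exists>x. affine_fun (- \<theta>) 1 x = 0 \<and> affine_fun \<beta> 0 x = 0 \<and> (\<forall>c\<in>\<Delta>. c x \<ge> 0)"
proof -
  define f where "f \<gamma> = (if \<gamma> = \<beta> then 0 else 1 :: real)" for \<gamma>
  have f: "\<forall>\<gamma>\<in>F. f \<gamma> \<ge> 0" by (simp add: f_def)
  obtain v where v: "\<forall>\<gamma>\<in>F. blinfun_apply \<gamma> v = f \<gamma>" "blinfun_apply \<theta> v \<ge> 0"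
    and "\<forall>\<beta>0\<in>F. blinfun_apply \<theta> v = 0 \<longrightarrow> (\<forall>\<gamma>\<in>F. \<gamma> \<noteq> \<beta>0 \<longrightarrow> f \<gamma> > 0) \<longrightarrow> \<theta> = \<beta>0"
    using ex_dual_point[OF f] by blast
  note v = this[unfolded f_def] v[unfolded f_def]
  have v1: "blinfun_apply \<beta> v = 0" and v2: "\<gamma> \<in> F \<Longrightarrow> blinfun_apply \<gamma> v \<ge> 0" for \<gamma>
    using v \<beta>(1) by auto
  \<comment> \<open>By the last clause of \<open>ex_dual_point\<close>, \<theta> could vanish at
    \<open>v\<close> only if it were \<beta>.\<close>
  from v have pos: "blinfun_apply \<theta> v > 0" using \<beta> by (auto simp: less_le)
  let ?x = "(1 / blinfun_apply \<theta> v) *\<^sub>R v"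
  have "c ?x \<ge> 0" if "c \<in> \<Delta>" for c
    using that pos v2 by (cases rule: \<Delta>_cases) (auto simp: blinfun.scaleR_right)
  then show ?thesis
    using pos v1 by (intro exI[of _ ?x]) (simp add: blinfun.scaleR_right)
qed

text \<open>In the application \<open>z\<close> is the image of the alcove point under an element
  with the two descents \<open>a\<close> and \<open>b\<close>. It excludes the pair 1 - \<theta>,
  \<theta>, which has no common zero. Two roots of \<open>F\<close> vanish together at the
  origin.\<close>

lemma ex_vertex:
  assumes a: "a \<in> \<Delta>" and b: "b \<in> \<Delta>" and "a \<noteq> b" and z: "a z < 0" "b z < 0"
  shows "\<exists>x. a x = 0 \<and> b x = 0 \<and> (\<forall>c\<in>\<Delta>. c x \<ge> 0)"
  using a
proof (cases rule: \<Delta>_cases)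
  case a: 1
  from b show ?thesis
  proof (cases rule: \<Delta>_cases)
    case (2 \<beta>)
    then have "\<theta> \<noteq> \<beta>" using z a by auto
    then show ?thesis using ex_vertex_aux[OF 2(1)] a 2 by simp
  qed (use a \<open>a \<noteq> b\<close> in simp)
next
  case a: (2 \<alpha>)
  from b show ?thesis
  proof (cases rule: \<Delta>_cases)
    case 1
    then have "\<theta> \<noteq> \<alpha>" using z a by auto
    then show ?thesis using ex_vertex_aux[OF a(1)] a 1 by auto
  next
    case (2 \<beta>)
    have "c 0 \<ge> 0" if "c \<in> \<Delta>" for c
      using that by (cases rule: \<Delta>_cases) (auto simp: blinfun.zero_right)
    then show ?thesis using a 2 by (intro exI[of _ 0]) (simp add: blinfun.zero_right)
  qed
qed

lemma pos_iff: "c \<in> pos_affine_roots R F \<longleftrightarrow> c \<in> \<Phi> \<and> c alcove_point > 0"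
  and root_p_nonzero: "c \<in> \<Phi> \<Longrightarrow> c alcove_point \<noteq> 0"
  using pos_or_neg_affine[of c] pos_root_pos[of _ alcove_point] simple_p pos_subset_\<Phi> by force+

lemma neg_iff: "c \<in> neg_affine_roots R F \<longleftrightarrow> c \<in> \<Phi> \<and> c alcove_point < 0"
proof
  assume "c \<in> neg_affine_roots R F"
  then obtain d where d: "c = (\<lambda>v. - d v)" "d \<in> pos_affine_roots R F"
    by (auto simp: neg_affine_roots_def)
  then show "c \<in> \<Phi> \<and> c alcove_point < 0" using uminus_in_\<Phi>[of d] by (simp add: pos_iff)
next
  assume c: "c \<in> \<Phi> \<and> c alcove_point < 0"
  then have "(\<lambda>v. - c v) \<in> pos_affine_roots R F" by (simp add: pos_iff uminus_in_\<Phi>)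
  then show "c \<in> neg_affine_roots R F"
    unfolding neg_affine_roots_def by (rule rev_image_eqI) simp
qed

lemma root_nonzero_W: "c \<in> \<Phi> \<Longrightarrow> g \<in> W \<Longrightarrow> c (iapply g alcove_point) \<noteq> 0"
  using root_p_nonzero[OF root_compose] by blast

text \<open>At a point \<open>q\<close> on the wall of \<open>a\<close> alone \<open>c\<close> is
  positive: if it vanished there it would be a multiple of \<open>a\<close>, hence equal to
  \<open>a\<close> by reducedness. The reflection fixes \<open>q\<close>, so the reflected root is
  positive at \<open>q\<close> too and cannot be a negative root.\<close>

lemma simple_reflection_pos:
  assumes a: "a \<in> \<Delta>" and c: "c \<in> \<Phi>" "c alcove_point > 0" "c \<noteq> a"
  shows "c (iapply (affine_reflection a) alcove_point) > 0"
proof -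
  have a\<Phi>: "a \<in> \<Phi>" using a \<Delta>_subset_\<Phi> by blast
  obtain q where q: "a q = 0" "\<And>b. b \<in> \<Delta> \<Longrightarrow> b \<noteq> a \<Longrightarrow> b q > 0"
    using ex_wall_point[OF a] by blast
  then have q0: "\<forall>b\<in>\<Delta>. b q \<ge> 0" by (metis less_eq_real_def)
  have cpos: "c \<in> pos_affine_roots R F" using c by (simp add: pos_iff)
  have "c q \<noteq> 0"
  proof
    assume cq: "c q = 0"
    obtain n where n: "\<forall>b\<in>\<Delta>. n b \<ge> 0" and cv: "\<forall>v. c v = (\<Sum>b\<in>\<Delta>. n b * b v)"
      using pos_root_comb[OF cpos] by blast
  note n = n[rule_format] and cv = cv[rule_format]
    have "n b * b q = 0" if "b \<in> \<Delta>" for b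
      using cq sum_nonneg_eq_0_iff[OF finite_\<Delta>, of "\<lambda>b. n b * b q"] n q0 that by (simp add: cv)
    then have n0: "n b = 0" if "b \<in> \<Delta>" "b \<noteq> a" for b using that q(2) by fastforce
    have ca: "c v = n a * a v" for v
    proof -
      have "(\<Sum>b\<in>\<Delta>. n b * b v) = (\<Sum>b\<in>{a}. n b * b v)"
        using a n0 by (intro sum.mono_neutral_right finite_\<Delta>) auto
      then show ?thesis by (simp add: cv)
    qed
    obtain \<alpha> i where \<alpha>: "a = affine_fun \<alpha> i" "\<alpha> \<in> R" using a\<Phi> by (blast elim: \<Phi>_cases)
    obtain \<gamma> j where \<gamma>: "c = affine_fun \<gamma> j" "\<gamma> \<in> R" using c(1) by (blast elim: \<Phi>_cases)
    have "blinfun_apply \<gamma> v = n a * blinfun_apply \<alpha> v" for v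
      using ca[of v] ca[of 0] by (simp add: \<alpha> \<gamma> affine_fun_def blinfun.zero_right algebra_simps)
    then have "\<gamma> = n a *\<^sub>R \<alpha>" by (intro blinfun_eqI) (simp add: blinfun.scaleR_left)
    then have "n a = 1" using reduced[of \<alpha> "n a"] \<alpha>(2) \<gamma>(2) n[OF a] by auto
    then show False using ca \<open>c \<noteq> a\<close> by (simp add: fun_eq_iff)
  qed
  then have cq: "c q > 0" using pos_root_nonneg[OF cpos q0] by (simp add: less_le)
  obtain k where k: "\<And>v. c (iapply (affine_reflection a) v) = c v - k * a v"
    using root_reflection[OF a\<Phi> c(1)] by blast
  let ?d = "\<lambda>v. c (iapply (affine_reflection a) v)"
  have d: "?d \<in> \<Phi>" by (rule root_compose[OF W_reflection[OF a\<Phi>] c(1)])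
  have "?d q > 0" using k[of q] q(1) cq by simp
  moreover have "(\<lambda>v. - ?d v) \<in> pos_affine_roots R F \<Longrightarrow> - ?d q \<ge> 0"
    using pos_root_nonneg[of "\<lambda>v. - ?d v" q] q0 by simp
  ultimately have "?d \<in> pos_affine_roots R F"
    using pos_or_neg_affine[OF d] by auto
  then show ?thesis by (simp add: pos_iff)
qed

section \<open>Inversions and length\<close>

definition inversions :: "'v isom \<Rightarrow> ('v \<Rightarrow> real) set"
  where "inversions w = {c \<in> \<Phi>. c alcove_point > 0 \<and> c (iapply (- w) alcove_point) < 0}"

abbreviation len where "len \<equiv> weyl_length R F"

lemma len_eq_card_inversions:
  assumes "w \<in> W"
  shows "len w = card (inversions w)"
proof -
  have "c \<in> isom_act (- w) ` neg_affine_roots R F \<longleftrightarrow> isom_act w c \<in> neg_affine_roots R F" for c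
  proof
    assume "isom_act w c \<in> neg_affine_roots R F"
    then show "c \<in> isom_act (- w) ` neg_affine_roots R F"
      by (rule rev_image_eqI) (simp flip: isom_act_plus)
  qed (auto simp flip: isom_act_plus)
  then have "pos_affine_roots R F \<inter> isom_act (- w) ` neg_affine_roots R F = inversions w"
    using isom_act_root[OF assms] by (auto simp: inversions_def pos_iff neg_iff isom_act_def)
  then show ?thesis by (simp add: weyl_length_def)
qed

text \<open>For a fixed gradient the two sign conditions confine the constant to a bounded interval.
  Finiteness is what gives content to \<open>card\<close> in the length, since infinite sets have
  cardinality 0.\<close>

lemma finite_inversions: "finite (inversions w)"
proof -
  let ?A = "\<Union>\<alpha>\<in>R. affine_fun \<alpha> ` {\<lfloor>- blinfun_apply \<alpha> alcove_point\<rfloor>..\<lceil>- blinfun_apply \<alpha> (iapply (- w) alcove_point)\<rceil>}"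
  have "inversions w \<subseteq> ?A"
  proof
    fix c assume c: "c \<in> inversions w"
    then obtain \<alpha> m where \<alpha>: "c = affine_fun \<alpha> m" "\<alpha> \<in> R"
      unfolding inversions_def by (blast elim: \<Phi>_cases)
    with c have "m \<in> {\<lfloor>- blinfun_apply \<alpha> alcove_point\<rfloor>..\<lceil>- blinfun_apply \<alpha> (iapply (- w) alcove_point)\<rceil>}"
      by (simp add: inversions_def affine_fun_def) linarith
    with \<alpha> show "c \<in> ?A" by blast
  qed
  moreover have "finite ?A" using finite_R by blast
  ultimately show ?thesis by (rule finite_subset)
qed

lemma simple_in_\<Phi>: "a \<in> \<Delta> \<Longrightarrow> a \<in> \<Phi>"
  using \<Delta>_subset_\<Phi> by blast

lemma W_simple_reflection: "a \<in> \<Delta> \<Longrightarrow> affine_reflection a \<in> W"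
  by (simp add: W_reflection simple_in_\<Phi>)

lemma simple_reflection_sign:
  assumes a: "a \<in> \<Delta>" and d: "d \<in> \<Phi>" "d \<noteq> a" "d \<noteq> (\<lambda>v. - a v)"
  shows "d (iapply (affine_reflection a) alcove_point) < 0 \<longleftrightarrow> d alcove_point < 0"
proof -
  have "(\<lambda>v. - d v) \<noteq> a" using d(3) by auto
  then have "d alcove_point < 0 \<Longrightarrow> d (iapply (affine_reflection a) alcove_point) < 0"
    using simple_reflection_pos[OF a uminus_in_\<Phi>[OF d(1)]] by simp
  moreover have "d alcove_point > 0 \<Longrightarrow> d (iapply (affine_reflection a) alcove_point) > 0"
    using simple_reflection_pos[OF a d(1) _ d(2)] .
  ultimately show ?thesis using root_p_nonzero[OF d(1)] by linarith
qed

text \<open>By \<open>simple_reflection_sign\<close> the reflection in \<open>a\<close> disturbs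
  only the signs of \<open>a\<close> and its negative. The inversion that is lost is the root sent
  by \<open>w\<close> to the negative of \<open>a\<close>.\<close>

lemma inversions_descent:
  assumes w: "w \<in> W" and a: "a \<in> \<Delta>" and desc: "a (iapply w alcove_point) < 0"
  shows "inversions w = insert (\<lambda>v. - a (iapply w v)) (inversions (affine_reflection a + w))"
    and "(\<lambda>v. - a (iapply w v)) \<notin> inversions (affine_reflection a + w)"
proof -
  let ?c0 = "\<lambda>v. - a (iapply w v)"
  have a\<Phi>: "a \<in> \<Phi>" by (rule simple_in_\<Phi>[OF a])
  have c0: "?c0 \<in> \<Phi>" by (intro uminus_in_\<Phi> root_compose w a\<Phi>)
  have inv: "iapply (- (affine_reflection a + w)) v = iapply (- w) (iapply (affine_reflection a) v)" for v
    by (simp only: minus_add iapply_plus reflection_self_inverse[OF a\<Phi>])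
  show notin: "?c0 \<notin> inversions (affine_reflection a + w)"
    using simple_p[OF a] by (simp add: inversions_def inv root_reflection_self[OF a\<Phi>])
  have "c \<in> inversions w \<longleftrightarrow> c = ?c0 \<or> c \<in> inversions (affine_reflection a + w)" if c: "c \<in> \<Phi>" for c
  proof -
    let ?d = "\<lambda>v. c (iapply (- w) v)"
    have d: "?d \<in> \<Phi>" by (rule root_compose[OF W_uminus[OF w] c])
    have cd: "c v = ?d (iapply w v)" for v by simp
    consider "?d = a" | "?d = (\<lambda>v. - a v)" | "?d \<noteq> a" "?d \<noteq> (\<lambda>v. - a v)" by blast
    then show ?thesis
    proof cases
      case 1
      then have "c alcove_point < 0" using desc cd by metis
      moreover have "?c0 alcove_point > 0" using desc by simp
      ultimately show ?thesis by (auto simp: inversions_def)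
    next
      case 2
      have "c = ?c0"
        by (rule ext) (subst cd, simp only: 2[THEN fun_cong])
      then show ?thesis using simple_p[OF a] desc c0 by (simp add: inversions_def)
    next
      case 3
      then have "c \<noteq> ?c0" by auto
      then show ?thesis
        using simple_reflection_sign[OF a d 3] by (simp add: inversions_def inv)
    qed
  qed
  then show "inversions w = insert ?c0 (inversions (affine_reflection a + w))"
    using c0 by (auto simp: inversions_def)
qed

lemma len_descent:
  assumes "w \<in> W" and "a \<in> \<Delta>" and "a (iapply w alcove_point) < 0"
  shows "len w = Suc (len (affine_reflection a + w))"
  using inversions_descent[OF assms] assms
  by (simp add: len_eq_card_inversions W_plus W_simple_reflection finite_inversions)

lemma len_ascent:
  assumes "w \<in> W" and "a \<in> \<Delta>" and "a (iapply w alcove_point) > 0"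
  shows "len (affine_reflection a + w) = Suc (len w)"
  using len_descent[of "affine_reflection a + w" a] assms
  by (simp add: W_plus W_simple_reflection root_reflection_self reflection_self_inverse simple_in_\<Phi>)

text \<open>If every simple root is positive at the image of the alcove point under
  \<open>w\<close>, so is every positive root. An inversion \<open>c\<close> contradicts this: the
  negative of \<open>w c\<close> is positive, yet its value at that image is minus that of
  \<open>c\<close> at the alcove point.\<close>

lemma ex_descent:
  assumes w: "w \<in> W" and "len w > 0"
  shows "\<exists>a\<in>\<Delta>. a (iapply w alcove_point) < 0"
proof (rule ccontr)
  assume "\<not> ?thesis"
  then have pos: "a (iapply w alcove_point) > 0" if "a \<in> \<Delta>" for a
    using root_nonzero_W[OF simple_in_\<Phi> w] that by (meson linorder_neqE_linordered_idom)
  have "inversions w \<noteq> {}"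
    using assms by (auto simp: len_eq_card_inversions)
  then obtain c where c: "c \<in> \<Phi>" "c alcove_point > 0" "c (iapply (- w) alcove_point) < 0"
    by (auto simp: inversions_def)
  let ?d = "\<lambda>v. - c (iapply (- w) v)"
  have "?d \<in> pos_affine_roots R F"
    using c by (simp add: pos_iff uminus_in_\<Phi> root_compose W_uminus[OF w])
  from pos_root_pos[OF this, of "iapply w alcove_point"] pos show False using c by simp
qed

lemma no_descent_len_0: "w \<in> W \<Longrightarrow> len w = 0 \<Longrightarrow> a \<in> \<Delta> \<Longrightarrow> a (iapply w alcove_point) > 0"
  using len_descent[of w a] root_nonzero_W[OF simple_in_\<Phi>, of a w] by fastforce

section \<open>Elements of length zero and length estimates\<close>

abbreviation \<Omega> where "\<Omega> \<equiv> length_zero_group R X F"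

lemma \<Omega>_iff: "w \<in> \<Omega> \<longleftrightarrow> w \<in> W \<and> len w = 0"
  by (simp add: length_zero_group_def)

text \<open>Without inversions no positive root changes sign; negative roots are covered by passing
  to their negatives.\<close>

lemma \<Omega>_sign:
  assumes \<omega>: "\<omega> \<in> \<Omega>" and c: "c \<in> \<Phi>"
  shows "c (iapply (- \<omega>) alcove_point) < 0 \<longleftrightarrow> c alcove_point < 0"
    and "c (iapply \<omega> alcove_point) < 0 \<longleftrightarrow> c alcove_point < 0"
proof -
  have W: "\<omega> \<in> W" and "inversions \<omega> = {}"
    using \<omega> finite_inversions[of \<omega>] by (auto simp: \<Omega>_iff len_eq_card_inversions)
  then have noinv: "\<not> d (iapply (- \<omega>) alcove_point) < 0" if "d \<in> \<Phi>" "d alcove_point > 0" for d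
    using that by (auto simp: inversions_def)
  have sign: "d (iapply (- \<omega>) alcove_point) < 0 \<longleftrightarrow> d alcove_point < 0" if d: "d \<in> \<Phi>" for d
    using noinv[OF d] noinv[OF uminus_in_\<Phi>[OF d]] root_p_nonzero[OF d] root_nonzero_W[OF d W_uminus[OF W]]
    by fastforce
  then show "c (iapply (- \<omega>) alcove_point) < 0 \<longleftrightarrow> c alcove_point < 0" using c by blast
  show "c (iapply \<omega> alcove_point) < 0 \<longleftrightarrow> c alcove_point < 0"
    using sign[OF root_compose[OF W c]] by simp
qed

lemma zero_in_\<Omega>: "0 \<in> \<Omega>"
proof -
  have "inversions 0 = {}" by (auto simp: inversions_def)
  then show ?thesis by (simp add: \<Omega>_iff W_0 len_eq_card_inversions)
qed

lemma len_\<Omega>_plus: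
  assumes \<omega>: "\<omega> \<in> \<Omega>" and w: "w \<in> W"
  shows "len (\<omega> + w) = len w"
proof -
  have "inversions (\<omega> + w) = inversions w"
    using \<Omega>_sign(1)[OF \<omega> root_compose[OF W_uminus[OF w]]]
    by (auto simp: inversions_def minus_add simp del: add_uminus_conv_diff)
  then show ?thesis using \<omega> w by (simp add: len_eq_card_inversions W_plus \<Omega>_iff)
qed

lemma reflection_isom_act:
  assumes "c \<in> \<Phi>" and "g \<in> W"
  shows "affine_reflection (isom_act g c) = g + affine_reflection c + - g"
proof -
  obtain \<alpha> m where c: "c = affine_fun \<alpha> m" "\<alpha> \<noteq> 0" using assms by (blast elim: \<Phi>_cases)
  obtain \<beta> n where "isom_act g c = affine_fun \<beta> n" using isom_act_root[OF assms(2,1)] by (blast elim: \<Phi>_cases)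
  then show ?thesis using isom_act_affine_fun(3)[OF c(2)] c(1) by metis
qed

text \<open>The image of \<open>a\<close> is a positive root, so the reflection in it has positive
  length and hence a simple descent \<open>e\<close>. Pulled back by \<omega>, \<open>e\<close> is a
  positive root that \<open>s_a\<close> makes negative, so it is \<open>a\<close>.\<close>

lemma \<Omega>_simple:
  assumes \<omega>: "\<omega> \<in> \<Omega>" and a: "a \<in> \<Delta>"
  shows "isom_act \<omega> a \<in> \<Delta>"
proof -
  have W: "\<omega> \<in> W" using \<omega> by (simp add: \<Omega>_iff)
  have a\<Phi>: "a \<in> \<Phi>" by (rule simple_in_\<Phi>[OF a])
  let ?b = "isom_act \<omega> a"
  have b: "?b \<in> \<Phi>" by (rule isom_act_root[OF W a\<Phi>])
  let ?s = "affine_reflection ?b"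
  have s: "?s \<in> W" by (rule W_reflection[OF b])
  have bp: "?b alcove_point > 0"
    using \<Omega>_sign(1)[OF \<omega> a\<Phi>] simple_p[OF a] root_p_nonzero[OF b] by (force simp: isom_act_def)
  have "?b \<in> inversions ?s"
    using b bp by (simp add: inversions_def reflection_self_inverse root_reflection_self)
  then have "len ?s > 0"
    using finite_inversions by (auto simp: len_eq_card_inversions[OF s] card_gt_0_iff)
  then obtain e where e: "e \<in> \<Delta>" "e (iapply ?s alcove_point) < 0" using ex_descent[OF s] by blast
  have e\<Phi>: "e \<in> \<Phi>" by (rule simple_in_\<Phi>[OF e(1)])
  let ?d = "\<lambda>v. e (iapply \<omega> v)"
  have d: "?d \<in> \<Phi>" by (rule root_compose[OF W e\<Phi>])
  have dp: "?d alcove_point > 0"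
    using \<Omega>_sign(2)[OF \<omega> e\<Phi>] simple_p[OF e(1)] root_p_nonzero[OF d] by force
  have "?d = a"
  proof (rule ccontr)
    assume "?d \<noteq> a"
    then have "?d (iapply (affine_reflection a) alcove_point) > 0"
      by (rule simple_reflection_pos[OF a d dp])
    moreover have "?d (iapply (affine_reflection a) (iapply (- \<omega>) alcove_point)) < 0"
      using e(2) by (simp add: reflection_isom_act[OF a\<Phi> W])
    then have "?d (iapply (affine_reflection a) alcove_point) < 0"
      using \<Omega>_sign(1)[OF \<omega> root_compose[OF W_reflection[OF a\<Phi>] d]] by simp
    ultimately show False by simp
  qed
  then have "?b = e" by (auto simp: isom_act_def)
  with e show ?thesis by simp
qed

text \<open>An explicit injection maps the inversions of \<open>w s_c\<close> to inversions of
  \<open>w\<close> other than \<open>c\<close>: a root goes to its reflection if that is positive,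
  and to itself otherwise.\<close>

lemma len_reflection_less:
  assumes w: "w \<in> W" and c: "c \<in> inversions w"
  shows "len (w + affine_reflection c) < len w"
proof -
  let ?s = "affine_reflection c"
  have c\<Phi>: "c \<in> \<Phi>" and cp: "c alcove_point > 0" and cw: "c (iapply (- w) alcove_point) < 0"
    using c by (auto simp: inversions_def)
  have sW: "?s \<in> W" by (rule W_reflection[OF c\<Phi>])
  have inv: "iapply (- (w + ?s)) v = iapply ?s (iapply (- w) v)" for v
    by (simp only: minus_add iapply_plus reflection_self_inverse[OF c\<Phi>])
  define r where "r d = (\<lambda>v. d (iapply ?s v))" for d :: "'v \<Rightarrow> real"
  define f where "f d = (if r d alcove_point > 0 then r d else d)" for d
  have rr: "r (r d) = d" for d
    by (simp add: r_def reflection_self_inverse[OF c\<Phi>])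
  have r\<Phi>: "d \<in> \<Phi> \<Longrightarrow> r d \<in> \<Phi>" for d unfolding r_def by (rule root_compose[OF sW])
  have f: "f d \<in> inversions w - {c}" if "d \<in> inversions (w + ?s)" for d
  proof -
    have d: "d \<in> \<Phi>" "d alcove_point > 0" "r d (iapply (- w) alcove_point) < 0"
      using that by (auto simp: inversions_def inv r_def)
    show ?thesis
    proof (cases "r d alcove_point > 0")
      case True
      have "r d \<noteq> c"
      proof
        assume "r d = c"
        then have "d alcove_point = c (iapply ?s alcove_point)" using rr[of d] by (metis r_def)
        then show False using d(2) cp root_reflection_self[OF c\<Phi>, of alcove_point] by simp
      qed
      then show ?thesis using True d r\<Phi> by (simp add: f_def inversions_def)
    next
      case False
      \<comment> \<open>The reflection turns \<open>d\<close> from positive to negative at the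
        alcove point, which forces \<open>k > 0\<close>. At the other point \<open>d\<close> is
        \<open>r d + k * c\<close>, a sum of two negative numbers.\<close>
      obtain k where k: "\<And>v. r d v = d v - k * c v"
        using root_reflection[OF c\<Phi> d(1)] unfolding r_def by blast
      have "k * c alcove_point > 0" using k[of alcove_point] False d(2) by simp
      then have "k > 0" using cp by (simp add: zero_less_mult_iff)
      then have "k * c (iapply (- w) alcove_point) < 0" using cw by (simp add: mult_pos_neg)
      then have "d (iapply (- w) alcove_point) < 0" using k d(3) by simp
      moreover have "d \<noteq> c"
        using d(3) cw root_reflection_self[OF c\<Phi>] by (auto simp: r_def)
      ultimately show ?thesis using False d by (simp add: f_def inversions_def)
    qed
  qed
  have "inj_on f (inversions (w + ?s))"
  proof (rule inj_onI)
    fix d e assume d: "d \<in> inversions (w + ?s)" and e: "e \<in> inversions (w + ?s)" and eq: "f d = f e"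
    have pos: "d alcove_point > 0" "e alcove_point > 0" using d e by (auto simp: inversions_def)
    show "d = e"
    proof (cases "r d alcove_point > 0"; cases "r e alcove_point > 0")
      assume "r d alcove_point > 0" "r e alcove_point > 0"
      then have "r (r d) = r (r e)" using eq by (simp add: f_def)
      then show ?thesis by (simp only: rr)
    next
      assume "r d alcove_point > 0" "\<not> r e alcove_point > 0"
      then have "r d = e" using eq by (simp add: f_def)
      then have "r e = d" using rr by metis
      then show ?thesis using \<open>\<not> r e alcove_point > 0\<close> pos by simp
    next
      assume "\<not> r d alcove_point > 0" "r e alcove_point > 0"
      then have "r e = d" using eq by (simp add: f_def)
      then have "r d = e" using rr by metis
      then show ?thesis using \<open>\<not> r d alcove_point > 0\<close> pos by simp
    qed (use eq in \<open>simp add: f_def\<close>)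
  qed
  then have "card (inversions (w + ?s)) \<le> card (inversions w - {c})"
    using f finite_inversions by (intro card_inj_on_le[of f]) auto
  also have "\<dots> < card (inversions w)"
    using c finite_inversions by (rule card_Diff1_less[rotated])
  finally show ?thesis using w sW by (simp add: len_eq_card_inversions W_plus)
qed

text \<open>Suppose \<open>u\<close> makes a positive root \<open>c\<close> negative. Then
  \<open>c\<close> and the negative of \<open>u c\<close> are both nonnegative at \<open>x\<close>,
  and opposite there because \<open>u\<close> fixes \<open>x\<close>; so both vanish at
  \<open>x\<close>. Now \<open>pos_root_face\<close> makes \<open>c\<close> both positive and
  negative at the image of the alcove point under \<open>y\<close>.\<close>

lemma face_stabilizer_len_0:
  assumes u: "u \<in> W" and y: "y \<in> W" and x: "\<forall>a\<in>\<Delta>. a x \<ge> 0" and ux: "iapply u x = x"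
    and m1: "\<forall>a\<in>\<Delta>. a x = 0 \<longrightarrow> a (iapply y alcove_point) > 0"
    and m2: "\<forall>a\<in>\<Delta>. a x = 0 \<longrightarrow> a (iapply (u + y) alcove_point) > 0"
  shows "u \<in> \<Omega>"
proof -
  have "\<not> c (iapply (- u) alcove_point) < 0" if c: "c \<in> \<Phi>" "c alcove_point > 0" for c
  proof
    assume neg: "c (iapply (- u) alcove_point) < 0"
    let ?d = "\<lambda>v. - c (iapply (- u) v)"
    have d: "?d \<in> pos_affine_roots R F"
      using neg by (simp add: pos_iff uminus_in_\<Phi> root_compose[OF W_uminus[OF u] c(1)])
    have cpos: "c \<in> pos_affine_roots R F" using c by (simp add: pos_iff)
    have ux': "iapply (- u) x = x" using ux iapply_cancel(1)[of u x] by simp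
    have cx: "c x = 0"
      using pos_root_nonneg[OF d x] pos_root_nonneg[OF cpos x] ux' by simp
    then have dx: "?d x = 0" using ux' by simp
    have "c (iapply y alcove_point) > 0"
      by (rule pos_root_face[OF cpos x cx m1])
    moreover have "?d (iapply (u + y) alcove_point) > 0"
      by (rule pos_root_face[OF d x dx m2])
    ultimately show False by simp
  qed
  then have "inversions u = {}" by (auto simp: inversions_def)
  then show ?thesis using u by (simp add: \<Omega>_iff len_eq_card_inversions)
qed

end

section \<open>Linear maps\<close>

lemma clinearI:
  assumes "\<And>x y. f (x + y) = f x + f y" and "\<And>c x. f (c *\<^sub>C x) = c *\<^sub>C f x"
  shows "clinear f"
  using assms by unfold_locales auto

lemma clinear_simps:
  assumes "clinear f"
  shows "f (x + y) = f x + f y" "f (c *\<^sub>C x) = c *\<^sub>C f x" "f 0 = 0" "f (- x) = - f x" "f (x - y) = f x - f y"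
    "f (sum g A) = (\<Sum>i\<in>A. f (g i))"
proof -
  interpret f: Vector_Spaces.linear scaleC scaleC f by (rule assms)
  show "f (x + y) = f x + f y" "f (c *\<^sub>C x) = c *\<^sub>C f x" "f 0 = 0" "f (- x) = - f x" "f (x - y) = f x - f y"
    "f (sum g A) = (\<Sum>i\<in>A. f (g i))"
    by (simp_all add: f.add f.scale f.zero f.neg f.diff f.sum)
qed

lemma clinear_compose: "clinear f \<Longrightarrow> clinear g \<Longrightarrow> clinear (\<lambda>x. f (g x))"
  by (intro clinearI) (simp_all add: clinear_simps)

lemma clinear_id: "clinear (\<lambda>x. x)" "clinear id"
  by (auto intro: clinearI)

lemma clinear_diff_scale: "clinear f \<Longrightarrow> clinear g \<Longrightarrow> clinear (\<lambda>x. f x - c *\<^sub>C g x)"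
  by (intro clinearI) (simp_all add: clinear_simps complex_vector.scale_right_diff_distrib
      complex_vector.scale_right_distrib complex_vector.scale_left_commute)

definition lin_ext :: "('z \<Rightarrow> 'e::complex_vector) \<Rightarrow> ('z \<Rightarrow>\<^sub>0 complex) \<Rightarrow> 'e"
  where "lin_ext B p = (\<Sum>z\<in>Poly_Mapping.keys p. Poly_Mapping.lookup p z *\<^sub>C B z)"

lemma lin_ext_superset:
  assumes "finite A" "Poly_Mapping.keys p \<subseteq> A"
  shows "lin_ext B p = (\<Sum>z\<in>A. Poly_Mapping.lookup p z *\<^sub>C B z)"
  unfolding lin_ext_def using assms by (intro sum.mono_neutral_left) (auto simp: in_keys_iff)

lemma clinear_lin_ext: "clinear (lin_ext B)"
proof (rule clinearI)
  fix p q :: "'a \<Rightarrow>\<^sub>0 complex" and c :: complex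
  let ?A = "Poly_Mapping.keys p \<union> Poly_Mapping.keys q"
  have "Poly_Mapping.keys (p + q) \<subseteq> ?A" by (rule Poly_Mapping.keys_add)
  then show "lin_ext B (p + q) = lin_ext B p + lin_ext B q"
    using lin_ext_superset[of ?A p B] lin_ext_superset[of ?A q B] lin_ext_superset[of ?A "p + q" B]
    by (simp add: lookup_add scaleC_add_left sum.distrib)
  have "Poly_Mapping.keys (c *\<^sub>C p) \<subseteq> Poly_Mapping.keys p"
    by (auto simp: in_keys_iff scaleC_poly_mapping.rep_eq)
  then show "lin_ext B (c *\<^sub>C p) = c *\<^sub>C lin_ext B p"
    using lin_ext_superset[of "Poly_Mapping.keys p" "c *\<^sub>C p" B]
    by (simp add: lin_ext_def scaleC_poly_mapping.rep_eq scaleC_complex_def complex_vector.scale_sum_right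
        scaleC_scaleC)
qed

lemma lin_ext_single: "lin_ext B (Poly_Mapping.single z c) = c *\<^sub>C B z"
  by (cases "c = 0") (simp_all add: lin_ext_def)

lemma lin_ext_fun_add: "lin_ext (\<lambda>z. B z + C z) p = lin_ext B p + lin_ext C p"
  and lin_ext_fun_scale: "lin_ext (\<lambda>z. c *\<^sub>C B z) p = c *\<^sub>C lin_ext B p"
  by (simp_all add: lin_ext_def scaleC_add_right sum.distrib complex_vector.scale_sum_right
      complex_vector.scale_left_commute mult.commute)

section \<open>Tensor products\<close>

definition tensor_lift :: "('a::complex_vector \<Rightarrow> 'b::complex_vector \<Rightarrow> 'e::complex_vector) \<Rightarrow> ('a, 'b) ctensor \<Rightarrow> 'e"
  where "tensor_lift B t = lin_ext (case_prod B) (rep_ctensor t)"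

text \<open>The linear extension of \<open>B\<close> to formal sums kills the tensor relations, so
  the representative chosen in the definition does not matter.\<close>

lemma tensor_lift:
  fixes B :: "'a::complex_vector \<Rightarrow> 'b::complex_vector \<Rightarrow> 'e::complex_vector"
  assumes B1: "\<And>y. clinear (\<lambda>x. B x y)" and B2: "\<And>x. clinear (B x)"
  shows "clinear (tensor_lift B)" and "tensor_lift B (x \<otimes>\<^sub>C y) = B x y"
proof -
  let ?H = "lin_ext (case_prod B)"
  interpret H': Vector_Spaces.linear scaleC scaleC ?H by (rule clinear_lin_ext)
  note H = clinear_simps[OF clinear_lin_ext[of "case_prod B"]]
  have "?H r = 0" if "r \<in> tensor_relations" for r
    using that by cases (simp_all add: H lin_ext_single scaleC_one clinear_simps[OF B1] clinear_simps[OF B2])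
  then have H0: "?H r = 0" if "r \<in> cspan tensor_relations" for r
    using H'.eq_0_on_span[OF _ that] by blast
  have abs: "tensor_lift B (abs_ctensor p) = ?H p" for p
  proof -
    have "rep_ctensor (abs_ctensor p) - p \<in> cspan tensor_relations"
      by (rule Quotient_rep_abs[OF Quotient_ctensor, simplified]) (simp add: complex_vector.span_zero)
    from H0[OF this] show ?thesis by (simp add: tensor_lift_def H)
  qed
  show "clinear (tensor_lift B)"
  proof (rule clinearI)
    show "tensor_lift B (s + t) = tensor_lift B s + tensor_lift B t" for s t
      by (induction s rule: ctensor.abs_induct, induction t rule: ctensor.abs_induct)
        (simp add: plus_ctensor.abs_eq abs H)
    show "tensor_lift B (c *\<^sub>C t) = c *\<^sub>C tensor_lift B t" for c t
      by (induction t rule: ctensor.abs_induct) (simp add: scaleC_ctensor.abs_eq abs H)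
  qed
  show "tensor_lift B (x \<otimes>\<^sub>C y) = B x y"
    by (simp add: tensor.abs_eq abs lin_ext_single scaleC_one)
qed

lemma ctensor_ext:
  assumes "clinear h" and "clinear h'" and "\<And>x y. h (x \<otimes>\<^sub>C y) = h' (x \<otimes>\<^sub>C y)"
  shows "h t = h' t"
  by (induction t rule: ctensor_induct) (simp_all add: clinear_simps[OF assms(1)] clinear_simps[OF assms(2)] assms(3))

lemma tensor_map:
  assumes "clinear f" and "clinear g"
  shows "clinear (tensor_map f g)" and "tensor_map f g (x \<otimes>\<^sub>C y) = f x \<otimes>\<^sub>C g y"
  using theI'[OF ex1_tensor_map[OF assms]] unfolding tensor_map_def by auto

lemma tensor_zero: "0 \<otimes>\<^sub>C y = 0" "x \<otimes>\<^sub>C 0 = 0"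
  using tensor_bilinear(3)[of 0 0 y] tensor_bilinear(4)[of x 0 0] by simp_all

lemma tensor_diff: "(x - x') \<otimes>\<^sub>C y = x \<otimes>\<^sub>C y - x' \<otimes>\<^sub>C y"
  using tensor_bilinear(1)[of "x - x'" x' y] by simp

lemma tensor_minus: "(- x) \<otimes>\<^sub>C y = - (x \<otimes>\<^sub>C y)"
  using tensor_diff[of 0 x y] by (simp add: tensor_zero)

lemma tensor_sum_right: "x \<otimes>\<^sub>C (\<Sum>i\<in>A. g i) = (\<Sum>i\<in>A. x \<otimes>\<^sub>C g i)"
  by (induction A rule: infinite_finite_induct) (simp_all add: tensor_zero tensor_bilinear)

text \<open>Applied to a basis of \<open>M\<close>, this replaces a tensor by finitely many analytic
  functions.\<close>

lemma ctensor_basis_expansion: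
  fixes t :: "('a::complex_vector, 'b::complex_vector) ctensor"
  assumes B: "cspan B = (UNIV :: 'b set)"
  shows "\<exists>S f. finite S \<and> S \<subseteq> B \<and> t = (\<Sum>b\<in>S. f b \<otimes>\<^sub>C b)"
proof (induction t rule: ctensor_induct)
  case (add s t)
  then obtain S f T g where S: "finite S" "S \<subseteq> B" "s = (\<Sum>b\<in>S. f b \<otimes>\<^sub>C b)"
    and T: "finite T" "T \<subseteq> B" "t = (\<Sum>b\<in>T. g b \<otimes>\<^sub>C b)" by blast
  let ?f = "\<lambda>b. if b \<in> S then f b else 0" and ?g = "\<lambda>b. if b \<in> T then g b else 0"
  have "s = (\<Sum>b\<in>S \<union> T. ?f b \<otimes>\<^sub>C b)"
    unfolding S(3) by (rule sum.mono_neutral_cong_left) (use S T in \<open>auto simp: tensor_zero\<close>)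
  moreover have "t = (\<Sum>b\<in>S \<union> T. ?g b \<otimes>\<^sub>C b)"
    unfolding T(3) by (rule sum.mono_neutral_cong_left) (use S T in \<open>auto simp: tensor_zero\<close>)
  ultimately have "s + t = (\<Sum>b\<in>S \<union> T. (?f b + ?g b) \<otimes>\<^sub>C b)"
    by (simp only: tensor_bilinear sum.distrib)
  then show ?case using S T by (intro exI[of _ "S \<union> T"] exI[of _ "\<lambda>b. ?f b + ?g b"]) auto
next
  case (scaleC c x y)
  have "y \<in> cspan B" using B by simp
  then obtain S r where S: "finite S" "S \<subseteq> B" "y = (\<Sum>b\<in>S. r b *\<^sub>C b)"
    unfolding complex_vector.span_explicit by blast
  have "c *\<^sub>C (x \<otimes>\<^sub>C y) = (\<Sum>b\<in>S. (c *\<^sub>C r b *\<^sub>C x) \<otimes>\<^sub>C b)"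
    unfolding S(3) tensor_sum_right complex_vector.scale_sum_right by (simp add: tensor_bilinear)
  then show ?case using S by (intro exI[of _ S] exI[of _ "\<lambda>b. c *\<^sub>C r b *\<^sub>C x"]) simp
qed

section \<open>Symmetric algebras\<close>

lemma sym_of_add: "sym_of (x + y) = sym_of x + sym_of y"
  by transfer (unfold diff_diff_add[symmetric], intro module.span_base[OF module_mult] sym_relations.intros)

lemma sym_of_scaleC: "sym_of (c *\<^sub>C x) = c *\<^sub>C sym_of x"
  by transfer (intro module.span_base[OF module_mult] sym_relations.intros)

lemma abs_symalg_single_add_mset:
  "abs_symalg (Poly_Mapping.single (add_mset x A) 1) = sym_of x * abs_symalg (Poly_Mapping.single A 1)"
  by (simp add: sym_of.abs_eq times_symalg.abs_eq mult_single)

lemma symalg_induct [case_names one mult add scaleC]: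
  assumes one: "P 1" and mult: "\<And>x q. P q \<Longrightarrow> P (sym_of x * q)"
    and add: "\<And>p q. P p \<Longrightarrow> P q \<Longrightarrow> P (p + q)" and scale: "\<And>c p. P p \<Longrightarrow> P (c *\<^sub>C p)"
  shows "P p"
proof (induction p rule: symalg.abs_induct)
  fix p :: "'a multiset \<Rightarrow>\<^sub>0 complex"
  have P_single: "P (abs_symalg (Poly_Mapping.single A 1))" for A
  proof (induction A)
    case empty
    have "abs_symalg (Poly_Mapping.single {#} 1) = (1 :: 'a symalg)"
      by (simp add: one_symalg.abs_eq flip: single_one)
    then show ?case using one by simp
  next
    case (add x A)
    then show ?case by (simp add: abs_symalg_single_add_mset mult)
  qed
  show "P (abs_symalg p)"
  proof (induction p rule: poly_mapping_add_induct)
    case (single A c)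
    show ?case using scale[OF P_single[of A], of c] by (subst single_eq_scaleC) (simp add: scaleC_symalg.abs_eq)
  next
    case (sum p q)
    then show ?case using add by (simp flip: plus_symalg.abs_eq)
  qed
qed

text \<open>The data of the universal property of the symmetric algebra, with target an algebra of
  operators; \<open>sym_op\<close> is the resulting extension.\<close>

locale commuting_operators =
  fixes \<phi> :: "'x::complex_vector \<Rightarrow> 'e::complex_vector \<Rightarrow> 'e"
  assumes lin: "clinear (\<phi> x)"
    and \<phi>_add: "\<phi> (x + y) t = \<phi> x t + \<phi> y t"
    and \<phi>_scale: "\<phi> (c *\<^sub>C x) t = c *\<^sub>C \<phi> x t"
    and \<phi>_comm: "\<phi> x (\<phi> y t) = \<phi> y (\<phi> x t)"
begin

lemma comp_fun_commute_\<phi>: "comp_fun_commute \<phi>"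
  by unfold_locales (auto simp: \<phi>_comm)

definition mono_op :: "'x multiset \<Rightarrow> 'e \<Rightarrow> 'e"
  where "mono_op A t = fold_mset \<phi> t A"

lemma mono_op_empty [simp]: "mono_op {#} t = t"
  and mono_op_add_mset: "mono_op (add_mset x A) t = \<phi> x (mono_op A t)"
  by (simp_all add: mono_op_def comp_fun_commute.fold_mset_add_mset[OF comp_fun_commute_\<phi>])

lemma mono_op_plus: "mono_op (A + B) t = mono_op A (mono_op B t)"
  by (induction A) (simp_all add: mono_op_add_mset)

lemma clinear_mono_op: "clinear (mono_op A)"
proof (induction A)
  case empty
  then show ?case by (intro clinearI) auto
next
  case (add x A)
  from clinear_compose[OF lin this] show ?case by (simp add: mono_op_add_mset[abs_def] cong: if_cong)
qed

definition poly_op :: "('x multiset \<Rightarrow>\<^sub>0 complex) \<Rightarrow> 'e \<Rightarrow> 'e"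
  where "poly_op p t = lin_ext (\<lambda>A. mono_op A t) p"

lemma clinear_poly_op_left: "clinear (\<lambda>p. poly_op p t)"
  unfolding poly_op_def by (rule clinear_lin_ext)

lemma clinear_poly_op: "clinear (poly_op p)"
  by (rule clinearI) (simp_all add: poly_op_def clinear_simps[OF clinear_mono_op] lin_ext_fun_add lin_ext_fun_scale)

lemma poly_op_single: "poly_op (Poly_Mapping.single A c) t = c *\<^sub>C mono_op A t"
  by (simp add: poly_op_def lin_ext_single)

lemma poly_op_times: "poly_op (p * q) t = poly_op p (poly_op q t)"
proof (induction p rule: poly_mapping_add_induct)
  case (single A c)
  show ?case
  proof (induction q rule: poly_mapping_add_induct)
    case (single B d)
    show ?case
      by (simp add: mult_single poly_op_single mono_op_plus clinear_simps[OF clinear_mono_op] scaleC_scaleC)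
  next
    case (sum q q')
    then show ?case
      by (simp add: distrib_left clinear_simps[OF clinear_poly_op_left] clinear_simps[OF clinear_poly_op])
  qed
next
  case (sum p p')
  then show ?case
    by (simp add: distrib_right clinear_simps[OF clinear_poly_op_left])
qed

text \<open>By \<open>poly_op_times\<close> the polynomials acting as zero form an ideal, so the
  generating relations are all that has to be checked.\<close>

lemma poly_op_ideal: "r \<in> ideal_generated sym_relations \<Longrightarrow> poly_op r t = 0"
proof -
  let ?K = "{r. \<forall>t. poly_op r t = 0}"
  have "sym_relations \<subseteq> ?K"
  proof
    fix r :: "'x multiset \<Rightarrow>\<^sub>0 complex"
    assume "r \<in> sym_relations"
    then show "r \<in> ?K"
      by cases (simp_all add: clinear_simps[OF clinear_poly_op_left] poly_op_single mono_op_add_mset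
          \<phi>_add \<phi>_scale scaleC_one)
  qed
  moreover have "module.subspace (*) ?K"
    by (auto simp: module.subspace_def[OF module_mult] clinear_simps[OF clinear_poly_op_left]
        poly_op_times clinear_simps[OF clinear_poly_op])
  ultimately have "ideal_generated sym_relations \<subseteq> ?K"
    by (rule ideal_minimal)
  then show "r \<in> ideal_generated sym_relations \<Longrightarrow> poly_op r t = 0" by blast
qed

definition sym_op :: "'x symalg \<Rightarrow> 'e \<Rightarrow> 'e"
  where "sym_op p = poly_op (rep_symalg p)"

lemma sym_op_abs: "sym_op (abs_symalg p) t = poly_op p t"
proof -
  have "rep_symalg (abs_symalg p) - p \<in> ideal_generated sym_relations"
    by (rule Quotient_rep_abs[OF Quotient_symalg, simplified]) (simp add: ideal_zero)
  from poly_op_ideal[OF this] show ?thesis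
    by (simp add: sym_op_def clinear_simps[OF clinear_poly_op_left])
qed

lemma clinear_sym_op: "clinear (sym_op p)"
  unfolding sym_op_def by (rule clinear_poly_op)

lemma sym_op_add: "sym_op (p + q) t = sym_op p t + sym_op q t"
  by (induction p rule: symalg.abs_induct, induction q rule: symalg.abs_induct)
    (simp add: plus_symalg.abs_eq sym_op_abs clinear_simps[OF clinear_poly_op_left])

lemma sym_op_scaleC: "sym_op (c *\<^sub>C p) t = c *\<^sub>C sym_op p t"
  by (induction p rule: symalg.abs_induct)
    (simp add: scaleC_symalg.abs_eq sym_op_abs clinear_simps[OF clinear_poly_op_left])

lemma sym_op_times: "sym_op (p * q) t = sym_op p (sym_op q t)"
  by (induction p rule: symalg.abs_induct, induction q rule: symalg.abs_induct)
    (simp add: times_symalg.abs_eq sym_op_abs poly_op_times)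

lemma sym_op_one [simp]: "sym_op 1 t = t"
  unfolding one_symalg.abs_eq sym_op_abs by (simp add: poly_op_single scaleC_one flip: single_one)

lemma sym_op_sym_of: "sym_op (sym_of x) t = \<phi> x t"
  unfolding sym_of.abs_eq sym_op_abs by (simp add: poly_op_single mono_op_add_mset scaleC_one)

end

section \<open>Algebras with a basis theorem\<close>

text \<open>An abstract form of \<open>A(k)\<close>: multiplication is bijective and the group part
  is generated by \<open>G\<close>. Generation is stated as an induction rule, which keeps the
  geometry of roots out of this section.\<close>

locale smash_product =
  fixes W :: "'v::euclidean_space isom set" and \<iota> :: "'x::complex_vector symalg \<Rightarrow> 'a::complex_algebra_1"
    and \<kappa> :: "('v isom \<Rightarrow>\<^sub>0 complex) \<Rightarrow> 'a" and \<mu> :: "('x symalg, 'v isom \<Rightarrow>\<^sub>0 complex) ctensor \<Rightarrow> 'a"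
    and G :: "'v isom set"
  assumes zero_in: "0 \<in> W" and plus_in: "g \<in> W \<Longrightarrow> h \<in> W \<Longrightarrow> g + h \<in> W" and G_subset: "G \<subseteq> W"
    and generated: "w \<in> W \<Longrightarrow> P 0 \<Longrightarrow> (\<And>g w. g \<in> G \<Longrightarrow> w \<in> W \<Longrightarrow> P w \<Longrightarrow> P (g + w)) \<Longrightarrow> P w"
    and \<iota>: "algebra_hom_on UNIV \<iota>" and \<kappa>: "algebra_hom_on (group_algebra W) \<kappa>"
    and \<mu>: "clinear \<mu>" "\<And>p g. g \<in> group_algebra W \<Longrightarrow> \<mu> (p \<otimes>\<^sub>C g) = \<iota> p * \<kappa> g"
    and bij: "bij_betw \<mu> (subspace_tensor UNIV (group_algebra W)) UNIV"
begin

lemma group_elt_in: "w \<in> W \<Longrightarrow> group_elt w \<in> group_algebra W"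
  by (simp add: group_algebra_def)

lemma group_algebra_closed:
  "0 \<in> group_algebra W" "g \<in> group_algebra W \<Longrightarrow> h \<in> group_algebra W \<Longrightarrow> g + h \<in> group_algebra W"
  "g \<in> group_algebra W \<Longrightarrow> c *\<^sub>C g \<in> group_algebra W"
  using Poly_Mapping.keys_add[of g h]
  by (auto simp: group_algebra_def in_keys_iff scaleC_poly_mapping.rep_eq)

lemma \<iota>_simps: "\<iota> 1 = 1" "\<iota> (p + q) = \<iota> p + \<iota> q" "\<iota> (p * q) = \<iota> p * \<iota> q" "\<iota> (c *\<^sub>C p) = c *\<^sub>C \<iota> p"
  using \<iota> by (auto simp: algebra_hom_on_def)

lemma \<kappa>_plus: "g \<in> group_algebra W \<Longrightarrow> h \<in> group_algebra W \<Longrightarrow> \<kappa> (g + h) = \<kappa> g + \<kappa> h"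
  and \<kappa>_scale: "g \<in> group_algebra W \<Longrightarrow> \<kappa> (c *\<^sub>C g) = c *\<^sub>C \<kappa> g"
  using \<kappa> by (auto simp: algebra_hom_on_def)

lemma \<kappa>_one: "\<kappa> 1 = 1"
  using \<kappa> by (simp add: algebra_hom_on_def)

lemma \<kappa>_group_elt_plus:
  assumes "g \<in> W" "h \<in> W"
  shows "\<kappa> (group_elt (g + h)) = \<kappa> (group_elt g) * \<kappa> (group_elt h)"
proof -
  have "\<kappa> (group_elt g * group_elt h) = \<kappa> (group_elt g) * \<kappa> (group_elt h)"
    using \<kappa> group_elt_in[OF assms(1)] group_elt_in[OF assms(2)] unfolding algebra_hom_on_def by blast
  then show ?thesis by (simp add: mult_single)
qed

lemma A_induct [case_names add scaleC basis]:
  assumes add: "\<And>x y. P x \<Longrightarrow> P y \<Longrightarrow> P (x + y)" and scale: "\<And>c x. P x \<Longrightarrow> P (c *\<^sub>C x)"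
    and basis: "\<And>p w. w \<in> W \<Longrightarrow> P (\<iota> p * \<kappa> (group_elt w))"
  shows "P x"
proof -
  have P0: "P 0"
    using scale[OF basis[OF zero_in], of 0] by simp
  have single: "P (\<iota> p * \<kappa> g)" if "g \<in> group_algebra W" for p g
    using that
  \<comment> \<open>Adding one new key at a time keeps the support inside \<open>W\<close>; an
    induction over arbitrary sums would not.\<close>
  proof (induction g rule: Poly_Mapping.update_induct)
    case const
    have "\<kappa> (0 *\<^sub>C group_elt 0) = 0 *\<^sub>C \<kappa> (group_elt 0)"
      by (rule \<kappa>_scale[OF group_elt_in[OF zero_in]])
    then show ?case using P0 by simp
  next
    case (update g w c)
    then have eq: "Poly_Mapping.update w c g = g + c *\<^sub>C group_elt w"
      by (subst single_eq_scaleC[symmetric], intro poly_mapping_eqI)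
        (auto simp: lookup_update lookup_add lookup_single in_keys_iff)
    have keys: "Poly_Mapping.keys (Poly_Mapping.update w c g) = insert w (Poly_Mapping.keys g)"
      using update by (auto simp: in_keys_iff lookup_update split: if_splits)
    then have w: "w \<in> W" and g: "g \<in> group_algebra W"
      using update.prems by (auto simp: group_algebra_def)
    then show ?case
      unfolding eq using update.IH basis[OF w, of p]
      by (simp add: \<kappa>_plus \<kappa>_scale group_algebra_closed group_elt_in distrib_left mult_scaleC_right add scale)
  qed
  obtain t where t: "t \<in> subspace_tensor UNIV (group_algebra W)" "x = \<mu> t"
    using bij by (auto simp: bij_betw_def)
  have "P (\<mu> t)"
    using t(1) unfolding subspace_tensor_def
  proof (induction rule: complex_vector.span_induct_alt)
    case base
    then show ?case using P0 by (simp add: clinear_simps[OF \<mu>(1)])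
  next
    case (step c s t)
    then show ?case using single by (auto simp: clinear_simps[OF \<mu>(1)] \<mu>(2) add scale)
  qed
  then show ?thesis using t by simp
qed

lemma hom_unique:
  assumes Q: "algebra_hom_End Q" and Q': "algebra_hom_End Q'"
    and sym: "\<And>v. Q (\<iota> (sym_of v)) = Q' (\<iota> (sym_of v))"
    and gen: "\<And>g. g \<in> G \<Longrightarrow> Q (\<kappa> (group_elt g)) = Q' (\<kappa> (group_elt g))"
  shows "Q = Q'"
proof
  note Qs = Q[unfolded algebra_hom_End_def] Q'[unfolded algebra_hom_End_def]
  have 1: "Q (\<iota> p) = Q' (\<iota> p)" for p
    by (induction p rule: symalg_induct) (use Qs sym in \<open>simp_all add: \<iota>_simps\<close>)
  have 2: "Q (\<kappa> (group_elt w)) = Q' (\<kappa> (group_elt w))" if "w \<in> W" for w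
  proof (rule generated[OF that])
    show "Q (\<kappa> (group_elt (g + w))) = Q' (\<kappa> (group_elt (g + w)))"
      if "g \<in> G" "w \<in> W" "Q (\<kappa> (group_elt w)) = Q' (\<kappa> (group_elt w))" for g w
      using that G_subset gen[OF that(1)] Qs by (simp add: \<kappa>_group_elt_plus subset_iff)
  qed (use Qs in \<open>simp add: \<kappa>_one\<close>)
  show "Q x = Q' x" for x
    by (induction x rule: A_induct) (use Qs 1 2 in simp_all)
qed

text \<open>The product of \<open>p\<close> and \<open>w\<close> has to act as \<open>T w\<close>
  followed by \<open>sym_op p\<close>, and bijectivity of \<mu> turns this into a definition. In
  \<open>rel\<close> the same \<open>v'\<close> and \<open>c\<close> serve the algebra and the
  operators, so a generator crosses a vector in the same way on both sides.\<close>

theorem ex_extension: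
  fixes T :: "'v isom \<Rightarrow> 'e::complex_vector \<Rightarrow> 'e" and \<phi> :: "'x \<Rightarrow> 'e \<Rightarrow> 'e"
  assumes \<phi>: "commuting_operators \<phi>"
    and T_lin: "\<And>w. w \<in> W \<Longrightarrow> clinear (T w)"
    and T_0: "T 0 = id" and T_plus: "\<And>g h. g \<in> W \<Longrightarrow> h \<in> W \<Longrightarrow> T (g + h) = T g \<circ> T h"
    and rel: "\<And>g v. g \<in> G \<Longrightarrow> \<exists>v' c.
      \<kappa> (group_elt g) * \<iota> (sym_of v) = \<iota> (sym_of v') * \<kappa> (group_elt g) + c *\<^sub>C 1 \<and>
      (\<forall>t. T g (\<phi> v t) = \<phi> v' (T g t) + c *\<^sub>C t)"
  shows "\<exists>Q. algebra_hom_End Q \<and> (\<forall>v. Q (\<iota> (sym_of v)) = \<phi> v) \<and> (\<forall>w\<in>W. Q (\<kappa> (group_elt w)) = T w)"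
proof -
  interpret \<phi>: commuting_operators \<phi> by (rule \<phi>)
  define T' where "T' w = (if w \<in> W then T w else id)" for w
  have T': "T' w = T w" if "w \<in> W" for w using that by (simp add: T'_def)
  have T'_lin: "clinear (T' w)" for w by (auto simp: T'_def T_lin clinear_id)
  define B where "B t p g = \<phi>.sym_op p (lin_ext (\<lambda>w. T' w t) g)" for t p g
  have B1: "clinear (\<lambda>p. B t p g)" for t g
    by (rule clinearI) (simp_all add: B_def \<phi>.sym_op_add \<phi>.sym_op_scaleC)
  have B2: "clinear (B t p)" for t p
    unfolding B_def by (rule clinear_compose[OF \<phi>.clinear_sym_op clinear_lin_ext])
  note lift = tensor_lift[where B = "B t" for t, OF B1 B2]
  let ?V = "subspace_tensor UNIV (group_algebra W) :: ('x symalg, 'v isom \<Rightarrow>\<^sub>0 complex) ctensor set"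
  \<comment> \<open>\<mu> is known to be injective on this subspace; the inverse is linear because
    the subspace is closed under sums and multiples.\<close>
  define \<nu> where "\<nu> = inv_into ?V \<mu>"
  have inj: "inj_on \<mu> ?V" and img: "\<mu> ` ?V = UNIV" using bij by (auto simp: bij_betw_def)
  have \<nu>_in: "\<nu> x \<in> ?V" and \<mu>_\<nu>: "\<mu> (\<nu> x) = x" for x
    unfolding \<nu>_def using img by (auto intro: inv_into_into f_inv_into_f)
  have \<nu>_eq: "\<nu> x = s" if "s \<in> ?V" "\<mu> s = x" for x s
    unfolding \<nu>_def using that inj by (auto intro: inv_into_f_eq)
  have \<nu>_add: "\<nu> (x + y) = \<nu> x + \<nu> y" for x y
    by (rule \<nu>_eq)
      (use \<nu>_in \<mu>_\<nu> in \<open>auto simp: subspace_tensor_def clinear_simps[OF \<mu>(1)] intro: complex_vector.span_add\<close>)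
  have \<nu>_scale: "\<nu> (c *\<^sub>C x) = c *\<^sub>C \<nu> x" for c x
    by (rule \<nu>_eq)
      (use \<nu>_in \<mu>_\<nu> in \<open>auto simp: subspace_tensor_def clinear_simps[OF \<mu>(1)] intro: complex_vector.span_scale\<close>)
  define Q where "Q x t = tensor_lift (B t) (\<nu> x)" for x t
  have Q_add: "Q (x + y) t = Q x t + Q y t" and Q_scale: "Q (c *\<^sub>C x) t = c *\<^sub>C Q x t" for x y t c
    by (simp_all add: Q_def \<nu>_add \<nu>_scale clinear_simps[OF lift(1)])
  have Q_basis: "Q (\<iota> p * \<kappa> (group_elt w)) t = \<phi>.sym_op p (T w t)" if w: "w \<in> W" for p w t
  proof -
    have "\<nu> (\<iota> p * \<kappa> (group_elt w)) = p \<otimes>\<^sub>C group_elt w"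
      using group_elt_in[OF w] by (intro \<nu>_eq) (auto simp: \<mu>(2) subspace_tensor_def intro!: complex_vector.span_base)
    then show ?thesis
      by (simp add: Q_def lift(2) B_def lin_ext_single scaleC_one T' w)
  qed
  have Q_\<kappa>: "Q (\<kappa> (group_elt w)) t = T w t" if "w \<in> W" for w t
    using Q_basis[OF that, of 1 t] by (simp add: \<iota>_simps)
  have Q_lin: "clinear (Q x)" for x
  proof (induction x rule: A_induct)
    case (add x y)
    then show ?case by (intro clinearI) (simp_all add: Q_add clinear_simps algebra_simps scaleC_add_right)
  next
    case (scaleC c x)
    then show ?case
      by (intro clinearI) (simp_all add: Q_scale clinear_simps scaleC_add_right complex_vector.scale_left_commute)
  next
    case (basis p w)
    have "Q (\<iota> p * \<kappa> (group_elt w)) = (\<lambda>t. \<phi>.sym_op p (T w t))"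
      by (rule ext) (rule Q_basis[OF basis])
    then show ?case
      using clinear_compose[OF \<phi>.clinear_sym_op T_lin[OF basis]] by simp
  qed
  have Q_\<iota>: "Q (\<iota> p * y) t = \<phi>.sym_op p (Q y t)" for p y t
    by (induction y rule: A_induct)
      (simp_all add: distrib_left mult_scaleC_right Q_add Q_scale Q_basis clinear_simps[OF \<phi>.clinear_sym_op]
        \<phi>.sym_op_times flip: mult.assoc \<iota>_simps)
  \<comment> \<open>The relations enter only here, by induction on the polynomial that the generator
    has to cross.\<close>
  have Q_G: "Q (\<kappa> (group_elt g) * y) t = T g (Q y t)" if g: "g \<in> G" for g y t
  proof (induction y rule: A_induct)
    case (basis p h)
    have gW: "g \<in> W" using g G_subset by blast
    note Tg = clinear_simps[OF T_lin[OF gW]]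
    have "Q (\<kappa> (group_elt g) * (\<iota> p * \<kappa> (group_elt h))) t = T g (\<phi>.sym_op p (T h t))"
    proof (induction p rule: symalg_induct)
      case one
      have "Q (\<iota> 1 * \<kappa> (group_elt (g + h))) t = T (g + h) t"
        by (subst Q_basis) (simp_all add: plus_in gW basis)
      then show ?case
        by (simp add: \<iota>_simps \<kappa>_group_elt_plus gW basis T_plus)
    next
      case (mult v q)
      obtain v' c where A: "\<kappa> (group_elt g) * \<iota> (sym_of v) = \<iota> (sym_of v') * \<kappa> (group_elt g) + c *\<^sub>C 1"
        and E: "\<And>t. T g (\<phi> v t) = \<phi> v' (T g t) + c *\<^sub>C t"
        using rel[OF g] by blast
      let ?y = "\<iota> q * \<kappa> (group_elt h)"
      have "\<kappa> (group_elt g) * (\<iota> (sym_of v * q) * \<kappa> (group_elt h)) = (\<kappa> (group_elt g) * \<iota> (sym_of v)) * ?y"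
        by (simp add: \<iota>_simps mult.assoc)
      also have "\<dots> = \<iota> (sym_of v') * (\<kappa> (group_elt g) * ?y) + c *\<^sub>C ?y"
        unfolding A by (simp add: distrib_right mult.assoc mult_scaleC_left)
      finally show ?case
        by (simp add: Q_add Q_scale Q_\<iota> mult Q_\<kappa> basis \<phi>.sym_op_sym_of \<phi>.sym_op_times E)
    next
      case (add p q)
      then show ?case by (simp add: \<iota>_simps distrib_left distrib_right Q_add \<phi>.sym_op_add Tg)
    next
      case (scaleC c p)
      then show ?case by (simp add: \<iota>_simps mult_scaleC_left mult_scaleC_right Q_scale \<phi>.sym_op_scaleC Tg)
    qed
    then show ?case by (simp add: Q_basis basis)
  next
    case (add x y)
    then show ?case
      using clinear_simps(1)[OF T_lin] g G_subset by (simp add: distrib_left Q_add subset_iff)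
  next
    case (scaleC c x)
    then show ?case
      using clinear_simps(2)[OF T_lin] g G_subset by (simp add: mult_scaleC_right Q_scale subset_iff)
  qed
  have Q_W: "\<forall>y t. Q (\<kappa> (group_elt w) * y) t = T w (Q y t)" if "w \<in> W" for w
  proof (rule generated[OF that])
    show "\<forall>y t. Q (\<kappa> (group_elt 0) * y) t = T 0 (Q y t)"
      by (simp add: \<kappa>_one T_0)
    fix g w assume "g \<in> G" "w \<in> W" "\<forall>y t. Q (\<kappa> (group_elt w) * y) t = T w (Q y t)"
    then show "\<forall>y t. Q (\<kappa> (group_elt (g + w)) * y) t = T (g + w) (Q y t)"
      using G_subset by (simp add: \<kappa>_group_elt_plus subset_iff mult.assoc Q_G T_plus)
  qed
  have Q_times: "Q (x * y) t = Q x (Q y t)" for x y t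
    by (induction x rule: A_induct)
      (simp_all add: distrib_right mult_scaleC_left Q_add Q_scale Q_basis mult.assoc Q_\<iota> Q_W Q_\<kappa>)
  have Q_one: "Q 1 t = t" for t
    using Q_basis[OF zero_in, of 1 t] by (simp add: \<iota>_simps \<kappa>_one T_0)
  have "Q (\<iota> (sym_of v)) t = \<phi> v t" for v t
    using Q_\<iota>[of "sym_of v" 1 t] by (simp add: Q_one \<phi>.sym_op_sym_of)
  moreover have "algebra_hom_End Q"
    unfolding algebra_hom_End_def using Q_lin Q_one Q_add Q_scale Q_times by (auto simp: fun_eq_iff)
  ultimately show ?thesis using Q_\<kappa> by (intro exI[of _ Q]) (auto simp: fun_eq_iff)
qed

end

section \<open>The representation by integral-reflection operators\<close>

text \<open>Over a basis of \<open>M\<close> only finitely many coefficient functions occur. By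
  independence the derivatives of each one vanish at \<open>x\<close>, and
  \<open>canalytic_identity\<close> applies to it.\<close>

lemma tensor_identity:
  fixes t :: "('v::euclidean_space canalytic, 'm::complex_vector) ctensor"
  assumes ev: "\<And>f m. ev (f \<otimes>\<^sub>C m) = capply f x *\<^sub>C m" "clinear ev"
    and zero: "\<And>w n. ev ((tensor_map (directional_deriv w) id ^^ n) t) = (0 :: 'm)"
  shows "t = 0"
proof -
  obtain B :: "'m set" where indep: "complex_vector.independent B" and "UNIV \<subseteq> cspan B"
    using complex_vector.maximal_independent_subset[of UNIV] by auto
  then have "cspan B = UNIV" by blast
  from ctensor_basis_expansion[OF this]
  obtain S f where S: "finite S" "S \<subseteq> B" and t: "t = (\<Sum>b\<in>S. f b \<otimes>\<^sub>C b)"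
    by blast
  have pow: "(tensor_map (directional_deriv w) id ^^ n) t = (\<Sum>b\<in>S. (directional_deriv w ^^ n) (f b) \<otimes>\<^sub>C b)" for w n
  proof -
    define E :: "('v canalytic, 'm) ctensor \<Rightarrow> ('v canalytic, 'm) ctensor"
      where "E = tensor_map (directional_deriv w) id"
    have E: "clinear E" "\<And>f m. E (f \<otimes>\<^sub>C m) = directional_deriv w f \<otimes>\<^sub>C m"
      unfolding E_def using tensor_map[OF clinear_directional_deriv clinear_id(2)] by simp_all
    have "(E ^^ n) t = (\<Sum>b\<in>S. (directional_deriv w ^^ n) (f b) \<otimes>\<^sub>C b)"
      by (induction n) (simp_all add: t clinear_simps[OF E(1)] E(2))
    then show ?thesis by (simp only: E_def)
  qed
  have "f b = 0" if b: "b \<in> S" for b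
  proof (rule canalytic_identity)
    fix w n
    have "(\<Sum>b\<in>S. capply ((directional_deriv w ^^ n) (f b)) x *\<^sub>C b) = 0"
      using zero[of n w] unfolding pow by (simp add: clinear_simps[OF ev(2)] ev(1))
    from complex_vector.independentD[OF indep S this b]
    show "capply ((directional_deriv w ^^ n) (f b)) x = 0" .
  qed
  then show ?thesis by (simp add: t tensor_zero)
qed

lemma linear_part_plus: "linear_part (g + h) v = linear_part g (linear_part h v)"
  using iapply_add[of g "iapply h 0" "linear_part h v"] iapply_add[of h 0 v]
  by (simp add: linear_part_def)

section \<open>The operators on the tensor product and their relations\<close>

locale integral_representation = affine_root_datum R X F \<theta>
  for R X F :: "'v::euclidean_space dual set" and \<theta> :: "'v dual" +
  fixes k :: "('v \<Rightarrow> real) \<Rightarrow> complex" and \<rho> :: "'v isom \<Rightarrow> 'm::complex_vector \<Rightarrow> 'm"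
  assumes multiplicity: "multiplicity_function R X k"
    and module: "group_module (ext_affine_weyl_group R X) \<rho>"
begin

lemma k_isom_act: "w \<in> W \<Longrightarrow> a \<in> \<Phi> \<Longrightarrow> k (isom_act w a) = k a"
  using multiplicity by (simp add: multiplicity_function_def)

lemma clinear_\<rho>: "g \<in> W \<Longrightarrow> clinear (\<rho> g)"
  and \<rho>_0: "\<rho> 0 = id" and \<rho>_plus: "g \<in> W \<Longrightarrow> h \<in> W \<Longrightarrow> \<rho> (g + h) = \<rho> g \<circ> \<rho> h"
  using module by (simp_all add: group_module_def)

definition ev :: "'v \<Rightarrow> ('v canalytic, 'm) ctensor \<Rightarrow> 'm"
  where "ev x = tensor_lift (\<lambda>f m. capply f x *\<^sub>C m)"

definition D :: "'v \<Rightarrow> ('v canalytic, 'm) ctensor \<Rightarrow> ('v canalytic, 'm) ctensor"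
  where "D v = tensor_map (directional_deriv v) id"

definition U :: "'v isom \<Rightarrow> ('v canalytic, 'm) ctensor \<Rightarrow> ('v canalytic, 'm) ctensor"
  where "U g = tensor_map (canalytic_act g) (\<rho> g)"

definition J :: "('v \<Rightarrow> real) \<Rightarrow> ('v canalytic, 'm) ctensor \<Rightarrow> ('v canalytic, 'm) ctensor"
  where "J a = tensor_map (integral_op a) id"

definition S :: "('v \<Rightarrow> real) \<Rightarrow> ('v canalytic, 'm) ctensor \<Rightarrow> ('v canalytic, 'm) ctensor"
  where "S a t = U (affine_reflection a) t - k a *\<^sub>C J a t"

lemma clinear_ev: "clinear (ev x)" and ev_tensor: "ev x (f \<otimes>\<^sub>C m) = capply f x *\<^sub>C m"
  unfolding ev_def by (rule tensor_lift; auto intro!: clinearI simp: scaleC_add_left scaleC_add_right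
    scaleC_scaleC complex_vector.scale_left_commute)+

lemma clinear_D: "clinear (D v)" and D_tensor: "D v (f \<otimes>\<^sub>C m) = directional_deriv v f \<otimes>\<^sub>C m"
  unfolding D_def using tensor_map[OF clinear_directional_deriv clinear_id(2)] by simp_all

lemma clinear_U: "g \<in> W \<Longrightarrow> clinear (U g)"
  and U_tensor: "g \<in> W \<Longrightarrow> U g (f \<otimes>\<^sub>C m) = canalytic_act g f \<otimes>\<^sub>C \<rho> g m"
  unfolding U_def using tensor_map[OF clinear_canalytic_act clinear_\<rho>] by blast+

lemma clinear_integral_op_root: "a \<in> \<Phi> \<Longrightarrow> clinear (integral_op a)"
  using clinear_integral_op by (blast elim: \<Phi>_cases)

lemma clinear_J: "a \<in> \<Phi> \<Longrightarrow> clinear (J a)"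
  and J_tensor: "a \<in> \<Phi> \<Longrightarrow> J a (f \<otimes>\<^sub>C m) = integral_op a f \<otimes>\<^sub>C m"
  unfolding J_def using tensor_map[OF clinear_integral_op_root clinear_id(2)] by simp_all

lemma clinear_S: "a \<in> \<Phi> \<Longrightarrow> clinear (S a)"
  unfolding S_def[abs_def] by (intro clinear_diff_scale clinear_U clinear_J W_reflection)

lemma S_tensor: "a \<in> \<Phi> \<Longrightarrow> S a (f \<otimes>\<^sub>C m) =
    canalytic_act (affine_reflection a) f \<otimes>\<^sub>C \<rho> (affine_reflection a) m - k a *\<^sub>C (integral_op a f \<otimes>\<^sub>C m)"
  by (simp add: S_def U_tensor J_tensor W_reflection)

lemma U_plus: "g \<in> W \<Longrightarrow> h \<in> W \<Longrightarrow> U (g + h) t = U g (U h t)"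
  by (rule ctensor_ext[OF clinear_U clinear_compose[OF clinear_U clinear_U]])
    (simp_all add: U_tensor W_plus canalytic_act_plus \<rho>_plus)

lemma U_0: "U 0 t = t"
  by (rule ctensor_ext[OF clinear_U clinear_id(1)]) (simp_all add: U_tensor W_0 \<rho>_0)

lemma ev_U: "g \<in> W \<Longrightarrow> ev x (U g t) = \<rho> g (ev (iapply (- g) x) t)"
  by (rule ctensor_ext[OF clinear_compose[OF clinear_ev clinear_U] clinear_compose[OF clinear_\<rho> clinear_ev]])
    (simp_all add: U_tensor ev_tensor capply_canalytic_act clinear_simps[OF clinear_\<rho>])

lemma U_D: "g \<in> W \<Longrightarrow> U g (D v t) = D (linear_part g v) (U g t)"
  by (rule ctensor_ext[OF clinear_compose[OF clinear_U clinear_D] clinear_compose[OF clinear_D clinear_U]])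
    (simp_all add: U_tensor D_tensor canalytic_act_directional_deriv)

lemma D_commute: "D u (D v t) = D v (D u t)"
  by (rule ctensor_ext[OF clinear_compose[OF clinear_D clinear_D] clinear_compose[OF clinear_D clinear_D]])
    (simp add: D_tensor directional_deriv_commute)

lemma D_add: "D (u + v) t = D u t + D v t"
  by (rule ctensor_ext) (auto intro!: clinearI simp: clinear_simps[OF clinear_D] D_tensor
    directional_deriv_add_left tensor_bilinear scaleC_add_right)

lemma D_scaleR: "D (c *\<^sub>R v) t = complex_of_real c *\<^sub>C D v t"
  by (rule ctensor_ext) (auto intro!: clinearI simp: clinear_simps[OF clinear_D] D_tensor
    directional_deriv_scaleR tensor_bilinear scaleC_add_right complex_vector.scale_left_commute)

text \<open>The mixed terms cancel: on one side of the integral operator the reflection is absorbed,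
  on the other it becomes a sign. The square of the integral operator is zero.\<close>

lemma S_S:
  assumes a: "a \<in> \<Phi>"
  shows "S a (S a t) = t"
proof (rule ctensor_ext[OF clinear_compose[OF clinear_S[OF a] clinear_S[OF a]] clinear_id(1)])
  fix f :: "'v canalytic" and m :: 'm
  obtain \<alpha> i where \<alpha>: "a = affine_fun \<alpha> i" "\<alpha> \<noteq> 0" using a by (blast elim: \<Phi>_cases)
  have \<rho>: "\<rho> (affine_reflection a) (\<rho> (affine_reflection a) m) = m"
    using \<rho>_plus[OF W_reflection[OF a] W_reflection[OF a]] \<rho>_0 reflection_self_inverse(1)[OF a]
    by (metis comp_apply id_apply)
  show "S a (S a (f \<otimes>\<^sub>C m)) = f \<otimes>\<^sub>C m"
    unfolding S_tensor[OF a] clinear_simps[OF clinear_S[OF a]] \<rho>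
    by (simp add: \<alpha> canalytic_act_reflection_self reflection_integral_op integral_op_reflection
        integral_op_integral_op tensor_zero tensor_minus)
qed

lemma U_S:
  assumes w: "w \<in> W" and a: "a \<in> \<Phi>"
  shows "U w (S a t) = S (isom_act w a) (U w t)"
proof (rule ctensor_ext[OF clinear_compose[OF clinear_U[OF w] clinear_S[OF a]]
    clinear_compose[OF clinear_S[OF isom_act_root[OF w a]] clinear_U[OF w]]])
  fix f :: "'v canalytic" and m :: 'm
  obtain \<alpha> i where \<alpha>: "a = affine_fun \<alpha> i" "\<alpha> \<noteq> 0" using a by (blast elim: \<Phi>_cases)
  obtain \<beta> j where \<beta>: "isom_act w a = affine_fun \<beta> j" using isom_act_root[OF w a] by (blast elim: \<Phi>_cases)
  let ?s = "affine_reflection a" and ?s' = "affine_reflection (isom_act w a)"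
  have s: "?s' + w = w + ?s"
    by (simp add: reflection_isom_act[OF a w] add.assoc del: add_uminus_conv_diff)
  have 1: "canalytic_act w (canalytic_act ?s f) = canalytic_act ?s' (canalytic_act w f)"
    by (simp add: s flip: canalytic_act_plus)
  have 2: "\<rho> w (\<rho> ?s m) = \<rho> ?s' (\<rho> w m)"
    using \<rho>_plus[OF w W_reflection[OF a]] \<rho>_plus[OF W_reflection[OF isom_act_root[OF w a]] w] s
    by (metis comp_apply)
  have 3: "canalytic_act w (integral_op a f) = integral_op (isom_act w a) (canalytic_act w f)"
    unfolding \<beta> unfolding \<alpha>(1) by (rule canalytic_act_integral_op[OF \<alpha>(2)]) (use \<alpha>(1) \<beta> in simp)
  show "U w (S a (f \<otimes>\<^sub>C m)) = S (isom_act w a) (U w (f \<otimes>\<^sub>C m))"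
    by (simp add: S_tensor a isom_act_root w U_tensor clinear_simps[OF clinear_U[OF w]] 1 2 3 k_isom_act)
qed

lemma S_D:
  assumes a: "a \<in> \<Phi>"
  shows "S a (D v t) = D (linear_part (affine_reflection a) v) (S a t)
    - (k a * complex_of_real (blinfun_apply (gradient a) v)) *\<^sub>C t"
proof (rule ctensor_ext[OF clinear_compose[OF clinear_S[OF a] clinear_D]
    clinear_diff_scale[OF clinear_compose[OF clinear_D clinear_S[OF a]] clinear_id(1)]])
  fix f :: "'v canalytic" and m :: 'm
  obtain \<alpha> i where \<alpha>: "a = affine_fun \<alpha> i" "\<alpha> \<noteq> 0" using a by (blast elim: \<Phi>_cases)
  let ?v = "linear_part (affine_reflection a) v"
  have 1: "integral_op a (directional_deriv v f) = directional_deriv ?v (integral_op a f)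
      + complex_of_real (blinfun_apply (gradient a) v) *\<^sub>C f"
    using integral_op_directional_deriv[OF \<alpha>(2), of i v f] by (simp add: \<alpha>(1))
  show "S a (D v (f \<otimes>\<^sub>C m)) = D ?v (S a (f \<otimes>\<^sub>C m))
      - (k a * complex_of_real (blinfun_apply (gradient a) v)) *\<^sub>C (f \<otimes>\<^sub>C m)"
    by (simp add: S_tensor a D_tensor clinear_simps[OF clinear_D] canalytic_act_directional_deriv 1
        tensor_bilinear scaleC_add_right scaleC_scaleC)
qed

text \<open>At a zero of \<open>a\<close> the integral term vanishes and the reflection fixes the
  point, so only the action on \<open>M\<close> is left.\<close>

lemma ev_S:
  assumes a: "a \<in> \<Phi>" and x: "a x = 0"
  shows "ev x (S a t) = \<rho> (affine_reflection a) (ev x t)"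
proof (rule ctensor_ext[OF clinear_compose[OF clinear_ev clinear_S[OF a]]
    clinear_compose[OF clinear_\<rho>[OF W_reflection[OF a]] clinear_ev]])
  fix f :: "'v canalytic" and m :: 'm
  obtain \<alpha> i where \<alpha>: "a = affine_fun \<alpha> i" "\<alpha> \<noteq> 0" using a by (blast elim: \<Phi>_cases)
  have "iapply (affine_reflection a) x = x"
    using x by (simp add: \<alpha>(1) iapply_reflection[OF \<alpha>(2)])
  moreover have "capply (integral_op a f) x = 0"
    using x by (simp add: \<alpha> capply_integral_op_zero)
  ultimately show "ev x (S a (f \<otimes>\<^sub>C m)) = \<rho> (affine_reflection a) (ev x (f \<otimes>\<^sub>C m))"
    by (simp add: S_tensor a clinear_simps[OF clinear_ev] ev_tensor capply_canalytic_act
        reflection_self_inverse clinear_simps[OF clinear_\<rho>[OF W_reflection[OF a]]])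
qed

text \<open>Every direction is the image of another under the linear part of \<open>g\<close>. So
  each iterated derivative of \<open>B t\<close> is again a value of \<open>B\<close> and vanishes
  at \<open>x\<close>.\<close>

lemma intertwiner_zero:
  assumes B: "clinear B" and BD: "\<And>v t. B (D v t) = D (linear_part g v) (B t)" and ev0: "\<And>t. ev x (B t) = 0"
  shows "B t = 0"
proof (rule tensor_identity[of "ev x", OF ev_tensor clinear_ev])
  fix w n
  obtain v where v: "linear_part g v = w"
    using orthogonal_transformation_surj[OF orthogonal_linear_part[of g]] by (metis surjD)
  have "(D w ^^ n) (B t) = B ((D v ^^ n) t)"
    by (induction n) (simp_all add: BD v)
  then show "ev x ((tensor_map (directional_deriv w) id ^^ n) (B t)) = 0"
    using ev0 by (simp flip: D_def)
qed

section \<open>Recursion on the length\<close>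

primrec Tn :: "nat \<Rightarrow> 'v isom \<Rightarrow> ('v canalytic, 'm) ctensor \<Rightarrow> ('v canalytic, 'm) ctensor"
  where "Tn 0 w = U w"
  | "Tn (Suc n) w =
      (let a = SOME a. a \<in> \<Delta> \<and> a (iapply w alcove_point) < 0 in S a \<circ> Tn n (affine_reflection a + w))"

text \<open>\<open>Tn\<close> takes an arbitrary descent; \<open>T_descent\<close> shows that any
  other gives the same operator. The counter starts at the length, which each descent lowers by
  exactly one, so the recursion stops at an element of length zero.\<close>

definition T where "T w = Tn (len w) w"

definition lower_terms :: "'v isom \<Rightarrow> 'v \<Rightarrow> ('v canalytic, 'm) ctensor \<Rightarrow> ('v canalytic, 'm) ctensor"
  where "lower_terms w v t = (\<Sum>c\<in>inversions w.
    (k c * complex_of_real (blinfun_apply (gradient c) v)) *\<^sub>C T (w + affine_reflection c) t)"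

text \<open>The clauses go through one induction on the length: comparing two descents of
  \<open>w\<close> uses the commutation clause and the \<Omega> clause for shorter elements.\<close>

definition good :: "'v isom \<Rightarrow> bool"
  where "good w \<longleftrightarrow> clinear (T w) \<and>
    (\<forall>a\<in>\<Delta>. a (iapply w alcove_point) < 0 \<longrightarrow> (\<forall>t. T w t = S a (T (affine_reflection a + w) t))) \<and>
    (\<forall>\<omega>\<in>\<Omega>. \<forall>t. T (\<omega> + w) t = U \<omega> (T w t)) \<and>
    (\<forall>v t. T w (D v t) = D (linear_part w v) (T w t) - lower_terms w v t)"

lemma T_\<Omega>: "\<omega> \<in> \<Omega> \<Longrightarrow> T \<omega> = U \<omega>"
  by (simp add: T_def \<Omega>_iff)

lemma good_\<Omega>: "w \<in> \<Omega> \<Longrightarrow> good w"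
proof -
  assume w: "w \<in> \<Omega>"
  then have W: "w \<in> W" and 0: "len w = 0" by (auto simp: \<Omega>_iff)
  have inv: "inversions w = {}" using 0 finite_inversions by (simp add: len_eq_card_inversions W)
  have "\<omega> + w \<in> \<Omega>" if "\<omega> \<in> \<Omega>" for \<omega>
    using that W 0 len_\<Omega>_plus[OF that W] by (simp add: \<Omega>_iff W_plus)
  then have "T (\<omega> + w) t = U \<omega> (T w t)" if "\<omega> \<in> \<Omega>" for \<omega> t
    using that W by (simp add: T_\<Omega> w U_plus) (simp add: U_plus \<Omega>_iff)
  moreover have "\<not> a (iapply w alcove_point) < 0" if "a \<in> \<Delta>" for a
    using no_descent_len_0[OF W 0 that] by simp
  ultimately show ?thesis
    using W by (simp add: good_def T_\<Omega>[OF w] clinear_U lower_terms_def inv U_D)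
qed

text \<open>If \<open>a\<close> is a descent of \<open>u\<close>, combine the descent clause with
  \<open>S_S\<close>. Otherwise the descent clause is applied to \<open>s_a u\<close>, which is
  longer by one; hence the bound on \<open>len u + 1\<close>.\<close>

lemma T_reflection_less:
  assumes good: "\<And>u. u \<in> W \<Longrightarrow> len u < n \<Longrightarrow> good u" and u: "u \<in> W" "len u + 1 < n" and a: "a \<in> \<Delta>"
  shows "S a (T u t) = T (affine_reflection a + u) t"
proof (cases "a (iapply u alcove_point) < 0")
  case True
  then have "T u t = S a (T (affine_reflection a + u) t)"
    using good[OF u(1)] u(2) a by (simp add: good_def)
  then show ?thesis by (simp add: S_S simple_in_\<Phi>[OF a])
next
  case False
  then have pos: "a (iapply u alcove_point) > 0"
    using root_nonzero_W[OF simple_in_\<Phi>[OF a] u(1)] by linarith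
  let ?u = "affine_reflection a + u"
  have "good ?u"
    using len_ascent[OF u(1) a pos] u by (intro good W_plus W_simple_reflection a) auto
  moreover have "a (iapply ?u alcove_point) < 0"
    using pos by (simp add: root_reflection_self simple_in_\<Phi>[OF a])
  ultimately have "T ?u t = S a (T (affine_reflection a + ?u) t)"
    using a by (simp add: good_def)
  then show ?thesis by (simp add: reflection_self_inverse simple_in_\<Phi>[OF a])
qed

lemma gradient_apply: "c \<in> \<Phi> \<Longrightarrow> blinfun_apply (gradient c) v = c (x + v) - c x"
proof -
  assume "c \<in> \<Phi>"
  then obtain \<alpha> m where "c = affine_fun \<alpha> m" by (blast elim: \<Phi>_cases)
  then show ?thesis by (simp add: affine_fun_def[of \<alpha> m] gradient_affine_fun[unfolded affine_fun_def] blinfun.add_right)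
qed

text \<open>\<open>S a\<close> is applied to the relation for the shorter \<open>w'\<close>. Its own
  lower term supplies the inversion that \<open>w'\<close> lacks, the other terms are carried over
  by \<open>T_reflection_less\<close>, and the right-hand sum no longer depends on
  \<open>a\<close>.\<close>

lemma commutation_step:
  assumes good: "\<And>u. u \<in> W \<Longrightarrow> len u < len w \<Longrightarrow> good u" and w: "w \<in> W"
    and a: "a \<in> \<Delta>" and desc: "a (iapply w alcove_point) < 0"
  defines "w' \<equiv> affine_reflection a + w"
  shows "S a (T w' (D v t)) = D (linear_part w v) (S a (T w' t)) - lower_terms w v t"
proof -
  let ?s = "affine_reflection a" and ?c0 = "\<lambda>v. - a (iapply w v)"
  let ?coef = "\<lambda>c. k c * complex_of_real (blinfun_apply (gradient c) v)"
  have a\<Phi>: "a \<in> \<Phi>" by (rule simple_in_\<Phi>[OF a])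
  have w': "w' \<in> W" unfolding w'_def by (intro W_plus W_simple_reflection a w)
  have len: "len w = Suc (len w')" unfolding w'_def by (rule len_descent[OF w a desc])
  have sw': "?s + w' = w" by (simp add: w'_def reflection_self_inverse[OF a\<Phi>])
  note inv = inversions_descent[OF w a desc, folded w'_def]
  note Sa = clinear_simps[OF clinear_S[OF a\<Phi>]]
  have "good w'" by (rule good[OF w']) (simp add: len)
  then have "T w' (D v t) = D (linear_part w' v) (T w' t) - lower_terms w' v t"
    by (simp add: good_def)
  then have "S a (T w' (D v t)) = D (linear_part ?s (linear_part w' v)) (S a (T w' t))
      - (k a * complex_of_real (blinfun_apply (gradient a) (linear_part w' v))) *\<^sub>C T w' t - S a (lower_terms w' v t)"
    by (simp add: Sa S_D[OF a\<Phi>])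
  also have "linear_part ?s (linear_part w' v) = linear_part w v"
    by (simp add: sw' flip: linear_part_plus)
  also have "S a (lower_terms w' v t) = (\<Sum>c\<in>inversions w'. ?coef c *\<^sub>C T (w + affine_reflection c) t)"
    unfolding lower_terms_def Sa
  proof (rule sum.cong[OF refl])
    fix c assume c: "c \<in> inversions w'"
    then have "affine_reflection c \<in> W" by (auto simp: inversions_def intro: W_reflection)
    \<comment> \<open>By \<open>len_reflection_less\<close> this element is shorter than
      \<open>w'\<close>, so one further reflection still stays below the length of
      \<open>w\<close>.\<close>
    then have "S a (T (w' + affine_reflection c) t) = T (?s + (w' + affine_reflection c)) t"
      using len_reflection_less[OF w' c] len
      by (intro T_reflection_less[OF good] W_plus w' a) auto
    also have "?s + (w' + affine_reflection c) = w + affine_reflection c"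
      by (simp add: sw' flip: add.assoc)
    finally show "?coef c *\<^sub>C S a (T (w' + affine_reflection c) t) = ?coef c *\<^sub>C T (w + affine_reflection c) t"
      by simp
  qed
  also have "(k a * complex_of_real (blinfun_apply (gradient a) (linear_part w' v))) *\<^sub>C T w' t
      = ?coef ?c0 *\<^sub>C T (w + affine_reflection ?c0) t"
  proof -
    \<comment> \<open>The new inversion is \<open>a\<close> pulled back along \<open>w'\<close>;
      multiplying \<open>w\<close> on the right by its reflection gives back
      \<open>w'\<close>.\<close>
    have c0: "?c0 = isom_act (- w') a"
      by (simp add: fun_eq_iff isom_act_def w'_def root_reflection_self[OF a\<Phi>])
    have "affine_reflection ?c0 = - w' + ?s + w'"
      unfolding c0 by (subst reflection_isom_act[OF a\<Phi> W_uminus[OF w']]) simp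
    then have "w + affine_reflection ?c0 = ?s + (w' + - w') + (?s + w')"
      by (simp only: sw'[symmetric] add.assoc)
    also have "\<dots> = w'"
      by (simp add: reflection_self_inverse[OF a\<Phi>])
    finally have 1: "w + affine_reflection ?c0 = w'" .
    have c0\<Phi>: "?c0 \<in> \<Phi>" unfolding c0 by (rule isom_act_root[OF W_uminus[OF w'] a\<Phi>])
    have 2: "k ?c0 = k a"
      unfolding c0 by (rule k_isom_act[OF W_uminus[OF w'] a\<Phi>])
    have c0': "?c0 y = a (iapply w' y)" for y
      by (simp add: w'_def root_reflection_self[OF a\<Phi>])
    have 3: "blinfun_apply (gradient ?c0) v = blinfun_apply (gradient a) (linear_part w' v)"
      using gradient_apply[OF c0\<Phi>, of v 0] gradient_apply[OF a\<Phi>, of "linear_part w' v" "iapply w' 0"]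
      unfolding c0' by (simp add: iapply_add[of w' 0 v, symmetric])
    show ?thesis unfolding 1 2 3 ..
  qed
  finally show ?thesis
    using inv finite_inversions by (simp add: lower_terms_def diff_diff_eq)
qed

text \<open>The lemma says that the piecewise analytic function which equals \<open>w\<inverse> T w t\<close> on the image of
  the alcove under \<open>w\<inverse>\<close> is continuous.\<close>

lemma ev_T_stabilizer:
  assumes good: "\<And>u. u \<in> W \<Longrightarrow> len u < n \<Longrightarrow> good u"
    and x: "\<forall>a\<in>\<Delta>. a x \<ge> 0"
    and "u \<in> W" "y \<in> W" "len y < n" "len (u + y) < n" and "iapply u x = x"
  shows "ev x (T (u + y) t) = \<rho> u (ev x (T y t))"
  using assms(3-)
proof (induction "len y + len (u + y)" arbitrary: u y rule: less_induct)
  case less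
  note u = less.prems(1) and y = less.prems(2)
  have uy: "u + y \<in> W" by (rule W_plus[OF u y])
  \<comment> \<open>If \<open>y\<close> or \<open>u + y\<close> has a descent at a simple root
    vanishing at \<open>x\<close>, a reflection fixing \<open>x\<close> lowers the sum of the
    lengths. If neither has one, \<open>face_stabilizer_len_0\<close> puts \<open>u\<close> into
    \<Omega>.\<close>
  consider a where "a \<in> \<Delta>" "a x = 0" "a (iapply y alcove_point) < 0"
    | a where "a \<in> \<Delta>" "a x = 0" "a (iapply (u + y) alcove_point) < 0"
    | "\<forall>a\<in>\<Delta>. a x = 0 \<longrightarrow> a (iapply y alcove_point) > 0" "\<forall>a\<in>\<Delta>. a x = 0 \<longrightarrow> a (iapply (u + y) alcove_point) > 0"
    using root_nonzero_W[OF simple_in_\<Phi> y] root_nonzero_W[OF simple_in_\<Phi> uy] by (meson linorder_neqE_linordered_idom)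
  then show ?case
  proof cases
    case 1
    let ?s = "affine_reflection a"
    have a\<Phi>: "a \<in> \<Phi>" by (rule simple_in_\<Phi>[OF 1(1)])
    have s: "?s \<in> W" by (rule W_reflection[OF a\<Phi>])
    have sx: "iapply ?s x = x" using a\<Phi> 1(2) by (auto elim!: \<Phi>_cases simp: iapply_reflection)
    have len: "len y = Suc (len (?s + y))" by (rule len_descent[OF y 1(1,3)])
    \<comment> \<open>The reflection is moved from \<open>y\<close> into \<open>u\<close>, which
      leaves the product unchanged.\<close>
    have eq: "u + ?s + (?s + y) = u + y"
      by (simp add: add.assoc reflection_self_inverse[OF a\<Phi>])
    have "ev x (T (u + ?s + (?s + y)) t) = \<rho> (u + ?s) (ev x (T (?s + y) t))"
      by (rule less.hyps) (use less.prems len eq s in \<open>auto simp: W_plus sx\<close>)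
    moreover have "T y t = S a (T (?s + y) t)"
      using good[OF y less.prems(3)] 1 by (simp add: good_def)
    ultimately show ?thesis
      by (simp add: eq ev_S[OF a\<Phi> 1(2)] \<rho>_plus[OF u s])
  next
    case 2
    let ?s = "affine_reflection a"
    have a\<Phi>: "a \<in> \<Phi>" by (rule simple_in_\<Phi>[OF 2(1)])
    have s: "?s \<in> W" by (rule W_reflection[OF a\<Phi>])
    have sx: "iapply ?s x = x" using a\<Phi> 2(2) by (auto elim!: \<Phi>_cases simp: iapply_reflection)
    have len: "len (u + y) = Suc (len (?s + (u + y)))" by (rule len_descent[OF uy 2(1,3)])
    have "ev x (T (?s + u + y) t) = \<rho> (?s + u) (ev x (T y t))"
      by (rule less.hyps) (use less.prems len s in \<open>auto simp: W_plus sx add.assoc\<close>)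
    moreover have "T (u + y) t = S a (T (?s + (u + y)) t)"
      using good[OF uy less.prems(4)] 2 by (simp add: good_def)
    moreover have "\<rho> ?s (\<rho> (?s + u) z) = \<rho> u z" for z
      using \<rho>_plus[OF s W_plus[OF s u]] reflection_self_inverse(3)[OF a\<Phi>, of u] by (metis comp_apply)
    ultimately show ?thesis
      by (simp add: ev_S[OF a\<Phi> 2(2)] add.assoc)
  next
    case 3
    have "u \<in> \<Omega>"
      by (rule face_stabilizer_len_0[OF u y x less.prems(5) 3])
    then have "T (u + y) t = U u (T y t)"
      using good[OF y less.prems(3)] by (simp add: good_def)
    moreover have "iapply (- u) x = x"
      using less.prems(5) iapply_cancel(1)[of u x] by simp
    ultimately show ?thesis by (simp add: ev_U[OF u])
  qed
qed

lemma S_T_descents_agree: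
  assumes good: "\<And>u. u \<in> W \<Longrightarrow> len u < len w \<Longrightarrow> good u" and w: "w \<in> W"
    and a: "a \<in> \<Delta>" "a (iapply w alcove_point) < 0" and b: "b \<in> \<Delta>" "b (iapply w alcove_point) < 0"
  shows "S a (T (affine_reflection a + w) t) = S b (T (affine_reflection b + w) t)"
proof (cases "a = b")
  case False
  obtain x where x: "a x = 0" "b x = 0" "\<forall>c\<in>\<Delta>. c x \<ge> 0"
    using ex_vertex[OF a(1) b(1) False a(2) b(2)] by blast
  let ?s = "affine_reflection a" and ?r = "affine_reflection b"
  have a\<Phi>: "a \<in> \<Phi>" and b\<Phi>: "b \<in> \<Phi>" using a b simple_in_\<Phi> by auto
  have s: "?s \<in> W" and r: "?r \<in> W" using W_reflection a\<Phi> b\<Phi> by auto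
  have sx: "iapply ?s x = x" using a\<Phi> x by (auto elim!: \<Phi>_cases simp: iapply_reflection)
  have rx: "iapply ?r x = x" using b\<Phi> x by (auto elim!: \<Phi>_cases simp: iapply_reflection)
  have sw: "?s + w \<in> W" "len (?s + w) < len w" and rw: "?r + w \<in> W" "len (?r + w) < len w"
    using len_descent[OF w a] len_descent[OF w b] s r w by (auto intro: W_plus)
  have lin: "clinear (T (?s + w))" "clinear (T (?r + w))"
    using good[OF sw] good[OF rw] by (auto simp: good_def)
  \<comment> \<open>The factor 1 brings the difference into the form of
    \<open>clinear_diff_scale\<close>.\<close>
  define B where "B t = S a (T (?s + w) t) - 1 *\<^sub>C S b (T (?r + w) t)" for t
  have "B t = 0"
  proof (rule intertwiner_zero[where B = B and g = w and x = x])
    show "clinear B"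
      unfolding B_def[abs_def]
      by (intro clinear_diff_scale clinear_compose[OF clinear_S[OF a\<Phi>] lin(1)] clinear_compose[OF clinear_S[OF b\<Phi>] lin(2)])
    show "B (D v t) = D (linear_part w v) (B t)" for v t
    proof -
      have "S a (T (?s + w) (D v t)) = D (linear_part w v) (S a (T (?s + w) t)) - lower_terms w v t"
        and "S b (T (?r + w) (D v t)) = D (linear_part w v) (S b (T (?r + w) t)) - lower_terms w v t"
        by (rule commutation_step[OF good w a], assumption+, rule commutation_step[OF good w b], assumption+)
      then show ?thesis
        by (simp add: B_def clinear_simps[OF clinear_D] scaleC_one)
    qed
    fix t
    \<comment> \<open>The two shorter elements differ by \<open>?r + ?s\<close>, which fixes
      \<open>x\<close>. At \<open>x\<close> the operators \<open>S a\<close> and \<open>S b\<close>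
      act through \<rho>, and both values become the image of one vector under
      \<open>\<rho> ?s\<close>.\<close>
    have eq: "?r + w = (?r + ?s) + (?s + w)"
      by (simp add: add.assoc reflection_self_inverse[OF a\<Phi>])
    have "ev x (T ((?r + ?s) + (?s + w)) t) = \<rho> (?r + ?s) (ev x (T (?s + w) t))"
    proof (rule ev_T_stabilizer[where n = "len w", OF good x(3)])
      show "len (?r + ?s + (?s + w)) < len w" using rw(2) by (simp only: eq)
    qed (use sw r s in \<open>auto simp: W_plus sx rx\<close>)
    moreover have "\<rho> ?r (\<rho> (?r + ?s) z) = \<rho> ?s z" for z
      using \<rho>_plus[OF r W_plus[OF r s]] reflection_self_inverse(3)[OF b\<Phi>, of ?s] by (metis comp_apply)
    ultimately have "ev x (S b (T (?r + w) t)) = \<rho> ?s (ev x (T (?s + w) t))"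
      unfolding ev_S[OF b\<Phi> x(2)] by (simp only: eq[symmetric])
    then show "ev x (B t) = 0"
      by (simp add: B_def clinear_simps[OF clinear_ev] ev_S[OF a\<Phi> x(1)] scaleC_one)
  qed
  then show ?thesis by (simp add: B_def scaleC_one)
qed simp

lemma T_descent:
  assumes good: "\<And>u. u \<in> W \<Longrightarrow> len u < len w \<Longrightarrow> good u" and w: "w \<in> W"
    and a: "a \<in> \<Delta>" "a (iapply w alcove_point) < 0"
  shows "T w t = S a (T (affine_reflection a + w) t)"
proof -
  let ?b = "SOME a. a \<in> \<Delta> \<and> a (iapply w alcove_point) < 0"
  have b: "?b \<in> \<Delta>" "?b (iapply w alcove_point) < 0"
    using someI[of "\<lambda>a. a \<in> \<Delta> \<and> a (iapply w alcove_point) < 0", OF conjI[OF a]] by auto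
  have "T w t = S ?b (T (affine_reflection ?b + w) t)"
    unfolding T_def len_descent[OF w b] by (simp add: Let_def)
  also have "\<dots> = S a (T (affine_reflection a + w) t)"
    by (rule S_T_descents_agree[OF good w b a])
  finally show ?thesis .
qed

lemma good_W: "w \<in> W \<Longrightarrow> good w"
proof (induction "len w" arbitrary: w rule: less_induct)
  case less
  show ?case
  proof (cases "len w = 0")
    case True
    then show ?thesis using less.prems by (intro good_\<Omega>) (simp add: \<Omega>_iff)
  next
    case False
    note w = less.prems
    have good: "good u" if "u \<in> W" "len u < len w" for u using less.hyps that by blast
    obtain a where a: "a \<in> \<Delta>" "a (iapply w alcove_point) < 0" using ex_descent[OF w] False by blast
    have a\<Phi>: "a \<in> \<Phi>" by (rule simple_in_\<Phi>[OF a(1)])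
    let ?w' = "affine_reflection a + w"
    have w': "?w' \<in> W" "len ?w' < len w"
      using len_descent[OF w a] W_simple_reflection[OF a(1)] w by (auto intro: W_plus)
    have T: "T w = (\<lambda>t. S a (T ?w' t))"
      using T_descent[OF good w a] by blast
    have "clinear (T w)"
      unfolding T by (rule clinear_compose[OF clinear_S[OF a\<Phi>]]) (use good[OF w'] in \<open>simp add: good_def\<close>)
    \<comment> \<open>The image of \<open>a\<close> under \<omega> is a simple descent of
      \<open>\<omega> + w\<close>, and \<open>T_descent\<close> allows it to replace whichever
      descent the recursion picked.\<close>
    moreover have "T (\<omega> + w) t = U \<omega> (T w t)" if \<omega>: "\<omega> \<in> \<Omega>" for \<omega> t
    proof -
      have \<omega>W: "\<omega> \<in> W" using \<omega> by (simp add: \<Omega>_iff)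
      let ?b = "isom_act \<omega> a"
      have "T (\<omega> + w) t = S ?b (T (affine_reflection ?b + (\<omega> + w)) t)"
      proof (rule T_descent)
        show "good u" if "u \<in> W" "len u < len (\<omega> + w)" for u
          using good that len_\<Omega>_plus[OF \<omega> w] by simp
        show "?b (iapply (\<omega> + w) alcove_point) < 0" using a by (simp add: isom_act_def)
      qed (use \<Omega>_simple[OF \<omega> a(1)] \<omega>W w in \<open>auto intro: W_plus\<close>)
      also have "affine_reflection ?b + (\<omega> + w) = \<omega> + ?w'"
        unfolding reflection_isom_act[OF a\<Phi> \<omega>W] by (simp only: add.assoc) (simp add: add.assoc[symmetric])
      also have "T (\<omega> + ?w') t = U \<omega> (T ?w' t)"
        using good[OF w'] \<omega> by (simp add: good_def)
      also have "S ?b (U \<omega> (T ?w' t)) = U \<omega> (T w t)"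
        by (simp add: T U_S[OF \<omega>W a\<Phi>])
      finally show ?thesis .
    qed
    moreover have "T w (D v t) = D (linear_part w v) (T w t) - lower_terms w v t" for v t
      unfolding T by (rule commutation_step[OF good w a])
    ultimately show ?thesis
      unfolding good_def using T_descent[OF good w] by blast
  qed
qed

text \<open>The bound \<open>len w + 2\<close> leaves the room for one ascent that
  \<open>T_reflection_less\<close> requires.\<close>

lemma T_simple_plus: "a \<in> \<Delta> \<Longrightarrow> w \<in> W \<Longrightarrow> T (affine_reflection a + w) t = S a (T w t)"
  using T_reflection_less[where n = "len w + 2", OF good_W] by simp

lemma T_\<Omega>_plus: "\<omega> \<in> \<Omega> \<Longrightarrow> w \<in> W \<Longrightarrow> T (\<omega> + w) t = U \<omega> (T w t)"
  using good_W[of w] by (simp add: good_def)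

lemma T_0: "T 0 = id"
  using T_\<Omega>[OF zero_in_\<Omega>] U_0 by auto

lemma T_simple: "a \<in> \<Delta> \<Longrightarrow> T (affine_reflection a) = S a"
  using T_simple_plus[OF _ W_0] by (auto simp: T_0)

text \<open>Descents are removed until an element of length zero remains, which is itself a
  generator.\<close>

lemma W_generated:
  assumes "w \<in> W" and "P 0" and step: "\<And>g w. g \<in> affine_reflection ` \<Delta> \<union> \<Omega> \<Longrightarrow> w \<in> W \<Longrightarrow> P w \<Longrightarrow> P (g + w)"
  shows "P w"
  using assms(1)
proof (induction "len w" arbitrary: w rule: less_induct)
  case less
  show ?case
  proof (cases "len w = 0")
    case True
    then show ?thesis using step[of w 0] less.prems \<open>P 0\<close> by (simp add: \<Omega>_iff W_0)
  next
    case False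
    then obtain a where a: "a \<in> \<Delta>" "a (iapply w alcove_point) < 0" using ex_descent[OF less.prems] by blast
    let ?w' = "affine_reflection a + w"
    have w': "?w' \<in> W" using W_simple_reflection[OF a(1)] less.prems by (rule W_plus)
    have "P ?w'" by (rule less.hyps[OF _ w']) (simp add: len_descent[OF less.prems a])
    then have "P (affine_reflection a + ?w')"
      using step[of "affine_reflection a" ?w'] a(1) w' by blast
    then show ?thesis
      using reflection_self_inverse(3)[OF simple_in_\<Phi>[OF a(1)], of w] by simp
  qed
qed

lemma T_plus:
  assumes g: "g \<in> W" and h: "h \<in> W"
  shows "T (g + h) = T g \<circ> T h"
proof -
  have "\<forall>t. T (g + h) t = T g (T h t)"
  proof (rule W_generated[OF g])
    fix g' g assume g': "g' \<in> affine_reflection ` \<Delta> \<union> \<Omega>" and g: "g \<in> W" and IH: "\<forall>t. T (g + h) t = T g (T h t)"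
    have gh: "g + h \<in> W" by (rule W_plus[OF g h])
    from g' show "\<forall>t. T (g' + g + h) t = T (g' + g) (T h t)"
      using IH by (auto simp: add.assoc T_simple_plus T_\<Omega>_plus g gh)
  qed (simp add: T_0)
  then show ?thesis by auto
qed

section \<open>Complexified derivatives and assembly of the homomorphism\<close>

definition \<phi> :: "'v cplxn \<Rightarrow> ('v canalytic, 'm) ctensor \<Rightarrow> ('v canalytic, 'm) ctensor"
  where "\<phi> v t = D (re_part v) t + \<i> *\<^sub>C D (im_part v) t"

lemma D_0: "D 0 t = 0"
  using D_scaleR[of 0 0 t] by simp

lemma D_diff: "D (u - v) t = D u t - D v t"
  using D_add[of "u - v" v t] by simp

lemma \<phi>_cplxn_of: "\<phi> (cplxn_of v) t = D v t"
  by (simp add: \<phi>_def D_0)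

lemma commuting_operators_\<phi>: "commuting_operators \<phi>"
proof (rule commuting_operators.intro)
  note simps = clinear_simps[OF clinear_D] scaleC_add_right scaleC_add_left scaleC_scaleC
  show "clinear (\<phi> v)" for v
    by (rule clinearI) (simp_all add: \<phi>_def simps mult_ac)
  show "\<phi> (u + v) t = \<phi> u t + \<phi> v t" for u v t
    by (simp add: \<phi>_def plus_cplxn_def D_add scaleC_add_right)
  show "\<phi> u (\<phi> v t) = \<phi> v (\<phi> u t)" for u v t
    by (simp add: \<phi>_def simps D_commute[of "re_part v"] D_commute[of "im_part v"])
  show "\<phi> (c *\<^sub>C v) t = c *\<^sub>C \<phi> v t" for c v t
  proof -
    have "\<phi> (c *\<^sub>C v) t = (complex_of_real (Re c) + \<i> * complex_of_real (Im c)) *\<^sub>C D (re_part v) t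
        + (\<i> * complex_of_real (Re c) - complex_of_real (Im c)) *\<^sub>C D (im_part v) t"
      by (simp add: \<phi>_def scaleC_cplxn_def D_diff D_add D_scaleR simps complex_vector.scale_left_diff_distrib)
    also have "complex_of_real (Re c) + \<i> * complex_of_real (Im c) = c"
      by (simp add: complex_eq_iff)
    also have "\<i> * complex_of_real (Re c) - complex_of_real (Im c) = c * \<i>"
      by (simp add: complex_eq_iff)
    finally show ?thesis by (simp add: \<phi>_def simps)
  qed
qed

lemma U_\<phi>: "g \<in> W \<Longrightarrow> U g (\<phi> v t) = \<phi> (cplxn_map (linear_part g) v) (U g t)"
  by (simp add: \<phi>_def cplxn_map_def clinear_simps[OF clinear_U] U_D)

lemma S_\<phi>:
  assumes a: "a \<in> \<Phi>"
  shows "S a (\<phi> v t) = \<phi> (cplxn_map (linear_part (affine_reflection a)) v) (S a t)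
    - (k a * cplxn_eval (blinfun_apply (gradient a)) v) *\<^sub>C t"
proof -
  let ?\<alpha> = "blinfun_apply (gradient a)"
  have "k a * cplxn_eval ?\<alpha> v = k a * complex_of_real (?\<alpha> (re_part v)) + \<i> * (k a * complex_of_real (?\<alpha> (im_part v)))"
    by (simp add: cplxn_eval_def Complex_eq algebra_simps)
  then show ?thesis
    by (simp add: \<phi>_def cplxn_map_def clinear_simps[OF clinear_S[OF a]] S_D[OF a] scaleC_add_left scaleC_scaleC
        complex_vector.scale_right_diff_distrib)
qed

text \<open>Links the reflection in the gradient, in which the relation of \<open>A(k)\<close> is
  written, to the linear part that occurs in \<open>S_\<phi>\<close>.\<close>

lemma gradient_reflection:
  assumes a: "a \<in> \<Phi>"
  shows "iapply (affine_reflection (affine_fun (gradient a) 0)) = linear_part (affine_reflection a)"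
proof
  fix v
  obtain \<alpha> m where \<alpha>: "a = affine_fun \<alpha> m" "\<alpha> \<in> R" "\<alpha> \<noteq> 0" using a by (rule \<Phi>_cases)
  then show "iapply (affine_reflection (affine_fun (gradient a) 0)) v = linear_part (affine_reflection a) v"
    by (simp add: reflection0_apply linear_part_reflection)
qed

end

theorem theorem4p11:
  fixes R X F :: "'v::euclidean_space dual set" and \<theta> :: "'v dual"
    and k :: "('v \<Rightarrow> real) \<Rightarrow> complex"
    and \<iota> :: "'v cplxn symalg \<Rightarrow> 'a::complex_algebra_1"
    and \<kappa> :: "('v isom \<Rightarrow>\<^sub>0 complex) \<Rightarrow> 'a"
    and \<rho> :: "'v isom \<Rightarrow> 'm::complex_vector \<Rightarrow> 'm"
  assumes "affine_root_data R X F \<theta>"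
    and "multiplicity_function R X k"
    and "group_module (ext_affine_weyl_group R X) \<rho>"
    and "is_algebra_A R X F \<theta> k \<iota> \<kappa>"
  shows "\<exists>!Q :: 'a \<Rightarrow> ('v canalytic, 'm) ctensor \<Rightarrow> ('v canalytic, 'm) ctensor.
    algebra_hom_End Q \<and>
    (\<forall>v. Q (\<iota> (sym_of (cplxn_of v))) = tensor_map (directional_deriv v) id) \<and>
    (\<forall>a\<in>simple_affine_roots F \<theta>.
      Q (\<kappa> (group_elt (affine_reflection a))) =
        (\<lambda>t. tensor_map (canalytic_act (affine_reflection a)) (\<rho> (affine_reflection a)) t
             - k a *\<^sub>C tensor_map (integral_op a) id t)) \<and>
    (\<forall>\<omega>\<in>length_zero_group R X F.
      Q (\<kappa> (group_elt \<omega>)) = tensor_map (canalytic_act \<omega>) (\<rho> \<omega>))"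
proof -
  interpret integral_representation R X F \<theta> k \<rho>
    using assms(1-3) by unfold_locales
  from assms(4) obtain \<mu> :: "('v cplxn symalg, 'v isom \<Rightarrow>\<^sub>0 complex) ctensor \<Rightarrow> 'a"
    where hom: "algebra_hom_on UNIV \<iota>" "algebra_hom_on (group_algebra W) \<kappa>"
      and \<mu>: "clinear \<mu>" "\<forall>p. \<forall>g\<in>group_algebra W. \<mu> (p \<otimes>\<^sub>C g) = \<iota> p * \<kappa> g"
        "bij_betw \<mu> (subspace_tensor UNIV (group_algebra W)) UNIV"
      and rel_s: "\<forall>a\<in>\<Delta>. \<forall>v. \<kappa> (group_elt (affine_reflection a)) * \<iota> (sym_of v)
        - \<iota> (sym_of (cplxn_map (iapply (affine_reflection (affine_fun (gradient a) 0))) v))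
          * \<kappa> (group_elt (affine_reflection a))
        = - (k a * cplxn_eval (blinfun_apply (gradient a)) v) *\<^sub>C 1"
      and rel_\<omega>: "\<forall>\<omega>\<in>\<Omega>. \<forall>v. \<kappa> (group_elt \<omega>) * \<iota> (sym_of v)
        = \<iota> (sym_of (cplxn_map (linear_part \<omega>) v)) * \<kappa> (group_elt \<omega>)"
    unfolding is_algebra_A_def Let_def by blast
  let ?G = "affine_reflection ` \<Delta> \<union> \<Omega>"
  interpret A: smash_product W \<iota> \<kappa> \<mu> ?G
  proof (rule smash_product.intro)
    show "?G \<subseteq> W" by (auto simp: \<Omega>_iff W_simple_reflection)
    show "P w" if "w \<in> W" "P 0" "\<And>g w. g \<in> ?G \<Longrightarrow> w \<in> W \<Longrightarrow> P w \<Longrightarrow> P (g + w)" for w and P :: "'v isom \<Rightarrow> bool"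
      using that by (rule W_generated)
  qed (use W_0 W_plus hom \<mu> in auto)
  let ?spec = "\<lambda>Q :: 'a \<Rightarrow> ('v canalytic, 'm) ctensor \<Rightarrow> ('v canalytic, 'm) ctensor.
    algebra_hom_End Q \<and> (\<forall>v. Q (\<iota> (sym_of (cplxn_of v))) = D v) \<and>
    (\<forall>a\<in>\<Delta>. Q (\<kappa> (group_elt (affine_reflection a))) = S a) \<and> (\<forall>\<omega>\<in>\<Omega>. Q (\<kappa> (group_elt \<omega>)) = U \<omega>)"
  have "\<exists>!Q. ?spec Q"
  proof (rule ex_ex1I)
    have "\<exists>Q. algebra_hom_End Q \<and> (\<forall>v. Q (\<iota> (sym_of v)) = \<phi> v) \<and> (\<forall>w\<in>W. Q (\<kappa> (group_elt w)) = T w)"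
    proof (rule A.ex_extension[OF commuting_operators_\<phi> _ T_0 T_plus])
      show "clinear (T w)" if "w \<in> W" for w using good_W[OF that] by (simp add: good_def)
      \<comment> \<open>For a simple reflection \<open>v'\<close> and \<open>c\<close> are read off
        from \<open>S_\<phi>\<close>, for an element of \<Omega> from \<open>U_\<phi>\<close> with
        \<open>c = 0\<close>.\<close>
      fix g v assume "g \<in> ?G"
      then consider a where "g = affine_reflection a" "a \<in> \<Delta>" | "g \<in> \<Omega>" by blast
      then show "\<exists>v' c. \<kappa> (group_elt g) * \<iota> (sym_of v) = \<iota> (sym_of v') * \<kappa> (group_elt g) + c *\<^sub>C 1 \<and>
        (\<forall>t. T g (\<phi> v t) = \<phi> v' (T g t) + c *\<^sub>C t)"
      proof cases
        case 1
        let ?v = "cplxn_map (linear_part g) v" and ?c = "- (k a * cplxn_eval (blinfun_apply (gradient a)) v)"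
        have "\<kappa> (group_elt g) * \<iota> (sym_of v) = \<iota> (sym_of ?v) * \<kappa> (group_elt g) + ?c *\<^sub>C 1"
          using rel_s 1 by (simp add: gradient_reflection simple_in_\<Phi> algebra_simps)
        moreover have "T g (\<phi> v t) = \<phi> ?v (T g t) + ?c *\<^sub>C t" for t
          using 1 by (simp add: T_simple S_\<phi> simple_in_\<Phi>)
        ultimately show ?thesis by blast
      next
        case 2
        have "\<kappa> (group_elt g) * \<iota> (sym_of v) = \<iota> (sym_of (cplxn_map (linear_part g) v)) * \<kappa> (group_elt g) + 0 *\<^sub>C 1"
          using rel_\<omega> 2 by simp
        moreover have "T g (\<phi> v t) = \<phi> (cplxn_map (linear_part g) v) (T g t) + 0 *\<^sub>C t" for t
          using 2 by (simp add: T_\<Omega> U_\<phi> \<Omega>_iff)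
        ultimately show ?thesis by blast
      qed
    qed
    then obtain Q where Q: "algebra_hom_End Q" "\<And>v. Q (\<iota> (sym_of v)) = \<phi> v" "\<And>w. w \<in> W \<Longrightarrow> Q (\<kappa> (group_elt w)) = T w"
      by blast
    have "Q (\<kappa> (group_elt (affine_reflection a))) = S a" if "a \<in> \<Delta>" for a
      using that by (simp add: Q(3) W_simple_reflection T_simple)
    moreover have "Q (\<kappa> (group_elt \<omega>)) = U \<omega>" if "\<omega> \<in> \<Omega>" for \<omega>
      using that T_\<Omega>[OF that] by (simp add: Q(3) \<Omega>_iff)
    moreover have "Q (\<iota> (sym_of (cplxn_of v))) = D v" for v
      unfolding Q(2) by (rule ext) (rule \<phi>_cplxn_of)
    ultimately show "\<exists>Q. ?spec Q" using Q(1) by blast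
  next
    fix Q Q' assume Q: "?spec Q" and Q': "?spec Q'"
    show "Q = Q'"
    proof (rule A.hom_unique)
      show "Q (\<kappa> (group_elt g)) = Q' (\<kappa> (group_elt g))" if "g \<in> ?G" for g
        using that Q Q' by auto
      fix v :: "'v cplxn"
      \<comment> \<open>The specification fixes \<open>Q\<close> on real vectors; complex linearity
        then determines it on the complexification.\<close>
      have "v = cplxn_of (re_part v) + \<i> *\<^sub>C cplxn_of (im_part v)"
        by (simp add: plus_cplxn_def scaleC_cplxn_def)
      then have v: "\<iota> (sym_of v) = \<iota> (sym_of (cplxn_of (re_part v))) + \<i> *\<^sub>C \<iota> (sym_of (cplxn_of (im_part v)))"
        by (metis sym_of_add sym_of_scaleC A.\<iota>_simps(2,4))
      show "Q (\<iota> (sym_of v)) = Q' (\<iota> (sym_of v))"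
        unfolding v using Q Q' by (simp add: algebra_hom_End_def)
    qed (use Q Q' in auto)
  qed
  then show ?thesis
    unfolding D_def U_def J_def S_def[abs_def] .
qed

end
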